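(* Let $u:\mathbb R^n\to\mathbb R$ be a bounded monotone layer solution of $T_\Phi[u]=f(u)$ in $\mathbb R^n$, with $F(1)=0$. Let $\alpha>0$ and $\beta\ge 2$ with $\beta>\alpha$, and suppose there is a constant $C>0$ with $\Phi'(t)\le C t^{\beta-1}$ for all $t\in\mathbb R^+$. Assume that the kernel $K$ satisfies one of the following two conditions, where $c$ is a function with $\lambda\le c\le\Lambda$ for some constants $0<\lambda\le\Lambda$: (1) (finite range) there are $0<r_*\le R_*$ such that $$\frac{c(z)}{|z|^{n+\alpha}}\mathbf 1_{\{|z|\le r_*\}}\le K(z)\le \frac{c(z)}{|z|^{n+\alpha}}\mathbf 1_{\{|z|\le R_*\}};$$ (2) (decay at infinity) there is $R_*>0$ such that $$K(z)=\frac{c(z)}{|z|^{n+\alpha}}\ \text{ when } |z|\le R_*,\qquad \int_{r<|z|<2r}|K(z)|\,dz\le C\,D(r)\ \text{ when } r>R_*,$$ where $0\le D\in C(\mathbb R^+)$, $\lim_{r\to\infty}D(r)=0$, and $D(r)<C r^{-\theta}$ for some $\theta>\beta$. Then $$\mathcal E_K^\Phi(u,B_R)\le C R^{n-1}\qquad\text{for } R>R_*,$$ where the positive constant $C$ is independent of $R$ but may depend on $R_*,\alpha,\beta$.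
   Context: The kernel $K:\mathbb R^n\to[0,\infty)$ is measurable and even, $K(z)=K(-z)$. The function $\Phi\in C^2(\mathbb R^+)$ satisfies $\Phi(0)=\Phi'(0)=0$ and $\Phi,\Phi',\Phi''>0$ in $\mathbb R^+$; $\Phi'$ is odd on $\mathbb R$ (so $\Phi$ and $\Phi''$ are extended as even functions). $F\in C^1(\mathbb R)$ and $f=F'$. $B_R$ is the ball of radius $R$ centered at the origin; $C$ denotes a generic positive constant. The operator is $$T_\Phi[u(x)]:=\lim_{\epsilon\to0}\int_{\mathbb R^n\setminus B_\epsilon(x)}\Phi'[u(x)-u(y)]\,K(y-x)\,dy .$$ The energy is $$\mathcal E_K^\Phi(u,\Omega):=\frac12\int_\Omega\int_\Omega\Phi[u(x)-u(y)]K(x-y)\,dy\,dx+\int_\Omega\int_{\mathbb R^n\setminus\Omega}\Phi[u(x)-u(y)]K(x-y)\,dy\,dx-\int_\Omega F(u)\,dx .$$ A layer solution of $T_\Phi[u]=f(u)$ is a bounded solution $u$ that is monotone in one direction, $\partial_{x_n}u>0$, and satisfies $\lim_{x_n\to\pm\infty}u(x',x_n)=\pm1$ for every $x'\in\mathbb R^{n-1}$, where $x=(x',x_n)$. No specific regularity class for $u$ is fixed; it is understood to be regular enough for the expressions written to make sense. *)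

theory Defs
  imports "HOL-Analysis.Analysis"
begin

text \<open>
  The space is \<open>real ^ 'n\<close>, of dimension \<open>CARD('n)\<close>. As \<open>'n\<close> carries no order, the direction
  \<open>x\<^sub>n\<close> is the coordinate with an arbitrary fixed index \<open>k\<close>, and \<open>with_coord k x t\<close> is the
  point \<open>(x', t)\<close>, where \<open>x'\<close> stands for the remaining coordinates of \<open>x\<close>.
\<close>

definition with_coord :: "'n \<Rightarrow> real ^ 'n \<Rightarrow> real \<Rightarrow> real ^ 'n" where
  "with_coord k x t = (\<chi> i. if i = k then t else x $ i)"

text \<open>
  \<open>\<Phi>\<close> denotes the even extension to the whole line, so that its derivative is odd. The positivity
  and the second-order regularity are required on the open half-line only.
\<close>

definition nonlocal_density :: "(real \<Rightarrow> real) \<Rightarrow> bool" where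
  "nonlocal_density \<Phi> \<longleftrightarrow>
     (\<forall>t. \<Phi> (- t) = \<Phi> t) \<and>
     (\<forall>t. \<Phi> differentiable (at t)) \<and>
     continuous_on UNIV (deriv \<Phi>) \<and>
     (\<forall>t>0. deriv \<Phi> differentiable (at t)) \<and>
     continuous_on {0<..} (deriv (deriv \<Phi>)) \<and>
     \<Phi> 0 = 0 \<and> deriv \<Phi> 0 = 0 \<and>
     (\<forall>t>0. \<Phi> t > 0 \<and> deriv \<Phi> t > 0 \<and> deriv (deriv \<Phi>) t > 0)"

definition nonlocal_kernel :: "(real ^ 'n \<Rightarrow> real) \<Rightarrow> bool" where
  "nonlocal_kernel K \<longleftrightarrow>
     K \<in> borel_measurable lebesgue \<and> (\<forall>z. 0 \<le> K z) \<and> (\<forall>z. K (- z) = K z)"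

definition T_integrand ::
  "(real \<Rightarrow> real) \<Rightarrow> (real ^ 'n \<Rightarrow> real) \<Rightarrow> (real ^ 'n \<Rightarrow> real) \<Rightarrow> real ^ 'n \<Rightarrow> real ^ 'n \<Rightarrow> real" where
  "T_integrand \<Phi> K u x y = deriv \<Phi> (u x - u y) * K (y - x)"

text \<open>
  \<open>has_T \<Phi> K u x v\<close>: the principal value defining \<open>T\<^sub>\<Phi>[u(x)]\<close> exists and equals \<open>v\<close>. The
  integrability clause excludes the convention that a non-integrable function has integral zero.
\<close>

definition has_T ::
  "(real \<Rightarrow> real) \<Rightarrow> (real ^ 'n \<Rightarrow> real) \<Rightarrow> (real ^ 'n \<Rightarrow> real) \<Rightarrow> real ^ 'n \<Rightarrow> real \<Rightarrow> bool" where
  "has_T \<Phi> K u x v \<longleftrightarrow>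
     (\<forall>\<epsilon>>0. set_integrable lebesgue (- ball x \<epsilon>) (T_integrand \<Phi> K u x)) \<and>
     ((\<lambda>\<epsilon>. LINT y:(- ball x \<epsilon>)|lebesgue. T_integrand \<Phi> K u x y) \<longlongrightarrow> v) (at_right 0)"

text \<open>
  The only regularity required of \<open>u\<close> is continuity, existence of the partial derivative in the
  direction of monotonicity, and pointwise existence of the principal value.
\<close>

definition layer_solution ::
  "'n \<Rightarrow> (real \<Rightarrow> real) \<Rightarrow> (real ^ 'n \<Rightarrow> real) \<Rightarrow> (real \<Rightarrow> real) \<Rightarrow> (real ^ 'n \<Rightarrow> real) \<Rightarrow> bool" where
  "layer_solution k \<Phi> K f u \<longleftrightarrow>
     bounded (range u) \<and>
     continuous_on UNIV u \<and>
     (\<forall>x. has_T \<Phi> K u x (f (u x))) \<and>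
     (\<forall>x. \<exists>d>0. ((\<lambda>t. u (with_coord k x t)) has_real_derivative d) (at (x $ k))) \<and>
     (\<forall>x. ((\<lambda>t. u (with_coord k x t)) \<longlongrightarrow> 1) at_top) \<and>
     (\<forall>x. ((\<lambda>t. u (with_coord k x t)) \<longlongrightarrow> - 1) at_bot)"

text \<open>
  The interaction part of the energy has a nonnegative integrand and is taken in \<open>ennreal\<close>, so
  divergence shows up as \<open>\<infinity>\<close>; accordingly the energy takes values in \<open>ereal\<close>.
\<close>

definition interaction ::
  "(real \<Rightarrow> real) \<Rightarrow> (real ^ 'n \<Rightarrow> real) \<Rightarrow> (real ^ 'n \<Rightarrow> real) \<Rightarrow>
   (real ^ 'n) set \<Rightarrow> (real ^ 'n) set \<Rightarrow> ennreal" where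
  "interaction \<Phi> K u A B =
     (\<integral>\<^sup>+x\<in>A. (\<integral>\<^sup>+y\<in>B. ennreal (\<Phi> (u x - u y) * K (x - y)) \<partial>lebesgue) \<partial>lebesgue)"

definition energy ::
  "(real \<Rightarrow> real) \<Rightarrow> (real ^ 'n \<Rightarrow> real) \<Rightarrow> (real \<Rightarrow> real) \<Rightarrow> (real ^ 'n \<Rightarrow> real) \<Rightarrow>
   (real ^ 'n) set \<Rightarrow> ereal" where
  "energy \<Phi> K F u \<Omega> =
     enn2ereal (interaction \<Phi> K u \<Omega> \<Omega> / 2 + interaction \<Phi> K u \<Omega> (- \<Omega>))
     - ereal (LINT x:\<Omega>|lebesgue. F (u x))"

text \<open>
  In the two kernel conditions the origin is left out, since \<open>c(z) / |z|\<^bsup>n+\<alpha>\<^esup>\<close> has no meaning there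
  (and would be \<open>0\<close> by the convention on division).
\<close>

definition finite_range_kernel ::
  "real \<Rightarrow> (real ^ 'n \<Rightarrow> real) \<Rightarrow> real \<Rightarrow> real \<Rightarrow> (real ^ 'n \<Rightarrow> real) \<Rightarrow> bool" where
  "finite_range_kernel \<alpha> c r\<^sub>0 R\<^sub>0 K \<longleftrightarrow>
     0 < r\<^sub>0 \<and> r\<^sub>0 \<le> R\<^sub>0 \<and>
     (\<forall>z. z \<noteq> 0 \<longrightarrow>
        c z / norm z powr (real CARD('n) + \<alpha>) * indicator {z. norm z \<le> r\<^sub>0} z \<le> K z \<and>
        K z \<le> c z / norm z powr (real CARD('n) + \<alpha>) * indicator {z. norm z \<le> R\<^sub>0} z)"

text \<open>
  The bound on \<open>D\<close> by a power is required only for \<open>r > R\<^sub>0\<close>, the range in which \<open>D\<close> enters.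
\<close>

definition decaying_kernel ::
  "real \<Rightarrow> real \<Rightarrow> (real ^ 'n \<Rightarrow> real) \<Rightarrow> real \<Rightarrow> (real ^ 'n \<Rightarrow> real) \<Rightarrow> bool" where
  "decaying_kernel \<alpha> \<beta> c R\<^sub>0 K \<longleftrightarrow>
     0 < R\<^sub>0 \<and>
     (\<forall>z. z \<noteq> 0 \<and> norm z \<le> R\<^sub>0 \<longrightarrow> K z = c z / norm z powr (real CARD('n) + \<alpha>)) \<and>
     (\<exists>D C\<^sub>1 C\<^sub>2 \<theta>. C\<^sub>1 > 0 \<and> C\<^sub>2 > 0 \<and> \<theta> > \<beta> \<and>
        continuous_on {0<..} D \<and> (\<forall>r>0. 0 \<le> D r) \<and> (D \<longlongrightarrow> 0) at_top \<and>
        (\<forall>r>R\<^sub>0. D r < C\<^sub>2 * r powr (- \<theta>)) \<and>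
        (\<forall>r>R\<^sub>0. (\<integral>\<^sup>+z\<in>{z. r < norm z \<and> norm z < 2 * r}. ennreal \<bar>K z\<bar> \<partial>lebesgue)
                  \<le> ennreal (C\<^sub>1 * D r)))"

end

theory Submission
  imports Defs
begin

text \<open>
  If \<open>u\<close> were Lipschitz, one could differentiate the energy of the translates of \<open>u\<close> in the direction
  \<open>e\<^sub>k\<close> and integrate. Here \<open>u\<close> is only continuous and solves the equation pointwise in the sense of
  principal values, so the proof uses minimality instead: the translates \<open>u(\<cdot> + t e\<^sub>k)\<close> are ordered
  solutions that increase to \<open>1\<close>, and such a family makes \<open>u\<close> a minimiser. Concretely, let \<open>\<psi>\<close> be a
  Lipschitz cutoff with \<open>\<psi> = 1\<close> on \<open>B\<^bsub>R+1\<^esub>\<close> and \<open>\<psi> = -1\<close> outside \<open>B\<^bsub>R+2\<^esub>\<close>. Along the path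
  \<open>v\<^sub>t = min \<psi> u(\<cdot> + t e\<^sub>k)\<close>, which runs from \<open>min \<psi> u\<close> to \<open>\<psi>\<close>, the energy does not decrease: where
  \<open>v\<^sub>t\<close> moves it coincides with the translate, and everywhere it lies below it, so by monotonicity of \<open>\<Phi>'\<close>
  the operator at such a point is at least that of the translate, which equals \<open>f(v\<^sub>t)\<close>. Hence the
  energy of \<open>min \<psi> u\<close> is at most that of \<open>\<psi>\<close> (lemma \<open>minimality\<close>).

  Convexity of \<open>\<Phi>\<close> replaces the derivative along the path by finite steps (\<open>convexity_step\<close>), carried
  out for the kernel cut off near the origin, where all integrals converge absolutely. Removing the
  truncation needs a lower bound for the truncated operators, uniform in the truncation, which a merely
  continuous \<open>u\<close> does not give. Therefore \<open>u\<close> is replaced by its inf-convolution \<open>w\<close>. Because the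
  operator commutes with translations, \<open>w\<close> is still an approximate supersolution
  (\<open>infconv_touching\<close>), and only the supersolution inequality is used above. Being semiconcave, \<open>w\<close>
  satisfies the uniform lower bound (\<open>infconv_op_bounded_below\<close>). Lower semicontinuity of the energy
  then allows the return from \<open>w\<close> to \<open>u\<close>.

  The lower bound amounts to bounding \<open>\<integral> \<Phi>'(p \<cdot> z + q |z|\<^sup>2) K(z) dz\<close> near the origin. The odd part
  cancels, and what is left on the ball of radius \<open>r\<close> is of order \<open>r\<^bsup>n+\<beta>\<^esup>\<close> because the quadratic term
  only shifts the centre of the ball (\<open>tilted_ball_integral_le\<close>). This beats the singularity since
  \<open>\<alpha> < \<beta>\<close>; the condition \<open>\<beta> \<ge> 2\<close> keeps the bound uniform as \<open>p\<close> tends to \<open>0\<close>.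

  Both conditions on \<open>K\<close> imply that \<open>(1 + |z|) min 1 |z|\<^sup>\<beta>\<close> is integrable against \<open>K(z) dz\<close>
  (\<open>finite_kernel_moment\<close>). A jump \<open>z\<close> costs \<open>\<psi>\<close> at most \<open>C min 1 |z|\<^sup>\<beta>\<close>, and only at points of an
  annulus of width of order \<open>1 + |z|\<close>, so the energy of \<open>\<psi>\<close> is of order \<open>R\<^bsup>n-1\<^esup>\<close>. The same moment
  controls the interactions of \<open>B\<^sub>R\<close> with the complement of \<open>B\<^bsub>R+1\<^esub>\<close>, where \<open>u\<close> and \<open>min \<psi> u\<close> differ,
  and the potential terms differ only on the annulus between \<open>B\<^sub>R\<close> and \<open>B\<^bsub>R+2\<^esub>\<close>, as \<open>F(1) = 0\<close>.

  The kernel is treated throughout as the symmetric measure \<open>\<nu>(dz) = K(z) dz\<close>, with \<open>y = x + z\<close>.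
\<close>

section \<open>Convexity of the truncated energy\<close>

lemma lborel_translate: "distr lborel borel (\<lambda>x. x + c) = (lborel :: 'a::euclidean_space measure)"
proof -
  have "(\<lambda>x. x + c) = (+) c" by (auto simp: add.commute)
  then show ?thesis using lborel_distr_plus[of c] by simp
qed

lemma lborel_reflect: "distr lborel borel uminus = (lborel :: 'a::euclidean_space measure)"
  using lborel_affine[of "-1::real" "0::'a"] by (simp add: density_1)

lemma integral_reflect_symmetric:
  fixes f :: "'a::euclidean_space \<Rightarrow> real"
  assumes "sets N = sets borel" "distr N borel uminus = N" and [measurable]: "f \<in> borel_measurable borel"
  shows "(\<integral>z. f (- z) \<partial>N) = (\<integral>z. f z \<partial>N)"
proof -
  note [measurable_cong] = assms(1)
  have "(\<integral>z. f z \<partial>N) = (\<integral>z. f z \<partial>distr N borel uminus)" using assms(2) by simp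
  also have "\<dots> = (\<integral>z. f (- z) \<partial>N)" by (rule integral_distr) auto
  finally show ?thesis by simp
qed

lemma integral_translate:
  fixes f :: "'a::euclidean_space \<Rightarrow> real"
  assumes [measurable]: "f \<in> borel_measurable borel"
  shows "(\<integral>x. f (x + c) \<partial>lborel) = (\<integral>x. f x \<partial>lborel)"
proof -
  have "(\<integral>x. f x \<partial>lborel) = (\<integral>x. f x \<partial>distr lborel borel (\<lambda>x. x + c))"
    by (simp add: lborel_translate)
  also have "\<dots> = (\<integral>x. f (x + c) \<partial>lborel)" by (rule integral_distr) auto
  finally show ?thesis by simp
qed

lemma nn_integral_reflect_symmetric:
  assumes "sets N = sets borel" "distr N borel uminus = N" and [measurable]: "f \<in> borel_measurable borel"
  shows "(\<integral>\<^sup>+z. f (- z) \<partial>N) = (\<integral>\<^sup>+z. f (z::'a::euclidean_space) \<partial>N)"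
proof -
  note [measurable_cong] = assms(1)
  have "(\<integral>\<^sup>+z. f z \<partial>N) = (\<integral>\<^sup>+z. f z \<partial>distr N borel uminus)" using assms(2) by simp
  also have "\<dots> = (\<integral>\<^sup>+z. f (- z) \<partial>N)" by (rule nn_integral_distr) auto
  finally show ?thesis by simp
qed

lemma nn_integral_translate:
  assumes [measurable]: "f \<in> borel_measurable borel"
  shows "(\<integral>\<^sup>+x. f (x + c) \<partial>lborel) = (\<integral>\<^sup>+x. f (x::'a::euclidean_space) \<partial>lborel)"
proof -
  have "(\<integral>\<^sup>+x. f x \<partial>lborel) = (\<integral>\<^sup>+x. f x \<partial>distr lborel borel (\<lambda>x. x + c))"
    by (simp add: lborel_translate)
  also have "\<dots> = (\<integral>\<^sup>+x. f (x + c) \<partial>lborel)" by (rule nn_integral_distr) auto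
  finally show ?thesis by simp
qed

text \<open>
  At fixed \<open>z\<close> the integrand lives on the union of the ball and its translate by \<open>- z\<close>, whose volume
  is bounded independently of \<open>z\<close>; finiteness of \<open>N\<close> does the rest.
\<close>

lemma integrable_compact_interaction:
  fixes h :: "'a::euclidean_space \<times> 'a \<Rightarrow> real"
  assumes N: "finite_measure N" "sets N = sets borel"
    and h: "h \<in> borel_measurable (lborel \<Otimes>\<^sub>M N)"
    and bd: "\<And>x z. \<bar>h (x, z)\<bar> \<le> c"
    and supp: "\<And>x z. x \<notin> ball 0 r \<Longrightarrow> x + z \<notin> ball 0 r \<Longrightarrow> h (x, z) = 0"
  shows "integrable (lborel \<Otimes>\<^sub>M N) h"
proof (rule integrableI_bounded)
  interpret N: finite_measure N by fact
  interpret P: pair_sigma_finite lborel N ..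
  note [measurable_cong] = N(2)
  have c: "0 \<le> c" using bd[of 0 0] by linarith
  let ?B = "ball (0::'a) r"
  define b where "b x = (indicator ?B x :: ennreal)" for x
  have [measurable]: "b \<in> borel_measurable borel" by (auto simp: b_def[abs_def] intro!: borel_measurable_indicator)
  have "(\<integral>\<^sup>+p. norm (h p) \<partial>(lborel \<Otimes>\<^sub>M N))
      \<le> (\<integral>\<^sup>+p. ennreal c * (b (fst p) + b (fst p + snd p)) \<partial>(lborel \<Otimes>\<^sub>M N))"
  proof (rule nn_integral_mono)
    fix p :: "'a \<times> 'a"
    obtain x z where p: "p = (x, z)" by (cases p)
    have "ennreal \<bar>h p\<bar> \<le> ennreal c" using bd[of x z] unfolding p by (intro ennreal_leI) simp
    moreover have "ennreal c \<le> ennreal c * (b (fst p) + b (fst p + snd p))"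
      if "x \<in> ?B \<or> x + z \<in> ?B"
      using that by (auto simp: p b_def indicator_def distrib_left)
    ultimately show "ennreal (norm (h p)) \<le> ennreal c * (b (fst p) + b (fst p + snd p))"
      using supp[of x z] by (cases "x \<in> ?B \<or> x + z \<in> ?B") (auto simp: p)
  qed
  also have "\<dots> = ennreal c * ((\<integral>\<^sup>+p. b (fst p) \<partial>(lborel \<Otimes>\<^sub>M N))
      + (\<integral>\<^sup>+p. b (fst p + snd p) \<partial>(lborel \<Otimes>\<^sub>M N)))"
    by (subst nn_integral_cmult) (auto simp: nn_integral_add)
  also have "(\<integral>\<^sup>+p. b (fst p) \<partial>(lborel \<Otimes>\<^sub>M N)) = (\<integral>\<^sup>+z. (\<integral>\<^sup>+x. b x \<partial>lborel) \<partial>N)"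
    by (subst P.nn_integral_snd[symmetric]) auto
  also have "(\<integral>\<^sup>+p. b (fst p + snd p) \<partial>(lborel \<Otimes>\<^sub>M N)) = (\<integral>\<^sup>+z. (\<integral>\<^sup>+x. b (x + z) \<partial>lborel) \<partial>N)"
    by (subst P.nn_integral_snd[symmetric]) auto
  also have "\<dots> = (\<integral>\<^sup>+z. (\<integral>\<^sup>+x. b x \<partial>lborel) \<partial>N)"
    by (subst nn_integral_translate) auto
  also have "ennreal c * ((\<integral>\<^sup>+z. (\<integral>\<^sup>+x. b x \<partial>lborel) \<partial>N) + (\<integral>\<^sup>+z. (\<integral>\<^sup>+x. b x \<partial>lborel) \<partial>N)) < \<infinity>"
    using emeasure_lborel_ball_finite[of 0 r] N.emeasure_finite
    by (auto simp: b_def ennreal_mult_less_top less_top[symmetric] ennreal_mult_eq_top_iff)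
  finally show "(\<integral>\<^sup>+p. norm (h p) \<partial>(lborel \<Otimes>\<^sub>M N)) < \<infinity>" .
qed fact

text \<open>
  One step of the path argument. The tangent inequality for \<open>\<Phi>\<close> at the increments of \<open>v\<close> is integrated
  over all pairs; the resulting double integral of \<open>G(v(x) - v(x+z)) (\<phi>(x) - \<phi>(x+z))\<close> with
  \<open>\<phi> = v' - v\<close> splits into two halves that the substitution \<open>(x, z) \<mapsto> (x + z, - z)\<close> exchanges,
  since \<open>G\<close> is odd and \<open>N\<close> symmetric.
\<close>

lemma convexity_step:
  fixes v v' :: "'a::euclidean_space \<Rightarrow> real"
  assumes N: "finite_measure N" "sets N = sets borel" and sym: "distr N borel uminus = N"
    and [measurable]: "v \<in> borel_measurable borel" "v' \<in> borel_measurable borel"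
    and v: "\<And>x. \<bar>v x\<bar> \<le> 1" "\<And>x. x \<notin> ball 0 r \<Longrightarrow> v x = -1"
    and v': "\<And>x. \<bar>v' x\<bar> \<le> 1" "\<And>x. x \<notin> ball 0 r \<Longrightarrow> v' x = -1"
    and Phi: "continuous_on UNIV \<Phi>" "\<Phi> 0 = 0"
    and G: "continuous_on UNIV G" "\<And>t. G (- t) = - G t"
    and conv: "\<And>a b. \<Phi> a + G a * (b - a) \<le> \<Phi> b"
  shows "integrable (lborel \<Otimes>\<^sub>M N) (\<lambda>(x, z). \<Phi> (v x - v (x + z)))"
    and "integrable lborel (\<lambda>x. (v' x - v x) * (\<integral>z. G (v x - v (x + z)) \<partial>N))"
    and "(\<integral>(x, z). \<Phi> (v x - v (x + z)) \<partial>(lborel \<Otimes>\<^sub>M N))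
          + 2 * (\<integral>x. (v' x - v x) * (\<integral>z. G (v x - v (x + z)) \<partial>N) \<partial>lborel)
        \<le> (\<integral>(x, z). \<Phi> (v' x - v' (x + z)) \<partial>(lborel \<Otimes>\<^sub>M N))"
proof -
  interpret N: finite_measure N by fact
  interpret P: pair_sigma_finite lborel N ..
  note [measurable_cong] = N(2)
  have [measurable]: "\<Phi> \<in> borel_measurable borel" "G \<in> borel_measurable borel"
    using Phi G by (auto intro: borel_measurable_continuous_onI)
  have G0: "G 0 = 0" using G(2)[of 0] by simp
  let ?f = "\<lambda>x. v' x - v x"
  obtain M where M: "\<And>t. \<bar>t\<bar> \<le> 2 \<Longrightarrow> \<bar>\<Phi> t\<bar> \<le> M" "\<And>t. \<bar>t\<bar> \<le> 2 \<Longrightarrow> \<bar>G t\<bar> \<le> M"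
  proof -
    have "compact (\<Phi> ` {-2..2})" "compact (G ` {-2..2})"
      using Phi(1) G(1) by (auto intro!: compact_continuous_image intro: continuous_on_subset)
    then obtain a b where "\<forall>x\<in>\<Phi> ` {-2..2}. norm x \<le> a" "\<forall>x\<in>G ` {-2..2}. norm x \<le> b"
      by (meson bounded_iff compact_imp_bounded)
    then have "\<bar>\<Phi> t\<bar> \<le> a" "\<bar>G t\<bar> \<le> b" if "\<bar>t\<bar> \<le> 2" for t
      using that by (auto dest!: bspec[where x = t])
    then show ?thesis by (intro that[of "max a b"]) (auto simp: le_max_iff_disj)
  qed
  have M0: "0 \<le> M" using M(1)[of 0] by simp
  have d: "\<bar>v x - v y\<bar> \<le> 2" "\<bar>v' x - v' y\<bar> \<le> 2" "\<bar>?f x\<bar> \<le> 2" for x y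
    using v(1)[of x] v(1)[of y] v'(1)[of x] v'(1)[of y] by linarith+
  show i1: "integrable (lborel \<Otimes>\<^sub>M N) (\<lambda>(x, z). \<Phi> (v x - v (x + z)))"
    by (rule integrable_compact_interaction[OF N, where c = M and r = r])
       (use M d v(2) Phi(2) in auto)
  have i2: "integrable (lborel \<Otimes>\<^sub>M N) (\<lambda>(x, z). \<Phi> (v' x - v' (x + z)))"
    by (rule integrable_compact_interaction[OF N, where c = M and r = r])
       (use M d v'(2) Phi(2) in auto)
  have b: "\<bar>?f x * G (v y - v z)\<bar> \<le> 2 * M" for x y z
    unfolding abs_mult using d M M0 by (intro mult_mono) auto
  have j1: "integrable (lborel \<Otimes>\<^sub>M N) (\<lambda>(x, z). ?f x * G (v x - v (x + z)))"
    by (rule integrable_compact_interaction[OF N, where c = "2 * M" and r = r])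
       (use b v(2) v'(2) G0 in auto)
  have j2: "integrable (lborel \<Otimes>\<^sub>M N) (\<lambda>(x, z). ?f (x + z) * G (v x - v (x + z)))"
    by (rule integrable_compact_interaction[OF N, where c = "2 * M" and r = r])
       (use b v(2) v'(2) G0 in auto)
  have e1: "(\<integral>(x, z). ?f x * G (v x - v (x + z)) \<partial>(lborel \<Otimes>\<^sub>M N))
      = (\<integral>x. ?f x * (\<integral>z. G (v x - v (x + z)) \<partial>N) \<partial>lborel)"
    using P.integral_fst[OF j1] by simp
  show "integrable lborel (\<lambda>x. ?f x * (\<integral>z. G (v x - v (x + z)) \<partial>N))"
    using P.integrable_fst[OF j1] by simp
  have "(\<integral>(x, z). ?f (x + z) * G (v x - v (x + z)) \<partial>(lborel \<Otimes>\<^sub>M N))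
      = (\<integral>z. (\<integral>x. ?f (x + z) * G (v x - v (x + z)) \<partial>lborel) \<partial>N)"
    using P.integral_snd[OF j2] by simp
  also have "\<dots> = (\<integral>z. (\<integral>x. ?f x * G (v (x - z) - v x) \<partial>lborel) \<partial>N)"
    using integral_translate[of "\<lambda>x. ?f x * G (v (x - z) - v x)" z for z] by simp
  also have "\<dots> = (\<integral>z. - (\<integral>x. ?f x * G (v x - v (x - z)) \<partial>lborel) \<partial>N)"
  proof -
    have "?f x * G (v (x - z) - v x) = - (?f x * G (v x - v (x - z)))" for x z
      using G(2)[of "v x - v (x - z)"] by simp
    then show ?thesis by simp
  qed
  also have "\<dots> = (\<integral>z. - (\<integral>x. ?f x * G (v x - v (x + z)) \<partial>lborel) \<partial>N)"
    using integral_reflect_symmetric[OF N(2) sym, of "\<lambda>z. - (\<integral>x. ?f x * G (v x - v (x + z)) \<partial>lborel)"]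
    by simp
  also have "\<dots> = - (\<integral>(x, z). ?f x * G (v x - v (x + z)) \<partial>(lborel \<Otimes>\<^sub>M N))"
    using P.integral_snd[OF j1] by simp
  finally have e2: "(\<integral>(x, z). ?f (x + z) * G (v x - v (x + z)) \<partial>(lborel \<Otimes>\<^sub>M N))
      = - (\<integral>(x, z). ?f x * G (v x - v (x + z)) \<partial>(lborel \<Otimes>\<^sub>M N))" .
  have "(\<integral>p. (case p of (x, z) \<Rightarrow> \<Phi> (v x - v (x + z))) + ((case p of (x, z) \<Rightarrow> ?f x * G (v x - v (x + z)))
        - (case p of (x, z) \<Rightarrow> ?f (x + z) * G (v x - v (x + z)))) \<partial>(lborel \<Otimes>\<^sub>M N))
      \<le> (\<integral>(x, z). \<Phi> (v' x - v' (x + z)) \<partial>(lborel \<Otimes>\<^sub>M N))"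
  proof (rule integral_mono)
    fix p :: "'a \<times> 'a"
    obtain x z where p: "p = (x, z)" by (cases p)
    show "(case p of (x, z) \<Rightarrow> \<Phi> (v x - v (x + z))) + ((case p of (x, z) \<Rightarrow> ?f x * G (v x - v (x + z)))
        - (case p of (x, z) \<Rightarrow> ?f (x + z) * G (v x - v (x + z)))) \<le> (case p of (x, z) \<Rightarrow> \<Phi> (v' x - v' (x + z)))"
      using conv[of "v x - v (x + z)" "v' x - v' (x + z)"] by (simp add: p algebra_simps)
  qed (intro i1 i2 j1 j2 Bochner_Integration.integrable_add Bochner_Integration.integrable_diff)+
  then show "(\<integral>(x, z). \<Phi> (v x - v (x + z)) \<partial>(lborel \<Otimes>\<^sub>M N))
          + 2 * (\<integral>x. ?f x * (\<integral>z. G (v x - v (x + z)) \<partial>N) \<partial>lborel)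
        \<le> (\<integral>(x, z). \<Phi> (v' x - v' (x + z)) \<partial>(lborel \<Otimes>\<^sub>M N))"
    unfolding Bochner_Integration.integral_add[OF i1 Bochner_Integration.integrable_diff[OF j1 j2]]
      Bochner_Integration.integral_diff[OF j1 j2] e2 e1 by simp
qed

section \<open>Regularisation by inf-convolution\<close>

text \<open>
  A point at which the infimum of \<open>u y + q |y - x|\<^sup>2\<close> over \<open>y\<close> is attained; for bounded continuous
  \<open>u\<close> and \<open>q > 0\<close> it exists, so the inf-convolution below can be written as a minimum.
\<close>

definition infconv_point :: "real \<Rightarrow> ('a::euclidean_space \<Rightarrow> real) \<Rightarrow> 'a \<Rightarrow> 'a" where
  "infconv_point q u x =
     (SOME m. \<forall>y. u m + q * (norm (m - x))\<^sup>2 \<le> u y + q * (norm (y - x))\<^sup>2)"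

definition infconv :: "real \<Rightarrow> ('a::euclidean_space \<Rightarrow> real) \<Rightarrow> 'a \<Rightarrow> real" where
  "infconv q u x = u (infconv_point q u x) + q * (norm (infconv_point q u x - x))\<^sup>2"

context
  fixes u :: "'a::euclidean_space \<Rightarrow> real" and q :: real
  assumes u: "continuous_on UNIV u" "\<And>x. \<bar>u x\<bar> \<le> 1" and q: "q > 0"
begin

lemma infconv_le: "infconv q u x \<le> u y + q * (norm (y - x))\<^sup>2"
proof -
  let ?g = "\<lambda>y. u y + q * (norm (y - x))\<^sup>2"
  \<comment> \<open>At distance beyond s the penalty exceeds the oscillation of u, so the infimum is attained in the
    ball of radius s.\<close>
  define s where "s = sqrt (2 / q)"
  have s: "s \<ge> 0" "q * s\<^sup>2 = 2" using q by (auto simp: s_def)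
  have "continuous_on (cball x s) ?g"
    by (intro continuous_intros continuous_on_subset[OF u(1)]) auto
  then obtain m where m: "m \<in> cball x s" "\<And>y. y \<in> cball x s \<Longrightarrow> ?g m \<le> ?g y"
    using continuous_attains_inf[OF compact_cball, of x s ?g] s by fastforce
  have "?g m \<le> ?g y" for y
  proof (cases "y \<in> cball x s")
    case False
    then have "s\<^sup>2 \<le> (norm (y - x))\<^sup>2"
      using s by (intro power_mono) (auto simp: dist_norm norm_minus_commute)
    then have "q * s\<^sup>2 \<le> q * (norm (y - x))\<^sup>2" using q by simp
    moreover have "?g m \<le> ?g x" using m(2)[of x] s by simp
    ultimately show ?thesis using u(2)[of x] u(2)[of y] s by simp
  qed (use m in blast)
  then have "\<exists>m. \<forall>y. ?g m \<le> ?g y" by blast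
  from someI_ex[OF this] show ?thesis unfolding infconv_def infconv_point_def by blast
qed

lemma infconv_bounds: "- 1 \<le> infconv q u x" "infconv q u x \<le> u x"
    "u (infconv_point q u x) \<le> infconv q u x"
  using infconv_le[of x x] u(2)[of "infconv_point q u x"] q
  by (auto simp: infconv_def intro: add_increasing2)

lemma infconv_point_near: "norm (infconv_point q u x - x) \<le> sqrt (2 / q)"
proof -
  have "q * (norm (infconv_point q u x - x))\<^sup>2 \<le> 2"
    using infconv_le[of x x] u(2)[of "infconv_point q u x"] u(2)[of x]
    unfolding infconv_def by simp
  then show ?thesis using q by (intro real_le_rsqrt) (simp add: field_simps)
qed

text \<open>
  Translating \<open>u\<close> by the vector from \<open>x\<close> to its minimising point, and adding a constant, gives a
  function that touches the inf-convolution from above at \<open>x\<close>. Any operator that is monotone in the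
  increments and invariant under translations therefore takes at \<open>x\<close> a value no smaller than that of
  \<open>u\<close> at the minimising point.
\<close>

lemma infconv_touching:
  "u (infconv_point q u x) - u (infconv_point q u x + z) \<le> infconv q u x - infconv q u (x + z)"
  using infconv_le[of "x + z" "infconv_point q u x + z"] unfolding infconv_def by simp

text \<open>
  Using the minimising point of \<open>x\<close> as a competitor at \<open>x + z\<close> bounds the inf-convolution above by a
  paraboloid with opening \<open>q\<close>. Its slope is controlled by the distance to the minimising point.
\<close>

lemma infconv_semiconcave:
  "infconv q u (x + z) - infconv q u x \<le> (- (2 * q) *\<^sub>R (infconv_point q u x - x)) \<bullet> z + q * (norm z)\<^sup>2"
proof -
  let ?m = "infconv_point q u x"
  have "(norm (?m - (x + z)))\<^sup>2 = (norm (?m - x))\<^sup>2 - 2 * ((?m - x) \<bullet> z) + (norm z)\<^sup>2"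
    unfolding power2_norm_eq_inner by (simp add: algebra_simps inner_commute)
  then have "q * (norm (?m - (x + z)))\<^sup>2 = q * (norm (?m - x))\<^sup>2 - 2 * q * ((?m - x) \<bullet> z) + q * (norm z)\<^sup>2"
    by (simp only:) (simp add: algebra_simps)
  then show ?thesis using infconv_le[of "x + z" ?m] by (simp add: infconv_def[of q u x])
qed

lemma infconv_slope: "norm (- (2 * q) *\<^sub>R (infconv_point q u x - x)) \<le> 2 * q * sqrt (2 / q)"
  using infconv_point_near[of x] q by simp

lemma continuous_infconv: "continuous_on UNIV (infconv q u)"
proof -
  let ?L = "2 * q * sqrt (2 / q)"
  have one: "infconv q u (x + z) - infconv q u x \<le> ?L * norm z + q * (norm z)\<^sup>2" for x z
  proof -
    have "(- (2 * q) *\<^sub>R (infconv_point q u x - x)) \<bullet> z \<le> ?L * norm z"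
      by (rule order_trans[OF norm_cauchy_schwarz]) (intro mult_right_mono infconv_slope norm_ge_zero)
    then show ?thesis using infconv_semiconcave[of x z] by linarith
  qed
  have two: "\<bar>infconv q u y - infconv q u x\<bar> \<le> ?L * norm (y - x) + q * (norm (y - x))\<^sup>2" for x y
    using one[of x "y - x"] one[of y "x - y"] by (simp add: abs_le_iff norm_minus_commute)
  have "(infconv q u \<longlongrightarrow> infconv q u x) (at x)" for x
  proof -
    have "((\<lambda>y. ?L * norm (y - x) + q * (norm (y - x))\<^sup>2) \<longlongrightarrow> ?L * norm (x - x) + q * (norm (x - x))\<^sup>2) (at x)"
      by (intro tendsto_intros)
    then have "((\<lambda>y. ?L * norm (y - x) + q * (norm (y - x))\<^sup>2) \<longlongrightarrow> 0) (at x)" by simp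
    then have "((\<lambda>y. infconv q u y - infconv q u x) \<longlongrightarrow> 0) (at x)"
      by (rule Lim_null_comparison[rotated]) (use two in auto)
    then show ?thesis using LIM_zero_iff by blast
  qed
  then show ?thesis by (simp add: continuous_on_def)
qed

lemma infconv_mono:
  assumes "\<And>x. u x \<le> u (x + c)"
  shows "infconv q u x \<le> infconv q u (x + c)"
proof -
  let ?m = "infconv_point q u (x + c)"
  have "infconv q u x \<le> u (?m - c) + q * (norm (?m - c - x))\<^sup>2" by (rule infconv_le)
  also have "\<dots> \<le> u ?m + q * (norm (?m - c - x))\<^sup>2" using assms[of "?m - c"] by simp
  also have "\<dots> = infconv q u (x + c)" by (simp add: infconv_def algebra_simps)
  finally show ?thesis .
qed

end

text \<open>
  Dini's argument: a monotone family of continuous functions with a constant limit approaches it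
  uniformly on compact sets.
\<close>

lemma monotone_limit_uniform_on_ball:
  fixes u :: "'a::euclidean_space \<Rightarrow> real"
  assumes u: "continuous_on UNIV u"
    and mono: "\<And>x s t. s \<le> t \<Longrightarrow> u (x + s *\<^sub>R d) \<le> u (x + t *\<^sub>R d)"
    and lim: "\<And>x. ((\<lambda>t. u (x + t *\<^sub>R d)) \<longlongrightarrow> l) at_top"
    and "\<eta> > 0"
  obtains T where "T > 0" "\<And>x. x \<in> cball 0 r \<Longrightarrow> l - \<eta> \<le> u (x + T *\<^sub>R d)"
proof (rule ccontr)
  assume "\<not> thesis"
  then have "\<exists>x\<in>cball 0 r. u (x + real (Suc n) *\<^sub>R d) < l - \<eta>" for n
    using that[of "real (Suc n)"] by force
  then obtain X where X: "\<And>n. X n \<in> cball 0 r" "\<And>n. u (X n + real (Suc n) *\<^sub>R d) < l - \<eta>" by metis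
  obtain x \<sigma> where x: "strict_mono \<sigma>" "(X \<circ> \<sigma>) \<longlonglongrightarrow> x"
    using compact_imp_seq_compact[OF compact_cball, of 0 r] X(1) unfolding seq_compact_def by blast
  have "u (x + t *\<^sub>R d) \<le> l - \<eta>" for t
  proof (rule tendsto_upperbound)
    show "(\<lambda>n. u ((X \<circ> \<sigma>) n + t *\<^sub>R d)) \<longlonglongrightarrow> u (x + t *\<^sub>R d)"
      by (rule continuous_on_tendsto_compose[OF u]) (use x(2) in \<open>auto intro!: tendsto_intros simp: o_def\<close>)
    show "eventually (\<lambda>n. u ((X \<circ> \<sigma>) n + t *\<^sub>R d) \<le> l - \<eta>) sequentially"
      using eventually_ge_at_top[of "nat \<lceil>t\<rceil>"]
    proof eventually_elim
      case (elim n)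
      have "t \<le> real (Suc (\<sigma> n))" using elim seq_suble[OF x(1), of n] by linarith
      then show ?case using mono[of t "real (Suc (\<sigma> n))" "X (\<sigma> n)"] X(2)[of "\<sigma> n"] by simp
    qed
  qed simp
  then have "l \<le> l - \<eta>"
    by (intro tendsto_upperbound[OF lim[of x]]) auto
  then show False using \<open>\<eta> > 0\<close> by simp
qed

section \<open>Levy measures and their energies\<close>

text \<open>
  Restriction of \<open>\<nu>\<close> to jumps of length at least \<open>\<epsilon>\<close>, realised as a density so that it remains a
  measure on the whole space. Integrating against it gives the truncated operators whose limit is the
  principal value.
\<close>

definition cut :: "'a::euclidean_space measure \<Rightarrow> real \<Rightarrow> 'a measure" where
  "cut \<nu> \<epsilon> = density \<nu> (\<lambda>z. ennreal (indicator (- ball 0 \<epsilon>) z))"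

text \<open>
  Every unordered pair of points is counted twice, so this is twice the usual interaction energy.
\<close>

definition levy_energy :: "(real \<Rightarrow> real) \<Rightarrow> 'a::euclidean_space measure \<Rightarrow> ('a \<Rightarrow> real) \<Rightarrow> ennreal" where
  "levy_energy \<Phi> \<nu> v = (\<integral>\<^sup>+x. (\<integral>\<^sup>+z. ennreal (\<Phi> (v x - v (x + z))) \<partial>\<nu>) \<partial>lborel)"

lemma sets_cut: "sets (cut \<nu> \<epsilon>) = sets \<nu>"
  by (simp add: cut_def)

lemma cut_zero: "sets \<nu> = sets borel \<Longrightarrow> cut \<nu> 0 = \<nu>"
  by (simp add: cut_def density_1)

lemma levy_energy_cut:
  assumes [measurable_cong]: "sets \<nu> = sets borel"
    and [measurable]: "\<Phi> \<in> borel_measurable borel" "v \<in> borel_measurable borel"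
  shows "levy_energy \<Phi> (cut \<nu> \<epsilon>) v =
    (\<integral>\<^sup>+x. (\<integral>\<^sup>+z. ennreal (indicator (- ball 0 \<epsilon>) z) * ennreal (\<Phi> (v x - v (x + z))) \<partial>\<nu>) \<partial>lborel)"
  unfolding levy_energy_def cut_def
  by (intro nn_integral_cong nn_integral_density) auto

text \<open>
  Fatou's lemma in both variables. The origin, which no truncation sees, contributes nothing because
  \<open>\<Phi> 0 = 0\<close>. Taking \<open>v\<close> constant removes a truncation; taking \<open>\<epsilon> = 0\<close> removes a regularisation.
\<close>

lemma levy_energy_lower_semicontinuous:
  assumes nu: "sets \<nu> = sets borel" "sigma_finite_measure \<nu>"
    and Phi: "continuous_on UNIV \<Phi>" "\<Phi> 0 = 0"
    and v [measurable]: "\<And>i. v i \<in> borel_measurable borel" "w \<in> borel_measurable borel"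
    and lim: "\<And>x. (\<lambda>i. v i x) \<longlonglongrightarrow> w x" "\<epsilon> \<longlonglongrightarrow> 0"
  shows "levy_energy \<Phi> \<nu> w \<le> liminf (\<lambda>i. levy_energy \<Phi> (cut \<nu> (\<epsilon> i)) (v i))"
proof -
  interpret sigma_finite_measure \<nu> by fact
  note [measurable_cong] = nu(1)
  have [measurable]: "\<Phi> \<in> borel_measurable borel"
    using Phi(1) by (auto intro: borel_measurable_continuous_onI)
  let ?h = "\<lambda>i x z. ennreal (indicator (- ball 0 (\<epsilon> i)) z) * ennreal (\<Phi> (v i x - v i (x + z)))"
  have *: "ennreal (\<Phi> (w x - w (x + z))) \<le> liminf (\<lambda>i. ?h i x z)" for x z
  proof (cases "z = 0")
    case False
    have "(\<lambda>i. ennreal (\<Phi> (v i x - v i (x + z)))) \<longlonglongrightarrow> ennreal (\<Phi> (w x - w (x + z)))"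
      by (intro tendsto_ennrealI continuous_on_tendsto_compose[OF Phi(1)] tendsto_diff lim) auto
    moreover have "\<forall>\<^sub>F i in sequentially. \<epsilon> i < norm z"
      using order_tendstoD(2)[OF lim(2), of "norm z"] False by simp
    then have "\<forall>\<^sub>F i in sequentially. ennreal (\<Phi> (v i x - v i (x + z))) = ?h i x z"
      by eventually_elim (auto simp: indicator_def)
    ultimately have "(\<lambda>i. ?h i x z) \<longlonglongrightarrow> ennreal (\<Phi> (w x - w (x + z)))"
      using Lim_transform_eventually by fast
    then show ?thesis using lim_imp_Liminf[of sequentially] by fastforce
  qed (simp add: Phi)
  have "levy_energy \<Phi> \<nu> w \<le> (\<integral>\<^sup>+x. (\<integral>\<^sup>+z. liminf (\<lambda>i. ?h i x z) \<partial>\<nu>) \<partial>lborel)"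
    unfolding levy_energy_def by (intro nn_integral_mono *)
  also have "\<dots> \<le> (\<integral>\<^sup>+x. liminf (\<lambda>i. \<integral>\<^sup>+z. ?h i x z \<partial>\<nu>) \<partial>lborel)"
    by (intro nn_integral_mono nn_integral_liminf) auto
  also have "\<dots> \<le> liminf (\<lambda>i. \<integral>\<^sup>+x. (\<integral>\<^sup>+z. ?h i x z \<partial>\<nu>) \<partial>lborel)"
    by (intro nn_integral_liminf) auto
  finally show ?thesis using nu(1) by (simp add: levy_energy_cut)
qed

locale levy_measure =
  fixes \<nu> :: "'a::euclidean_space measure"
  assumes sets_nu: "sets \<nu> = sets borel"
    and sigma_finite_nu: "sigma_finite_measure \<nu>"
    and symmetric_nu: "distr \<nu> borel uminus = \<nu>"
    and tail_nu: "\<And>\<epsilon>. \<epsilon> > 0 \<Longrightarrow> emeasure \<nu> (- ball 0 \<epsilon>) < \<infinity>"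
begin

lemma sets_cut_nu [measurable_cong]: "sets (cut \<nu> \<epsilon>) = sets borel"
  by (simp add: sets_cut sets_nu)

lemma finite_cut: "\<epsilon> > 0 \<Longrightarrow> finite_measure (cut \<nu> \<epsilon>)"
proof (rule finite_measureI)
  note [measurable_cong] = sets_nu
  assume "\<epsilon> > 0"
  then show "emeasure (cut \<nu> \<epsilon>) (space (cut \<nu> \<epsilon>)) \<noteq> \<infinity>"
    using tail_nu[of \<epsilon>] sets_eq_imp_space_eq[OF sets_nu]
    by (simp add: cut_def emeasure_density ennreal_indicator less_top)
qed

lemma symmetric_cut: "distr (cut \<nu> \<epsilon>) borel uminus = cut \<nu> \<epsilon>"
proof -
  note [measurable_cong] = sets_nu
  have "cut \<nu> \<epsilon> = density (distr \<nu> borel uminus) (\<lambda>z. ennreal (indicator (- ball 0 \<epsilon>) z))"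
    unfolding cut_def symmetric_nu ..
  also have "\<dots> = distr (density \<nu> (\<lambda>z. ennreal (indicator (- ball 0 \<epsilon>) (- z)))) borel uminus"
    by (rule density_distr) auto
  also have "(\<lambda>z. ennreal (indicator (- ball 0 \<epsilon>) (- z))) = (\<lambda>z. ennreal (indicator (- ball 0 \<epsilon>) (z::'a)))"
    by (auto simp: indicator_def)
  finally show ?thesis unfolding cut_def ..
qed

end

text \<open>
  \<open>G\<close> plays the role of \<open>\<Phi>'\<close>. The assumption \<open>one_sided\<close> is what replaces regularity of the layer: it
  bounds the truncated operator, uniformly in the truncation, on functions that lie below a paraboloid.
\<close>

locale levy_convex = levy_measure \<nu> for \<nu> :: "'a::euclidean_space measure" +
  fixes \<Phi> G :: "real \<Rightarrow> real" and \<rho> :: real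
  assumes Phi_continuous: "continuous_on UNIV \<Phi>"
    and Phi_nonneg: "\<And>t. 0 \<le> \<Phi> t" and Phi_0: "\<Phi> 0 = 0"
    and G_continuous: "continuous_on UNIV G"
    and G_odd: "\<And>t. G (- t) = - G t"
    and G_mono: "\<And>s t. s \<le> t \<Longrightarrow> G s \<le> G t"
    and Phi_convex: "\<And>a b. \<Phi> a + G a * (b - a) \<le> \<Phi> b"
    and rho_pos: "\<rho> > 0"
    and one_sided: "\<And>q P. q > 0 \<Longrightarrow> \<exists>C. \<forall>p \<epsilon>. norm p \<le> P \<longrightarrow> \<epsilon> > 0 \<longrightarrow>
       (\<integral>z. indicator (ball 0 \<rho>) z * G (p \<bullet> z + q * (norm z)\<^sup>2) \<partial>cut \<nu> \<epsilon>) \<le> C"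
begin

lemma measurable_PhiG [measurable]: "\<Phi> \<in> borel_measurable borel" "G \<in> borel_measurable borel"
  using Phi_continuous G_continuous by (auto intro: borel_measurable_continuous_onI)

lemma integrable_G_difference:
  assumes [measurable]: "v \<in> borel_measurable borel" and v: "\<And>x. \<bar>v x\<bar> \<le> 1" and "\<epsilon> > 0"
  shows "integrable (cut \<nu> \<epsilon>) (\<lambda>z. G (v x - v (x + z)))"
proof -
  interpret finite_measure "cut \<nu> \<epsilon>" by (rule finite_cut) fact
  show ?thesis
  proof (rule integrable_const_bound[where B = "G 2"])
    have "\<bar>v x - v y\<bar> \<le> 2" for y using v[of x] v[of y] by linarith
    then show "AE z in cut \<nu> \<epsilon>. norm (G (v x - v (x + z))) \<le> G 2"
      using G_mono G_odd[of 2] by (intro AE_I2) (simp add: abs_le_iff, smt (verit))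
  qed measurable
qed

text \<open>
  Jumps inside the ball of radius \<open>\<rho>\<close> are handled by semiconcavity and \<open>one_sided\<close>, the slope of the
  paraboloid being bounded in terms of \<open>q\<close> alone; longer jumps have finite mass, and the increments
  are at most \<open>2\<close>.
\<close>

lemma infconv_op_bounded_below:
  assumes u: "continuous_on UNIV u" "\<And>x. \<bar>u x\<bar> \<le> 1" and q: "q > 0"
  obtains C where "\<And>x \<epsilon>. \<epsilon> > 0 \<Longrightarrow>
    - C \<le> (\<integral>z. G (infconv q u x - infconv q u (x + z)) \<partial>cut \<nu> \<epsilon>)"
proof -
  let ?w = "infconv q u"
  have wb: "\<bar>?w x\<bar> \<le> 1" for x using infconv_bounds[OF u q, of x] u(2)[of x] by simp
  have [measurable]: "?w \<in> borel_measurable borel"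
    by (intro borel_measurable_continuous_onI continuous_infconv u q)
  obtain C where C: "\<And>p \<epsilon>. norm p \<le> 2 * q * sqrt (2 / q) \<Longrightarrow> \<epsilon> > 0 \<Longrightarrow>
       (\<integral>z. indicator (ball 0 \<rho>) z * G (p \<bullet> z + q * (norm z)\<^sup>2) \<partial>cut \<nu> \<epsilon>) \<le> C"
    using one_sided[OF q] by blast
  have G2: "G 2 \<ge> 0" using G_mono[of "-2" 2] G_odd[of 2] by simp
  have "- (C + G 2 * measure \<nu> (- ball 0 \<rho>)) \<le> (\<integral>z. G (?w x - ?w (x + z)) \<partial>cut \<nu> \<epsilon>)"
    if e: "\<epsilon> > 0" for x \<epsilon>
  proof -
    interpret finite_measure "cut \<nu> \<epsilon>" by (rule finite_cut) fact
    define p where "p = - (2 * q) *\<^sub>R (infconv_point q u x - x)"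
    let ?g = "\<lambda>z. indicator (ball 0 \<rho>) z * G (p \<bullet> z + q * (norm z)\<^sup>2)"
    let ?t = "\<lambda>z. G 2 * indicator (- ball 0 \<rho>) z"
    have ig: "integrable (cut \<nu> \<epsilon>) ?g"
    proof (rule integrable_const_bound[where B = "G (norm p * \<rho> + q * \<rho>\<^sup>2)"])
      show "AE z in cut \<nu> \<epsilon>. norm (?g z) \<le> G (norm p * \<rho> + q * \<rho>\<^sup>2)"
      proof (intro AE_I2)
        fix z
        let ?s = "norm p * \<rho> + q * \<rho>\<^sup>2"
        have s0: "0 \<le> G ?s" using G_mono[of "- ?s" ?s] G_odd[of ?s] rho_pos q by simp
        show "norm (?g z) \<le> G ?s"
        proof (cases "z \<in> ball 0 \<rho>")
          case True
          have "\<bar>p \<bullet> z\<bar> \<le> norm p * \<rho>"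
            by (rule order_trans[OF Cauchy_Schwarz_ineq2]) (use True in \<open>auto intro!: mult_left_mono\<close>)
          moreover have "q * (norm z)\<^sup>2 \<le> q * \<rho>\<^sup>2" "0 \<le> q * (norm z)\<^sup>2"
            using True q by (auto intro!: mult_left_mono power_mono)
          ultimately have "- ?s \<le> p \<bullet> z + q * (norm z)\<^sup>2" "p \<bullet> z + q * (norm z)\<^sup>2 \<le> ?s"
            by linarith+
          from G_mono[OF this(1)] G_mono[OF this(2)] show ?thesis
            using True G_odd[of ?s] by (simp add: abs_le_iff)
        qed (use s0 in simp)
      qed
    next
      have "?g \<in> borel_measurable borel"
        by (intro borel_measurable_times borel_measurable_indicator measurable_compose[OF _ measurable_PhiG(2)]) auto
      then show "?g \<in> borel_measurable (cut \<nu> \<epsilon>)" by measurable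
    qed
    have it: "integrable (cut \<nu> \<epsilon>) ?t"
      by (rule integrable_const_bound[where B = "G 2"]) (auto simp: indicator_def G2)
    have mt: "measure (cut \<nu> \<epsilon>) (- ball 0 \<rho>) \<le> measure \<nu> (- ball 0 \<rho>)"
    proof -
      note [measurable_cong] = sets_nu
      have "emeasure (cut \<nu> \<epsilon>) (- ball 0 \<rho>)
          = (\<integral>\<^sup>+z. ennreal (indicator (- ball 0 \<epsilon>) z) * indicator (- ball 0 \<rho>) z \<partial>\<nu>)"
        unfolding cut_def by (rule emeasure_density) auto
      also have "\<dots> \<le> (\<integral>\<^sup>+z. indicator (- ball 0 \<rho>) z \<partial>\<nu>)"
        by (intro nn_integral_mono) (auto simp: indicator_def)
      also have "\<dots> = emeasure \<nu> (- ball 0 \<rho>)"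
        by (rule nn_integral_indicator) simp
      finally have "emeasure (cut \<nu> \<epsilon>) (- ball 0 \<rho>) \<le> emeasure \<nu> (- ball 0 \<rho>)" .
      then show ?thesis using tail_nu[OF rho_pos] by (simp add: measure_def enn2real_mono)
    qed
    have "(\<integral>z. - (?g z + ?t z) \<partial>cut \<nu> \<epsilon>) \<le> (\<integral>z. G (?w x - ?w (x + z)) \<partial>cut \<nu> \<epsilon>)"
    proof (rule integral_mono)
      fix z
      show "- (?g z + ?t z) \<le> G (?w x - ?w (x + z))"
      proof (cases "z \<in> ball 0 \<rho>")
        case True
        have "- (p \<bullet> z + q * (norm z)\<^sup>2) \<le> ?w x - ?w (x + z)"
          using infconv_semiconcave[OF u q, of x z] unfolding p_def by linarith
        from G_mono[OF this] show ?thesis using True by (simp only: G_odd) simp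
      next
        case False
        have "- 2 \<le> ?w x - ?w (x + z)" using wb[of x] wb[of "x + z"] by linarith
        from G_mono[OF this] show ?thesis using False by (simp add: G_odd)
      qed
    qed (use ig it wb e in \<open>auto intro!: integrable_G_difference\<close>)
    moreover have "(\<integral>z. - (?g z + ?t z) \<partial>cut \<nu> \<epsilon>) = - (\<integral>z. ?g z \<partial>cut \<nu> \<epsilon>) - G 2 * measure (cut \<nu> \<epsilon>) (- ball 0 \<rho>)"
      using ig it by simp
    moreover have "(\<integral>z. ?g z \<partial>cut \<nu> \<epsilon>) \<le> C"
      by (rule C) (use e infconv_slope[OF u q, of x] p_def in auto)
    moreover have "G 2 * measure (cut \<nu> \<epsilon>) (- ball 0 \<rho>) \<le> G 2 * measure \<nu> (- ball 0 \<rho>)"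
      by (intro mult_left_mono mt G2)
    ultimately show ?thesis by linarith
  qed
  then show ?thesis by (rule that)
qed

end

section \<open>A layer minimises among functions below a cutoff\<close>

text \<open>
  The equation is required in the principal value sense at every point, along the truncations of \<open>\<nu>\<close>;
  \<open>d\<close> is the direction of monotonicity.
\<close>

locale monotone_layer = levy_convex \<nu> \<Phi> G \<rho>
  for \<nu> :: "'a::euclidean_space measure" and \<Phi> G :: "real \<Rightarrow> real" and \<rho> :: real +
  fixes u :: "'a \<Rightarrow> real" and F f :: "real \<Rightarrow> real" and d :: 'a
  assumes u_continuous: "continuous_on UNIV u"
    and u_bound: "\<And>x. \<bar>u x\<bar> \<le> 1"
    and u_mono: "\<And>x s t. s \<le> t \<Longrightarrow> u (x + s *\<^sub>R d) \<le> u (x + t *\<^sub>R d)"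
    and u_limit: "\<And>x. ((\<lambda>t. u (x + t *\<^sub>R d)) \<longlongrightarrow> 1) at_top"
    and equation: "\<And>x. ((\<lambda>\<epsilon>. \<integral>z. G (u x - u (x + z)) \<partial>cut \<nu> \<epsilon>) \<longlongrightarrow> f (u x)) (at_right 0)"
    and F_deriv: "\<And>t. (F has_real_derivative f t) (at t)"
    and f_continuous: "continuous_on UNIV f"
begin

abbreviation eps :: "nat \<Rightarrow> real" where "eps i \<equiv> inverse (real (Suc i))"

lemma eps: "eps i > 0" "eps \<longlonglongrightarrow> 0" "filterlim eps (at_right 0) sequentially"
  by (simp, rule LIMSEQ_inverse_real_of_nat,
      simp add: filterlim_at LIMSEQ_inverse_real_of_nat del: of_nat_Suc)

text \<open>
  One step of the path for a regularised translate \<open>w = infconv q u\<close> shifted by \<open>a\<close> and lifted by \<open>\<eta>\<close>,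
  passing from \<open>v\<close> to \<open>v'\<close>. Where \<open>v\<close> moves it touches the translate from below, so the truncated
  operator of \<open>v\<close> dominates that of \<open>w\<close>, which in the limit is at least \<open>f(v) - e\<close>. To pass to the
  limit under the integral without an upper bound on the operator of \<open>w\<close>, the operator is replaced by
  its minimum with \<open>f(v) - e\<close>: this is still a lower bound, is bounded on both sides, and converges.
  The last conclusion compares the first-order term with the increment of \<open>F\<close>.
\<close>

lemma step_lower_limit:
  fixes v v' w :: "'a \<Rightarrow> real" and a :: 'a
  assumes q: "q > 0"
    and v: "continuous_on UNIV v" "continuous_on UNIV v'"
      "\<And>x. \<bar>v x\<bar> \<le> 1" "\<And>x. \<bar>v' x\<bar> \<le> 1"
      "\<And>x. x \<notin> ball 0 r \<Longrightarrow> v x = -1" "\<And>x. x \<notin> ball 0 r \<Longrightarrow> v' x = -1"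
    and le: "\<And>x. v x \<le> v' x"
    and touch: "\<And>x. v x < v' x \<Longrightarrow> v x = infconv q u (x + a) + \<eta>"
    and below: "\<And>x. v x \<le> infconv q u (x + a) + \<eta>"
    and near: "\<And>x. v x < v' x \<Longrightarrow> f (v x) - e \<le> f (u (infconv_point q u (x + a)))"
    and small: "\<And>x s. v x \<le> s \<Longrightarrow> s \<le> v' x \<Longrightarrow> f s \<le> f (v x) + e"
    and e: "e \<ge> 0"
  obtains b where "b \<longlonglongrightarrow> (\<integral>x. (v' x - v x) * (f (v x) - e) \<partial>lborel)"
    "\<And>i. (\<integral>(x, z). \<Phi> (v x - v (x + z)) \<partial>(lborel \<Otimes>\<^sub>M cut \<nu> (eps i))) + 2 * b i
        \<le> (\<integral>(x, z). \<Phi> (v' x - v' (x + z)) \<partial>(lborel \<Otimes>\<^sub>M cut \<nu> (eps i)))"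
    "integrable lborel (\<lambda>x. (v' x - v x) * (f (v x) - e))"
    "\<And>x. F (v' x) - F (v x) - 2 * e * (v' x - v x) \<le> (v' x - v x) * (f (v x) - e)"
proof -
  let ?w = "infconv q u"
  let ?m = "\<lambda>x. infconv_point q u (x + a)"
  let ?T = "\<lambda>i x. \<integral>z. G (?w (x + a) - ?w (x + a + z)) \<partial>cut \<nu> (eps i)"
  let ?L = "\<lambda>x. f (v x) - e"
  let ?h = "\<lambda>i x. (v' x - v x) * min (?T i x) (?L x)"
  have w_cont: "continuous_on UNIV ?w" by (intro continuous_infconv u_continuous u_bound q)
  have w_bound: "\<bar>?w x\<bar> \<le> 1" for x
    using infconv_bounds[OF u_continuous u_bound q, of x] u_bound[of x] by simp
  have [measurable]: "?w \<in> borel_measurable borel" "f \<in> borel_measurable borel"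
      "v \<in> borel_measurable borel" "v' \<in> borel_measurable borel" "u \<in> borel_measurable borel"
    using v w_cont u_continuous f_continuous by (auto intro: borel_measurable_continuous_onI)
  obtain C where C: "\<And>x \<epsilon>. \<epsilon> > 0 \<Longrightarrow> - C \<le> (\<integral>z. G (?w x - ?w (x + z)) \<partial>cut \<nu> \<epsilon>)"
    using infconv_op_bounded_below[OF u_continuous u_bound q] by blast
  have "compact (f ` {-1..1})"
    using f_continuous by (auto intro!: compact_continuous_image intro: continuous_on_subset)
  then obtain M where "\<forall>y\<in>f ` {-1..1}. norm y \<le> M"
    by (meson bounded_iff compact_imp_bounded)
  then have M: "\<bar>f (v x)\<bar> \<le> M" for x
    using v(3)[of x] by (auto simp: abs_le_iff)
  \<comment> \<open>A bound for the minimum of the truncated operator with f (v x) - e, from below by the uniform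
    bound C and from above by the bound M on f.\<close>
  define B where "B = max C 0 + M + e"
  have M0: "0 \<le> M" using M[of 0] by linarith
  have T_meas [measurable]: "?T i \<in> borel_measurable borel" for i
  proof -
    interpret finite_measure "cut \<nu> (eps i)" by (rule finite_cut) (simp del: of_nat_Suc)
    show ?thesis by measurable
  qed
  have diff: "0 \<le> v' x - v x" "v' x - v x \<le> 2" for x
    using le[of x] v(3)[of x] v(4)[of x] by linarith+
  have h_bound: "\<bar>?h i x\<bar> \<le> 2 * B * indicator (ball 0 r) x" for i x
  proof (cases "x \<in> ball 0 r")
    case True
    have "\<bar>min (?T i x) (?L x)\<bar> \<le> B"
      using C[OF eps(1), of i "x + a"] M[of x] M0 e unfolding B_def by (auto simp: min_def abs_le_iff)
    then have "(v' x - v x) * \<bar>min (?T i x) (?L x)\<bar> \<le> 2 * B"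
      using diff[of x] by (intro mult_mono) auto
    then show ?thesis using True diff[of x] by (simp add: abs_mult)
  qed (simp add: v)
  have L_bound: "\<bar>(v' x - v x) * ?L x\<bar> \<le> 2 * B * indicator (ball 0 r) x" for x
  proof (cases "x \<in> ball 0 r")
    case True
    have "\<bar>?L x\<bar> \<le> B" using M[of x] e unfolding B_def by (auto simp: abs_le_iff)
    then have "(v' x - v x) * \<bar>?L x\<bar> \<le> 2 * B"
      using diff[of x] by (intro mult_mono) auto
    then show ?thesis using True diff[of x] by (simp add: abs_mult)
  qed (simp add: v)
  have dom: "integrable lborel (\<lambda>x. 2 * B * indicator (ball (0::'a) r) x)"
    using emeasure_lborel_ball_finite[of "0::'a" r]
    by (intro integrable_mult_right integrable_real_indicator) auto
  have L_int: "integrable lborel (\<lambda>x. (v' x - v x) * ?L x)"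
    by (rule Bochner_Integration.integrable_bound[OF dom]) (auto intro!: AE_I2 order_trans[OF L_bound abs_ge_self])
  have h_int: "integrable lborel (?h i)" for i
    by (rule Bochner_Integration.integrable_bound[OF dom]) (auto intro!: AE_I2 order_trans[OF h_bound abs_ge_self] simp del: of_nat_Suc)
  have h_lim: "(\<lambda>i. ?h i x) \<longlonglongrightarrow> (v' x - v x) * ?L x" for x
  proof (cases "v x < v' x")
    case True
    let ?A = "\<lambda>i. \<integral>z. G (u (?m x) - u (?m x + z)) \<partial>cut \<nu> (eps i)"
    have A: "?A \<longlonglongrightarrow> f (u (?m x))"
      by (rule filterlim_compose[OF equation eps(3)])
    have AT: "?A i \<le> ?T i x" for i
    proof (rule integral_mono)
      show "integrable (cut \<nu> (eps i)) (\<lambda>z. G (u (?m x) - u (?m x + z)))"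
        by (rule integrable_G_difference) (auto simp: u_bound simp del: of_nat_Suc)
      show "integrable (cut \<nu> (eps i)) (\<lambda>z. G (?w (x + a) - ?w (x + a + z)))"
        by (rule integrable_G_difference) (auto simp: w_bound simp del: of_nat_Suc)
      show "G (u (?m x) - u (?m x + z)) \<le> G (?w (x + a) - ?w (x + a + z))" for z
        by (intro G_mono infconv_touching u_continuous u_bound q)
    qed
    have "(\<lambda>i. min (?A i) (?L x)) \<longlonglongrightarrow> min (f (u (?m x))) (?L x)"
      by (intro tendsto_min A tendsto_const)
    also have "min (f (u (?m x))) (?L x) = ?L x" using near[OF True] by simp
    finally have "(\<lambda>i. min (?T i x) (?L x)) \<longlonglongrightarrow> ?L x"
      by (rule tendsto_sandwich[rotated 2, where h = "\<lambda>_. ?L x"])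
        (intro tendsto_const always_eventually allI min.mono AT order_refl min.cobounded2)+
    then show ?thesis by (intro tendsto_mult tendsto_const)
  next
    case False
    then have "v' x = v x" using le[of x] by simp
    then show ?thesis by simp
  qed
  have lim: "(\<lambda>i. \<integral>x. ?h i x \<partial>lborel) \<longlonglongrightarrow> (\<integral>x. (v' x - v x) * ?L x \<partial>lborel)"
    by (rule integral_dominated_convergence[OF _ _ dom])
      (use h_lim h_bound in \<open>auto intro!: AE_I2 simp del: of_nat_Suc\<close>)
  have step: "(\<integral>(x, z). \<Phi> (v x - v (x + z)) \<partial>(lborel \<Otimes>\<^sub>M cut \<nu> (eps i))) + 2 * (\<integral>x. ?h i x \<partial>lborel)
        \<le> (\<integral>(x, z). \<Phi> (v' x - v' (x + z)) \<partial>(lborel \<Otimes>\<^sub>M cut \<nu> (eps i)))" for i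
  proof -
    have fin: "finite_measure (cut \<nu> (eps i))" by (rule finite_cut) (simp del: of_nat_Suc)
    note cs = convexity_step[OF fin sets_cut_nu symmetric_cut, of v v' r \<Phi> G,
        OF _ _ v(3) v(5) v(4) v(6) Phi_continuous Phi_0 G_continuous G_odd Phi_convex]
    have "(\<integral>x. ?h i x \<partial>lborel) \<le> (\<integral>x. (v' x - v x) * (\<integral>z. G (v x - v (x + z)) \<partial>cut \<nu> (eps i)) \<partial>lborel)"
    proof (rule integral_mono)
      show "integrable lborel (\<lambda>x. (v' x - v x) * (\<integral>z. G (v x - v (x + z)) \<partial>cut \<nu> (eps i)))"
        by (rule cs(2)) auto
      show "?h i x \<le> (v' x - v x) * (\<integral>z. G (v x - v (x + z)) \<partial>cut \<nu> (eps i))" for x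
      proof (cases "v x < v' x")
        case True
        have "?T i x \<le> (\<integral>z. G (v x - v (x + z)) \<partial>cut \<nu> (eps i))"
        proof (rule integral_mono)
          show "integrable (cut \<nu> (eps i)) (\<lambda>z. G (?w (x + a) - ?w (x + a + z)))"
            by (rule integrable_G_difference) (auto simp: w_bound simp del: of_nat_Suc)
          show "integrable (cut \<nu> (eps i)) (\<lambda>z. G (v x - v (x + z)))"
            by (rule integrable_G_difference) (auto simp: v simp del: of_nat_Suc)
          show "G (?w (x + a) - ?w (x + a + z)) \<le> G (v x - v (x + z))" for z
            using below[of "x + z"] touch[OF True] by (intro G_mono) (simp add: add.commute add.left_commute)
        qed
        then show ?thesis using diff[of x] by (intro mult_left_mono) auto
      next
        case False
        then have "v' x = v x" using le[of x] by simp
        then show ?thesis by simp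
      qed
    qed (rule h_int)
    then show ?thesis using cs(3) by fastforce
  qed
  have mv: "F (v' x) - F (v x) - 2 * e * (v' x - v x) \<le> (v' x - v x) * (f (v x) - e)" for x
  proof (cases "v x < v' x")
    case True
    obtain s where s: "v x < s" "s < v' x" "F (v' x) - F (v x) = (v' x - v x) * f s"
      using MVT2[OF True, of F f] F_deriv by blast
    have "(v' x - v x) * f s \<le> (v' x - v x) * (f (v x) + e)"
      using small[of x s] s diff[of x] by (intro mult_left_mono) auto
    then show ?thesis using s by (simp add: algebra_simps)
  next
    case False
    then have "v' x = v x" using le[of x] by simp
    then show ?thesis by simp
  qed
  show ?thesis by (rule that[OF lim step L_int mv])
qed

end

context levy_convex begin

lemma levy_energy_cut_eq_integral:
  assumes v: "continuous_on UNIV v" "\<And>x. \<bar>v x\<bar> \<le> 1" "\<And>x. x \<notin> ball 0 r \<Longrightarrow> v x = -1" and "\<epsilon> > 0"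
  shows "levy_energy \<Phi> (cut \<nu> \<epsilon>) v
      = ennreal (\<integral>(x, z). \<Phi> (v x - v (x + z)) \<partial>(lborel \<Otimes>\<^sub>M cut \<nu> \<epsilon>))"
proof -
  interpret N: finite_measure "cut \<nu> \<epsilon>" by (rule finite_cut) fact
  have [measurable]: "v \<in> borel_measurable borel"
    using v by (auto intro: borel_measurable_continuous_onI)
  have int: "integrable (lborel \<Otimes>\<^sub>M cut \<nu> \<epsilon>) (\<lambda>(x, z). \<Phi> (v x - v (x + z)))"
    by (rule convexity_step(1)[of "cut \<nu> \<epsilon>" v v r \<Phi> G])
      (use v G_odd Phi_convex in \<open>auto simp: sets_cut_nu symmetric_cut Phi_continuous Phi_0 G_continuous N.finite_measure_axioms\<close>)
  have "levy_energy \<Phi> (cut \<nu> \<epsilon>) v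
      = (\<integral>\<^sup>+p. ennreal (case p of (x, z) \<Rightarrow> \<Phi> (v x - v (x + z))) \<partial>(lborel \<Otimes>\<^sub>M cut \<nu> \<epsilon>))"
    unfolding levy_energy_def
    by (subst N.nn_integral_fst[symmetric]) (auto simp: case_prod_unfold)
  also have "\<dots> = ennreal (\<integral>(x, z). \<Phi> (v x - v (x + z)) \<partial>(lborel \<Otimes>\<^sub>M cut \<nu> \<epsilon>))"
    by (rule nn_integral_eq_integral[OF int]) (auto simp: Phi_nonneg)
  finally show ?thesis .
qed

lemma levy_energy_cut_le:
  assumes [measurable]: "v \<in> borel_measurable borel"
  shows "levy_energy \<Phi> (cut \<nu> \<epsilon>) v \<le> levy_energy \<Phi> \<nu> v"
  unfolding levy_energy_cut[OF sets_nu measurable_PhiG(1) assms] unfolding levy_energy_def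
  by (intro nn_integral_mono) (auto simp: indicator_def)

end

context monotone_layer begin

lemma F_continuous: "continuous_on UNIV F"
  using F_deriv DERIV_isCont continuous_at_imp_continuous_on by blast

lemma integrable_F_difference:
  assumes "continuous_on UNIV v" "continuous_on UNIV v'" "\<And>x. \<bar>v x\<bar> \<le> 1" "\<And>x. \<bar>v' x\<bar> \<le> 1"
  shows "integrable lborel (\<lambda>x::'a. indicator (ball 0 r) x * (F (v x) - F (v' x)))"
proof -
  have "compact (F ` {-1..1})"
    using F_continuous by (auto intro!: compact_continuous_image intro: continuous_on_subset)
  then obtain M where "\<forall>y\<in>F ` {-1..1}. norm y \<le> M"
    by (meson bounded_iff compact_imp_bounded)
  then have M: "\<bar>F (v x)\<bar> \<le> M" "\<bar>F (v' x)\<bar> \<le> M" for x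
    using assms(3,4)[of x] by (auto simp: abs_le_iff)
  have [measurable]: "v \<in> borel_measurable borel" "v' \<in> borel_measurable borel" "F \<in> borel_measurable borel"
    using assms F_continuous by (auto intro: borel_measurable_continuous_onI)
  have dom: "integrable lborel (\<lambda>x::'a. 2 * M * indicator (ball 0 r) x)"
    using emeasure_lborel_ball_finite[of "0::'a" r]
    by (intro integrable_mult_right integrable_real_indicator) auto
  show ?thesis
  proof (rule Bochner_Integration.integrable_bound[OF dom])
    show "AE x in lborel. norm (indicator (ball 0 r) x * (F (v x) - F (v' x))) \<le> norm (2 * M * indicator (ball (0::'a) r) x)"
    proof (intro AE_I2)
      fix x :: 'a
      have "\<bar>F (v x) - F (v' x)\<bar> \<le> \<bar>2 * M\<bar>" using M[of x] by linarith
      then show "norm (indicator (ball 0 r) x * (F (v x) - F (v' x))) \<le> norm (2 * M * indicator (ball (0::'a) r) x)"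
        by (auto simp: indicator_def abs_mult)
    qed
  qed (intro borel_measurable_times borel_measurable_indicator, auto)
qed

text \<open>
  The parameters are chosen in this order: \<open>\<eta>\<close> from the modulus of continuity of \<open>f\<close>, the length \<open>T\<close> of
  the path so that the translate by \<open>T d\<close> is within \<open>\<eta>\<close> of \<open>1\<close> on a neighbourhood of the ball, \<open>q\<close> so
  that the inf-convolution is within \<open>\<eta>\<close> of \<open>u\<close> on all of the region swept by the path, and finally the
  number \<open>N\<close> of steps from the modulus of continuity of the inf-convolution. The lift by \<open>\<eta>\<close> makes the
  last translate exceed \<open>1\<close>, hence the path ends exactly at \<open>\<psi>\<close>.
\<close>

lemma approximate_minimality:
  assumes psi: "continuous_on UNIV \<psi>" "\<And>x. \<bar>\<psi> x\<bar> \<le> 1" "\<And>x. x \<notin> ball 0 r \<Longrightarrow> \<psi> x = -1"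
    and fin: "levy_energy \<Phi> \<nu> \<psi> < \<infinity>" and e: "e > 0"
  obtains W where "continuous_on UNIV W" "\<And>x. -1 \<le> W x" "\<And>x. x \<in> ball 0 r \<Longrightarrow> \<bar>W x - u x\<bar> \<le> e"
    "levy_energy \<Phi> \<nu> (\<lambda>x. min (\<psi> x) (W x)) \<le> ennreal (enn2real (levy_energy \<Phi> \<nu> \<psi>)
       + 2 * (\<integral>x. indicator (ball 0 r) x * (F (min (\<psi> x) (W x)) - F (\<psi> x)) \<partial>lborel)
       + 8 * e * measure lborel (ball (0::'a) r))"
    "0 \<le> enn2real (levy_energy \<Phi> \<nu> \<psi>)
       + 2 * (\<integral>x. indicator (ball 0 r) x * (F (min (\<psi> x) (W x)) - F (\<psi> x)) \<partial>lborel)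
       + 8 * e * measure lborel (ball (0::'a) r)"
proof -
  have "uniformly_continuous_on {-2..2} f"
    by (rule compact_uniformly_continuous) (auto intro: continuous_on_subset[OF f_continuous])
  then obtain \<kappa> where k: "\<kappa> > 0" "\<And>s t. s \<in> {-2..2} \<Longrightarrow> t \<in> {-2..2} \<Longrightarrow> \<bar>s - t\<bar> < \<kappa> \<Longrightarrow> \<bar>f s - f t\<bar> < e"
    unfolding uniformly_continuous_on_def dist_real_def using e by blast
  define \<eta> where "\<eta> = min (\<kappa> / 4) (min (e / 2) (1 / 2))"
  have eta: "\<eta> > 0" "2 * \<eta> < \<kappa>" "2 * \<eta> \<le> e" "\<eta> \<le> 1 / 2"
    using k(1) e unfolding \<eta>_def by (auto simp: min_def)
  obtain T where T: "T > 0" "\<And>x. x \<in> cball 0 (r + 1) \<Longrightarrow> 1 - \<eta> \<le> u (x + T *\<^sub>R d)"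
    using monotone_limit_uniform_on_ball[OF u_continuous u_mono u_limit eta(1), of "r + 1"] by blast
  define \<Omega> where "\<Omega> = cball (0::'a) (r + T * norm d)"
  have "uniformly_continuous_on (cball 0 (r + T * norm d + 1)) u"
    by (rule compact_uniformly_continuous) (auto intro: continuous_on_subset[OF u_continuous])
  then obtain \<kappa>2 where k2: "\<kappa>2 > 0" "\<And>x y. x \<in> cball 0 (r + T * norm d + 1) \<Longrightarrow>
      y \<in> cball 0 (r + T * norm d + 1) \<Longrightarrow> dist x y < \<kappa>2 \<Longrightarrow> \<bar>u x - u y\<bar> < \<eta>"
    unfolding uniformly_continuous_on_def dist_real_def using eta(1) by meson
  define \<delta> where "\<delta> = min \<kappa>2 1 / 2"
  have delta: "\<delta> > 0" "\<delta> < \<kappa>2" "\<delta> < 1" using k2(1) unfolding \<delta>_def by auto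
  \<comment> \<open>This choice makes the distance to the minimising points at most \<open>\<delta>\<close>.\<close>
  define q where "q = 2 / \<delta>\<^sup>2"
  have q: "q > 0" "sqrt (2 / q) = \<delta>" using delta by (auto simp: q_def)
  let ?w = "infconv q u"
  let ?m = "infconv_point q u"
  note iu = u_continuous u_bound q(1)
  have w_cont: "continuous_on UNIV ?w" by (intro continuous_infconv iu)
  have m_near: "norm (?m x - x) \<le> \<delta>" for x using infconv_point_near[OF iu, of x] q(2) by simp
  have w_lower: "-1 \<le> ?w x" for x using infconv_bounds[OF iu] by simp
  have w_near: "u (?m x) \<le> ?w x" "?w x \<le> u x" "u x < u (?m x) + \<eta>" if "x \<in> \<Omega>" for x
  proof -
    have "?m x \<in> cball 0 (r + T * norm d + 1)"
      using that m_near[of x] delta norm_triangle_ineq2[of "?m x" x] by (auto simp: \<Omega>_def)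
    moreover have "x \<in> cball 0 (r + T * norm d + 1)" using that by (auto simp: \<Omega>_def)
    ultimately show "u x < u (?m x) + \<eta>"
      using k2(2)[of "?m x" x] m_near[of x] delta by (simp add: dist_norm)
  qed (use infconv_bounds[OF iu] in auto)
  have "uniformly_continuous_on \<Omega> ?w"
    by (rule compact_uniformly_continuous) (auto simp: \<Omega>_def intro: continuous_on_subset[OF w_cont])
  then obtain \<kappa>3 where k3: "\<kappa>3 > 0" "\<And>x y. x \<in> \<Omega> \<Longrightarrow> y \<in> \<Omega> \<Longrightarrow> dist x y < \<kappa>3 \<Longrightarrow> \<bar>?w x - ?w y\<bar> < \<kappa>"
    unfolding uniformly_continuous_on_def dist_real_def using k(1) by meson
  obtain N :: nat where N: "N > 0" "T * norm d / N < \<kappa>3"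
  proof -
    obtain n :: nat where "T * norm d / \<kappa>3 < n" using reals_Archimedean2 by blast
    then show ?thesis using k3(1) by (intro that[of "Suc n"]) (auto simp: field_simps intro: less_trans)
  qed
  define h where "h = T / N"
  have h: "h > 0" "real N * h = T" "h * norm d < \<kappa>3" using T(1) N by (auto simp: h_def)
  define a where "a j = (real j * h) *\<^sub>R d" for j :: nat
  have a_Suc: "a (Suc j) = a j + h *\<^sub>R d" for j by (simp add: a_def algebra_simps)
  have a_in: "x + a j \<in> \<Omega>" if "x \<in> ball 0 r" "j \<le> N" for x j
  proof -
    have "real j * h \<le> T" using that(2) h by (metis mult_right_mono of_nat_le_iff less_imp_le)
    then have "real j * h * norm d \<le> T * norm d" by (intro mult_right_mono) auto
    then have "norm (a j) \<le> T * norm d" using h by (simp add: a_def)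
    then show ?thesis using that(1) norm_triangle_ineq[of x "a j"] by (simp add: \<Omega>_def)
  qed
  define v where "v j x = min (\<psi> x) (?w (x + a j) + \<eta>)" for j x
  have v_cont: "continuous_on UNIV (v j)" for j
    unfolding v_def
    by (intro continuous_intros psi(1) continuous_on_compose2[OF w_cont]) auto
  have v_bound: "\<bar>v j x\<bar> \<le> 1" for j x
    using w_lower[of "x + a j"] psi(2)[of x] eta by (auto simp: v_def min_def abs_le_iff)
  have v_out: "v j x = -1" if "x \<notin> ball 0 r" for j x
    using w_lower[of "x + a j"] psi(3)[OF that] eta by (simp add: v_def)
  have w_mono: "?w x \<le> ?w (x + h *\<^sub>R d)" for x
    using u_mono[of 0 h] h by (intro infconv_mono iu) simp
  have v_mono: "v j x \<le> v (Suc j) x" for j x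
    using w_mono[of "x + a j"] by (auto simp: v_def a_Suc add.assoc)
  have v_N: "v N = \<psi>"
  proof
    fix x
    show "v N x = \<psi> x"
    proof (cases "x \<in> ball 0 r")
      case True
      have aN: "a N = T *\<^sub>R d" using h by (simp add: a_def)
      let ?y = "?m (x + a N) - a N"
      have "norm ?y \<le> norm x + norm (?m (x + a N) - (x + a N))"
        using norm_triangle_ineq[of x "?m (x + a N) - (x + a N)"] by (simp add: algebra_simps)
      then have "?y \<in> cball 0 (r + 1)" using True m_near[of "x + a N"] delta by simp
      from T(2)[OF this] have "1 - \<eta> \<le> u (?m (x + a N))" by (simp add: aN)
      then have "1 \<le> ?w (x + a N) + \<eta>" using infconv_bounds(3)[OF iu, of "x + a N"] by simp
      then show ?thesis using psi(2)[of x] by (simp add: v_def abs_le_iff min_def)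
    qed (simp add: v_out psi)
  qed
  let ?\<phi> = "\<lambda>j x. v (Suc j) x - v j x"
  let ?E = "\<lambda>i v. \<integral>(x, z). \<Phi> (v x - v (x + z)) \<partial>(lborel \<Otimes>\<^sub>M cut \<nu> (eps i))"
  have "\<exists>b. b \<longlonglongrightarrow> (\<integral>x. ?\<phi> j x * (f (v j x) - e) \<partial>lborel) \<and>
      (\<forall>i. ?E i (v j) + 2 * b i \<le> ?E i (v (Suc j))) \<and>
      integrable lborel (\<lambda>x. ?\<phi> j x * (f (v j x) - e)) \<and>
      (\<forall>x. F (v (Suc j) x) - F (v j x) - 2 * e * ?\<phi> j x \<le> ?\<phi> j x * (f (v j x) - e))"
    if j: "j < N" for j
  proof -
    have lt1: "x \<in> ball 0 r" if "v j x < v (Suc j) x" for x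
      using that v_out[of x j] v_out[of x "Suc j"] by (cases "x \<in> ball 0 r") auto
    have lt2: "v j x = ?w (x + a j) + \<eta>" if "v j x < v (Suc j) x" for x
      using that by (auto simp: v_def min_def split: if_splits)
    note lt = lt1 lt2
    have near: "f (v j x) - e \<le> f (u (?m (x + a j)))" if "v j x < v (Suc j) x" for x
    proof -
      have "x + a j \<in> \<Omega>" using a_in[OF lt(1)[OF that]] j by simp
      then have "\<bar>v j x - u (?m (x + a j))\<bar> < \<kappa>"
        using w_near[of "x + a j"] lt(2)[OF that] eta by (auto simp: abs_less_iff)
      then show ?thesis using k(2)[of "v j x" "u (?m (x + a j))"] v_bound[of j x] u_bound[of "?m (x + a j)"]
        by (auto simp: abs_le_iff abs_less_iff)
    qed
    have small: "f s \<le> f (v j x) + e" if s: "v j x \<le> s" "s \<le> v (Suc j) x" for x s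
    proof (cases "v j x < v (Suc j) x")
      case True
      have in\<Omega>: "x + a j \<in> \<Omega>" "x + a j + h *\<^sub>R d \<in> \<Omega>"
        using a_in[OF lt(1)[OF True], of j] a_in[OF lt(1)[OF True], of "Suc j"] j
        by (auto simp: a_Suc add.assoc)
      have "\<bar>?w (x + a j + h *\<^sub>R d) - ?w (x + a j)\<bar> < \<kappa>"
        by (rule k3(2)[OF in\<Omega>(2,1)]) (use h in \<open>simp add: dist_norm\<close>)
      moreover have "v (Suc j) x \<le> ?w (x + a j + h *\<^sub>R d) + \<eta>" by (simp add: v_def a_Suc add.assoc)
      ultimately have "\<bar>s - v j x\<bar> < \<kappa>" using s lt(2)[OF True] by (auto simp: abs_less_iff)
      then show ?thesis using k(2)[of s "v j x"] v_bound[of j x] v_bound[of "Suc j" x] s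
        by (auto simp: abs_le_iff abs_less_iff)
    next
      case False
      then have "s = v j x" using s by simp
      then show ?thesis using e by simp
    qed
    have below: "v j x \<le> ?w (x + a j) + \<eta>" for x by (simp add: v_def)
    show ?thesis
    proof (rule step_lower_limit[OF q(1) v_cont v_cont v_bound v_bound v_out v_out v_mono lt2 below near small less_imp_le[OF e]])
      fix b
      assume b: "b \<longlonglongrightarrow> (\<integral>x. ?\<phi> j x * (f (v j x) - e) \<partial>lborel)"
        "\<And>i. ?E i (v j) + 2 * b i \<le> ?E i (v (Suc j))"
        "integrable lborel (\<lambda>x. ?\<phi> j x * (f (v j x) - e))"
        "\<And>x. F (v (Suc j) x) - F (v j x) - 2 * e * ?\<phi> j x \<le> ?\<phi> j x * (f (v j x) - e)"
      show ?thesis by (intro exI[of _ b] conjI allI b)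
    qed
  qed
  then have "\<forall>j\<in>{..<N}. \<exists>b. b \<longlonglongrightarrow> (\<integral>x. ?\<phi> j x * (f (v j x) - e) \<partial>lborel) \<and>
      (\<forall>i. ?E i (v j) + 2 * b i \<le> ?E i (v (Suc j))) \<and>
      integrable lborel (\<lambda>x. ?\<phi> j x * (f (v j x) - e)) \<and>
      (\<forall>x. F (v (Suc j) x) - F (v j x) - 2 * e * ?\<phi> j x \<le> ?\<phi> j x * (f (v j x) - e))"
    by blast
  from bchoice[OF this] obtain b where
      b_lim: "\<And>j. j < N \<Longrightarrow> b j \<longlonglongrightarrow> (\<integral>x. ?\<phi> j x * (f (v j x) - e) \<partial>lborel)"
    and b_step: "\<And>j i. j < N \<Longrightarrow> ?E i (v j) + 2 * b j i \<le> ?E i (v (Suc j))"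
    and b_int: "\<And>j. j < N \<Longrightarrow> integrable lborel (\<lambda>x. ?\<phi> j x * (f (v j x) - e))"
    and b_F: "\<And>j x. j < N \<Longrightarrow> F (v (Suc j) x) - F (v j x) - 2 * e * ?\<phi> j x \<le> ?\<phi> j x * (f (v j x) - e)"
    by auto
  have tele: "?E i (v 0) + 2 * (\<Sum>j<k. b j i) \<le> ?E i (v k)" if "k \<le> N" for k i
    using that
  proof (induction k)
    case (Suc k)
    then show ?case using b_step[of k i] by simp
  qed simp
  define I where "I = enn2real (levy_energy \<Phi> \<nu> \<psi>)"
  define S where "S = (\<Sum>j<N. \<integral>x. ?\<phi> j x * (f (v j x) - e) \<partial>lborel)"
  have E_psi: "?E i \<psi> \<le> I" for i
  proof -
    have "ennreal (?E i \<psi>) = levy_energy \<Phi> (cut \<nu> (eps i)) \<psi>"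
      by (rule levy_energy_cut_eq_integral[OF psi eps(1), symmetric])
    also have "\<dots> \<le> levy_energy \<Phi> \<nu> \<psi>"
      by (intro levy_energy_cut_le borel_measurable_continuous_onI psi(1))
    also have "\<dots> = ennreal I" using fin by (simp add: I_def)
    finally show ?thesis by (simp add: I_def)
  qed
  have E_nonneg: "0 \<le> ?E i (v 0)" for i
    by (intro integral_nonneg_AE AE_I2) (auto simp: Phi_nonneg)
  have le_i: "?E i (v 0) \<le> I - 2 * (\<Sum>j<N. b j i)" for i
    using tele[of N i] E_psi[of i] v_N by simp
  have lim_i: "(\<lambda>i. I - 2 * (\<Sum>j<N. b j i)) \<longlonglongrightarrow> I - 2 * S"
    unfolding S_def by (intro tendsto_intros b_lim) auto
  have nonneg: "0 \<le> I - 2 * S"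
    by (rule tendsto_lowerbound[OF lim_i]) (intro always_eventually allI order_trans[OF E_nonneg le_i], simp)
  have v_meas: "v j \<in> borel_measurable borel" for j
    by (rule borel_measurable_continuous_onI) (rule v_cont)
  have "levy_energy \<Phi> \<nu> (v 0) \<le> liminf (\<lambda>i. levy_energy \<Phi> (cut \<nu> (eps i)) (v 0))"
    by (rule levy_energy_lower_semicontinuous[OF sets_nu sigma_finite_nu Phi_continuous Phi_0 v_meas v_meas tendsto_const eps(2)])
  also have "\<dots> \<le> liminf (\<lambda>i. ennreal (I - 2 * (\<Sum>j<N. b j i)))"
  proof (intro Liminf_mono always_eventually allI)
    fix i
    have "levy_energy \<Phi> (cut \<nu> (eps i)) (v 0) = ennreal (?E i (v 0))"
      by (rule levy_energy_cut_eq_integral[OF v_cont v_bound v_out eps(1)])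
    also have "\<dots> \<le> ennreal (I - 2 * (\<Sum>j<N. b j i))"
      by (intro ennreal_leI le_i)
    finally show "levy_energy \<Phi> (cut \<nu> (eps i)) (v 0) \<le> ennreal (I - 2 * (\<Sum>j<N. b j i))" .
  qed
  also have "\<dots> = ennreal (I - 2 * S)"
    by (intro lim_imp_Liminf tendsto_ennrealI lim_i) simp
  finally have energy_le: "levy_energy \<Phi> \<nu> (v 0) \<le> ennreal (I - 2 * S)" .
  have S_lower: "- (\<integral>x. indicator (ball 0 r) x * (F (v 0 x) - F (\<psi> x)) \<partial>lborel) - 4 * e * measure lborel (ball (0::'a) r) \<le> S"
  proof -
    let ?l = "\<lambda>x. - (indicator (ball 0 r) x * (F (v 0 x) - F (\<psi> x))) - 4 * e * indicator (ball (0::'a) r) x"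
    have i1: "integrable lborel (\<lambda>x. indicator (ball 0 r) x * (F (v 0 x) - F (\<psi> x)))"
      by (intro integrable_F_difference v_cont psi(1) v_bound psi(2))
    have i2: "integrable lborel (\<lambda>x. 4 * e * indicator (ball (0::'a) r) x)"
      using emeasure_lborel_ball_finite[of "0::'a" r]
      by (intro integrable_mult_right integrable_real_indicator) auto
    have "(\<integral>x. ?l x \<partial>lborel) \<le> (\<integral>x. (\<Sum>j<N. ?\<phi> j x * (f (v j x) - e)) \<partial>lborel)"
    proof (rule integral_mono)
      show "integrable lborel ?l" using i1 i2 by auto
      show "integrable lborel (\<lambda>x. \<Sum>j<N. ?\<phi> j x * (f (v j x) - e))"
        by (intro Bochner_Integration.integrable_sum b_int) simp
      show "?l x \<le> (\<Sum>j<N. ?\<phi> j x * (f (v j x) - e))" for x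
      proof -
        have "(\<Sum>j<N. (F (v (Suc j) x) - F (v j x)) - 2 * e * ?\<phi> j x) \<le> (\<Sum>j<N. ?\<phi> j x * (f (v j x) - e))"
          by (intro sum_mono b_F) simp
        moreover have "(\<Sum>j<N. (F (v (Suc j) x) - F (v j x)) - 2 * e * ?\<phi> j x)
            = (F (\<psi> x) - F (v 0 x)) - 2 * e * (\<psi> x - v 0 x)"
          using sum_lessThan_telescope[of "\<lambda>j. F (v j x)" N] sum_lessThan_telescope[of "\<lambda>j. v j x" N] v_N
          by (simp add: sum_subtractf flip: sum_distrib_left)
        moreover have "2 * e * (\<psi> x - v 0 x) \<le> 2 * e * 2"
          using psi(2)[of x] v_bound[of 0 x] e by (intro mult_left_mono) (auto simp: abs_le_iff)
        ultimately show ?thesis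
          using v_out[of x 0] psi(3)[of x] by (cases "x \<in> ball 0 r") auto
      qed
    qed
    also have "\<dots> = S"
      unfolding S_def by (intro Bochner_Integration.integral_sum b_int) simp
    also have "(\<integral>x. ?l x \<partial>lborel) = - (\<integral>x. indicator (ball 0 r) x * (F (v 0 x) - F (\<psi> x)) \<partial>lborel)
        - 4 * e * measure lborel (ball (0::'a) r)"
      using i1 i2 by (subst Bochner_Integration.integral_diff) auto
    finally show ?thesis .
  qed
  have v0: "v 0 = (\<lambda>x. min (\<psi> x) (?w x + \<eta>))" by (auto simp: v_def a_def)
  show ?thesis
  proof (rule that[of "\<lambda>x. ?w x + \<eta>"])
    show "continuous_on UNIV (\<lambda>x. ?w x + \<eta>)" by (intro continuous_intros w_cont)
    show "-1 \<le> ?w x + \<eta>" for x using w_lower[of x] eta by simp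
    show "\<bar>?w x + \<eta> - u x\<bar> \<le> e" if "x \<in> ball 0 r" for x
      using a_in[OF that, of 0] w_near[of x] eta by (auto simp: a_def abs_le_iff)
    let ?b = "I + 2 * (\<integral>x. indicator (ball 0 r) x * (F (min (\<psi> x) (?w x + \<eta>)) - F (\<psi> x)) \<partial>lborel)
        + 8 * e * measure lborel (ball (0::'a) r)"
    have le: "I - 2 * S \<le> ?b" using S_lower unfolding v0 by simp
    show "0 \<le> enn2real (levy_energy \<Phi> \<nu> \<psi>)
       + 2 * (\<integral>x. indicator (ball 0 r) x * (F (min (\<psi> x) (?w x + \<eta>)) - F (\<psi> x)) \<partial>lborel)
       + 8 * e * measure lborel (ball (0::'a) r)"
      using order_trans[OF nonneg le] unfolding I_def .
    show "levy_energy \<Phi> \<nu> (\<lambda>x. min (\<psi> x) (?w x + \<eta>)) \<le> ennreal (enn2real (levy_energy \<Phi> \<nu> \<psi>)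
       + 2 * (\<integral>x. indicator (ball 0 r) x * (F (min (\<psi> x) (?w x + \<eta>)) - F (\<psi> x)) \<partial>lborel)
       + 8 * e * measure lborel (ball (0::'a) r))"
      using order_trans[OF energy_le ennreal_leI[OF le]] unfolding I_def v0 .
  qed
qed

text \<open>
  The second part, that the bound is a nonnegative real, keeps the first from being an artefact of the
  truncation of negative numbers in \<open>ennreal\<close>.
\<close>

lemma minimality:
  assumes psi: "continuous_on UNIV \<psi>" "\<And>x. \<bar>\<psi> x\<bar> \<le> 1" "\<And>x. x \<notin> ball 0 r \<Longrightarrow> \<psi> x = -1"
    and fin: "levy_energy \<Phi> \<nu> \<psi> < \<infinity>"
  shows "levy_energy \<Phi> \<nu> (\<lambda>x. min (\<psi> x) (u x)) \<le> ennreal (enn2real (levy_energy \<Phi> \<nu> \<psi>)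
       + 2 * (\<integral>x. indicator (ball 0 r) x * (F (min (\<psi> x) (u x)) - F (\<psi> x)) \<partial>lborel))" (is "_ \<le> ennreal ?a")
    and "0 \<le> enn2real (levy_energy \<Phi> \<nu> \<psi>)
       + 2 * (\<integral>x. indicator (ball 0 r) x * (F (min (\<psi> x) (u x)) - F (\<psi> x)) \<partial>lborel)"
proof -
  let ?V = "measure lborel (ball (0::'a) r)"
  let ?I = "enn2real (levy_energy \<Phi> \<nu> \<psi>)"
  let ?J = "\<lambda>w. \<integral>x. indicator (ball 0 r) x * (F (min (\<psi> x) (w x)) - F (\<psi> x)) \<partial>lborel"
  define good where "good n W \<longleftrightarrow> continuous_on UNIV W \<and> (\<forall>x. -1 \<le> W x) \<and> (\<forall>x\<in>ball 0 r. \<bar>W x - u x\<bar> \<le> eps n) \<and>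
      levy_energy \<Phi> \<nu> (\<lambda>x. min (\<psi> x) (W x)) \<le> ennreal (?I + 2 * ?J W + 8 * eps n * ?V) \<and>
      0 \<le> ?I + 2 * ?J W + 8 * eps n * ?V" for n W
  have "\<exists>W. good n W" for n
  proof (rule approximate_minimality[OF psi fin eps(1)[of n]])
    fix W
    assume W: "continuous_on UNIV W" "\<And>x. -1 \<le> W x" "\<And>x. x \<in> ball 0 r \<Longrightarrow> \<bar>W x - u x\<bar> \<le> eps n"
      "levy_energy \<Phi> \<nu> (\<lambda>x. min (\<psi> x) (W x)) \<le> ennreal (?I + 2 * ?J W + 8 * eps n * ?V)"
      "0 \<le> ?I + 2 * ?J W + 8 * eps n * ?V"
    show ?thesis unfolding good_def by (intro exI[of _ W] conjI allI ballI W)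
  qed
  then obtain W where "\<And>n. good n (W n)" by metis
  then have W: "\<And>n. continuous_on UNIV (W n)" "\<And>n x. -1 \<le> W n x"
      "\<And>n x. x \<in> ball 0 r \<Longrightarrow> \<bar>W n x - u x\<bar> \<le> eps n"
      "\<And>n. levy_energy \<Phi> \<nu> (\<lambda>x. min (\<psi> x) (W n x)) \<le> ennreal (?I + 2 * ?J (W n) + 8 * eps n * ?V)"
      "\<And>n. 0 \<le> ?I + 2 * ?J (W n) + 8 * eps n * ?V"
    unfolding good_def by simp_all
  let ?v = "\<lambda>n x. min (\<psi> x) (W n x)"
  let ?u = "\<lambda>x. min (\<psi> x) (u x)"
  have v_cont: "continuous_on UNIV (?v n)" for n by (intro continuous_intros psi W)
  have u_cont: "continuous_on UNIV ?u" by (intro continuous_intros psi u_continuous)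
  have v_bound: "\<bar>?v n x\<bar> \<le> 1" for n x
    using W(2)[of n x] psi(2)[of x] by (auto simp: min_def abs_le_iff)
  have v_lim: "(\<lambda>n. ?v n x) \<longlonglongrightarrow> ?u x" for x
  proof (cases "x \<in> ball 0 r")
    case True
    have "(\<lambda>n. W n x - u x) \<longlonglongrightarrow> 0"
      by (rule Lim_null_comparison[OF _ eps(2)]) (use W(3)[OF True] in auto)
    then have "(\<lambda>n. W n x) \<longlonglongrightarrow> u x" using LIM_zero_iff by blast
    then show ?thesis by (intro tendsto_min tendsto_const)
  next
    case False
    have "?v n x = -1" "?u x = -1" for n
      using psi(3)[OF False] W(2)[of n x] u_bound[of x] by auto
    then show ?thesis by simp
  qed
  have [measurable]: "?v n \<in> borel_measurable borel" "?u \<in> borel_measurable borel"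
      "\<psi> \<in> borel_measurable borel" "F \<in> borel_measurable borel" for n
    using v_cont u_cont psi F_continuous by (auto intro: borel_measurable_continuous_onI)
  have "compact (F ` {-1..1})"
    using F_continuous by (auto intro!: compact_continuous_image intro: continuous_on_subset)
  then obtain M where "\<forall>y\<in>F ` {-1..1}. norm y \<le> M"
    by (meson bounded_iff compact_imp_bounded)
  then have M: "\<bar>F s\<bar> \<le> M" if "\<bar>s\<bar> \<le> 1" for s using that by (auto simp: abs_le_iff)
  have J_lim: "(\<lambda>n. ?J (W n)) \<longlonglongrightarrow> ?J u"
  proof (rule integral_dominated_convergence)
    show "integrable lborel (\<lambda>x::'a. 2 * M * indicator (ball 0 r) x)"
      using emeasure_lborel_ball_finite[of "0::'a" r]
      by (intro integrable_mult_right integrable_real_indicator) auto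
    show "AE x in lborel. (\<lambda>n. indicator (ball 0 r) x * (F (?v n x) - F (\<psi> x)))
        \<longlonglongrightarrow> indicator (ball 0 r) x * (F (?u x) - F (\<psi> x))"
      by (intro AE_I2 tendsto_intros continuous_on_tendsto_compose[OF F_continuous v_lim]) auto
    show "AE x in lborel. norm (indicator (ball 0 r) x * (F (?v n x) - F (\<psi> x))) \<le> 2 * M * indicator (ball 0 r) x" for n
    proof (intro AE_I2)
      fix x :: 'a
      have "\<bar>F (?v n x) - F (\<psi> x)\<bar> \<le> 2 * M" using M[OF v_bound] M[OF psi(2)] by (smt (verit))
      then show "norm (indicator (ball 0 r) x * (F (?v n x) - F (\<psi> x))) \<le> 2 * M * indicator (ball 0 r) x"
        by (auto simp: indicator_def)
    qed
  qed (intro borel_measurable_times borel_measurable_indicator, auto)+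
  have lim: "(\<lambda>n. ?I + 2 * ?J (W n) + 8 * eps n * ?V) \<longlonglongrightarrow> ?I + 2 * ?J u + 8 * 0 * ?V"
    by (intro tendsto_intros J_lim eps(2))
  show "0 \<le> ?I + 2 * ?J u"
    using tendsto_lowerbound[OF lim, of 0] W(5) by (auto intro!: always_eventually simp del: of_nat_Suc)
  have "levy_energy \<Phi> \<nu> ?u \<le> liminf (\<lambda>n. levy_energy \<Phi> (cut \<nu> 0) (?v n))"
    by (rule levy_energy_lower_semicontinuous[OF sets_nu sigma_finite_nu Phi_continuous Phi_0 _ _ v_lim tendsto_const]) auto
  also have "\<dots> \<le> liminf (\<lambda>n. ennreal (?I + 2 * ?J (W n) + 8 * eps n * ?V))"
    by (intro Liminf_mono always_eventually allI) (simp add: cut_zero[OF sets_nu] W(4) del: of_nat_Suc)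
  also have "\<dots> = ennreal (?I + 2 * ?J u + 8 * 0 * ?V)"
    by (intro lim_imp_Liminf tendsto_ennrealI lim) simp
  finally show "levy_energy \<Phi> \<nu> ?u \<le> ennreal (?I + 2 * ?J u)" by simp
qed

end

section \<open>Singular kernels\<close>

lemma power_diff_le:
  fixes a b :: real
  assumes "0 \<le> a" "a \<le> b"
  shows "b ^ n - a ^ n \<le> real n * b ^ (n - 1) * (b - a)"
proof (induction n)
  case (Suc n)
  have "b ^ Suc n - a ^ Suc n = b * (b ^ n - a ^ n) + a ^ n * (b - a)" by (simp add: algebra_simps)
  also have "\<dots> \<le> b * (real n * b ^ (n - 1) * (b - a)) + b ^ n * (b - a)"
    using assms Suc by (intro add_mono mult_left_mono mult_right_mono power_mono) auto
  also have "\<dots> = real (Suc n) * b ^ (Suc n - 1) * (b - a)"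
    by (cases n) (simp_all add: algebra_simps)
  finally show ?case .
qed simp

text \<open>
  Allowing \<open>a < 0\<close>, where the inner ball is empty, spares a case distinction later: annuli whose width
  exceeds the outer radius obey the same bound. The centres may differ since only volumes are compared.
\<close>

lemma measure_ball_diff_le:
  assumes "a \<le> b" "0 \<le> b"
  shows "measure lborel (ball (c::'a::euclidean_space) b) - measure lborel (ball (c'::'a) a)
      \<le> unit_ball_vol (real DIM('a)) * real DIM('a) * b ^ (DIM('a) - 1) * (b - a)"
proof -
  let ?V = "unit_ball_vol (real DIM('a))" and ?n = "DIM('a)"
  have V: "0 \<le> ?V" by simp
  show ?thesis
  proof (cases "0 \<le> a")
    case True
    have "measure lborel (ball c b) - measure lborel (ball c' a) = ?V * (b ^ ?n - a ^ ?n)"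
      using True assms by (simp add: content_ball algebra_simps)
    also have "\<dots> \<le> ?V * (real ?n * b ^ (?n - 1) * (b - a))"
      by (intro mult_left_mono power_diff_le True assms V)
    finally show ?thesis by (simp add: mult.assoc)
  next
    case False
    have "b ^ ?n = b ^ (?n - 1) * b" by (metis DIM_positive power_minus_mult)
    also have "\<dots> \<le> b ^ (?n - 1) * (real ?n * (b - a))"
    proof (intro mult_left_mono)
      have "b \<le> 1 * (b - a)" using False by simp
      also have "\<dots> \<le> real ?n * (b - a)" using DIM_positive[where 'a = 'a] assms
        by (intro mult_right_mono) auto
      finally show "b \<le> real ?n * (b - a)" .
    qed (use assms in auto)
    finally have le: "?V * b ^ ?n \<le> ?V * (b ^ (?n - 1) * (real ?n * (b - a)))"
      by (intro mult_left_mono V)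
    have zero: "measure lborel (ball c' a) = 0" using False by simp
    show ?thesis unfolding zero using le assms by (simp add: content_ball mult_ac)
  qed
qed

text \<open>
  Dyadic decomposition of the ball: on the shell where \<open>|z|\<close> is between \<open>r\<^sub>k / 2\<close> and \<open>r\<^sub>k = \<rho> / 2\<^sup>k\<close> the weight
  is comparable to \<open>r\<^sub>k\<^bsup>- n - \<alpha>\<^esup>\<close>, so the shell contributes at most a multiple of \<open>r\<^sub>k\<^bsup>\<beta> - \<alpha>\<^esup>\<close>, a geometric
  sequence. The constant is explicit in \<open>A\<close> so that it is uniform over families of functions \<open>g\<close>.
\<close>

lemma nn_integral_power_weight_le:
  fixes g :: "'a::euclidean_space \<Rightarrow> ennreal"
  assumes [measurable]: "g \<in> borel_measurable borel"
    and \<rho>: "\<rho> > 0" and \<gamma>: "\<alpha> < \<beta>" and A: "A \<ge> 0" and \<alpha>: "\<alpha> > 0"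
    and g: "\<And>r. 0 < r \<Longrightarrow> r \<le> \<rho> \<Longrightarrow>
      (\<integral>\<^sup>+z. indicator (ball 0 r) z * g z \<partial>lborel) \<le> ennreal (A * r powr (real DIM('a) + \<beta>))"
  shows "(\<integral>\<^sup>+z. indicator (ball 0 \<rho>) z * g z * ennreal (norm z powr - (real DIM('a) + \<alpha>)) \<partial>lborel)
      \<le> ennreal (A * (2 powr (real DIM('a) + \<alpha>) * \<rho> powr (\<beta> - \<alpha>) / (1 - 2 powr - (\<beta> - \<alpha>))))"
proof -
  define s where "s = real DIM('a) + \<alpha>"
  have s: "s > 0" using \<alpha> by (simp add: s_def add_nonneg_pos)
  define r where "r k = \<rho> / 2 ^ k" for k :: nat
  have r: "r k > 0" "r k \<le> \<rho>" for k using \<rho> by (auto simp: r_def field_simps)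
  define x where "x = 2 powr - (\<beta> - \<alpha>)"
  have x: "0 < x" "x < 1" using \<gamma> by (auto simp: x_def powr_less_one)
  let ?c = "\<lambda>k. ennreal ((r k / 2) powr - s)"
  have pt: "indicator (ball 0 \<rho>) z * g z * ennreal (norm z powr - s)
      \<le> (\<Sum>k. ?c k * (indicator (ball 0 (r k)) z * g z))" for z :: 'a
  proof (cases "z \<in> ball 0 \<rho> \<and> z \<noteq> 0")
    case True
    then have nz: "norm z > 0" "norm z < \<rho>" by auto
    have "\<exists>k. \<rho> / 2 ^ k \<le> norm z"
    proof -
      obtain k where "\<rho> / norm z < 2 ^ k" using real_arch_pow[of 2 "\<rho> / norm z"] by auto
      then show ?thesis using nz by (intro exI[of _ k]) (auto simp: field_simps)
    qed
    define m where "m = (LEAST k. \<rho> / 2 ^ k \<le> norm z)"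
    have m: "\<rho> / 2 ^ m \<le> norm z" unfolding m_def by (rule LeastI_ex) fact
    have "m \<noteq> 0" using m nz by (cases m) auto
    then obtain k where k: "m = Suc k" by (cases m) auto
    have "\<not> \<rho> / 2 ^ k \<le> norm z" by (rule not_less_Least) (simp add: m_def[symmetric] k)
    then have in_k: "z \<in> ball 0 (r k)" by (simp add: r_def)
    have "r k / 2 \<le> norm z" using m by (simp add: k r_def)
    then have "norm z powr - s \<le> (r k / 2) powr - s"
      using r[of k] s by (intro powr_mono2') auto
    then have "indicator (ball 0 \<rho>) z * g z * ennreal (norm z powr - s) \<le> ?c k * (indicator (ball 0 (r k)) z * g z)"
      using True in_k by (auto intro!: mult_right_mono ennreal_leI simp: mult.commute[of "g z"])
    also have "\<dots> = (\<Sum>k\<in>{k}. ?c k * (indicator (ball 0 (r k)) z * g z))" by simp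
    also have "\<dots> \<le> (\<Sum>k. ?c k * (indicator (ball 0 (r k)) z * g z))"
      by (intro sum_le_suminf) auto
    finally show ?thesis .
  qed (use s in auto)
  have summ: "(\<lambda>k. A * (2 powr s * \<rho> powr (\<beta> - \<alpha>)) * x ^ k) sums (A * (2 powr s * \<rho> powr (\<beta> - \<alpha>)) * (1 / (1 - x)))"
    using x by (intro sums_mult geometric_sums) auto
  have rk: "(r k / 2) powr - s * r k powr (real DIM('a) + \<beta>) = 2 powr s * \<rho> powr (\<beta> - \<alpha>) * x ^ k" for k
  proof -
    have "(r k / 2) powr - s * r k powr (real DIM('a) + \<beta>) = 2 powr s * (r k powr - s * r k powr (real DIM('a) + \<beta>))"
      using r[of k] by (simp add: powr_divide powr_minus field_simps)
    also have "r k powr - s * r k powr (real DIM('a) + \<beta>) = r k powr (\<beta> - \<alpha>)"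
      by (simp add: powr_add[symmetric] s_def)
    also have "r k powr (\<beta> - \<alpha>) = \<rho> powr (\<beta> - \<alpha>) * x ^ k"
    proof -
      have "x ^ k = (2 ^ k) powr - (\<beta> - \<alpha>)"
        unfolding x_def by (simp add: powr_realpow[symmetric] powr_powr mult.commute)
      moreover have "(\<rho> / 2 ^ k) powr (\<beta> - \<alpha>) = \<rho> powr (\<beta> - \<alpha>) / (2 ^ k) powr (\<beta> - \<alpha>)"
        by (rule powr_divide)
      ultimately show ?thesis unfolding r_def powr_minus by (simp add: divide_inverse)
    qed
    finally show ?thesis by simp
  qed
  have [measurable]: "(\<lambda>z. indicator (ball 0 (r k)) z * g z) \<in> borel_measurable borel" for k
    by (rule borel_measurable_times_ennreal[OF borel_measurable_indicator]) auto
  have "(\<integral>\<^sup>+z. indicator (ball 0 \<rho>) z * g z * ennreal (norm z powr - s) \<partial>lborel)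
      \<le> (\<integral>\<^sup>+z. (\<Sum>k. ?c k * (indicator (ball 0 (r k)) z * g z)) \<partial>lborel)"
    by (intro nn_integral_mono pt)
  also have "\<dots> = (\<Sum>k. \<integral>\<^sup>+z. ?c k * (indicator (ball 0 (r k)) z * g z) \<partial>lborel)"
    by (rule nn_integral_suminf) measurable
  also have "\<dots> = (\<Sum>k. ?c k * (\<integral>\<^sup>+z. indicator (ball 0 (r k)) z * g z \<partial>lborel))"
    by (intro suminf_cong nn_integral_cmult) measurable
  also have "\<dots> \<le> (\<Sum>k. ?c k * ennreal (A * r k powr (real DIM('a) + \<beta>)))"
    by (intro suminf_le mult_left_mono g r) auto
  also have "\<dots> = (\<Sum>k. ennreal (A * (2 powr s * \<rho> powr (\<beta> - \<alpha>)) * x ^ k))"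
  proof (rule suminf_cong)
    fix k
    have "?c k * ennreal (A * r k powr (real DIM('a) + \<beta>))
        = ennreal (A * ((r k / 2) powr - s * r k powr (real DIM('a) + \<beta>)))"
      using A by (subst ennreal_mult[symmetric]) (auto simp: mult_ac)
    then show "?c k * ennreal (A * r k powr (real DIM('a) + \<beta>)) = ennreal (A * (2 powr s * \<rho> powr (\<beta> - \<alpha>)) * x ^ k)"
      unfolding rk by (simp add: mult.assoc)
  qed
  also have "\<dots> = ennreal (A * (2 powr s * \<rho> powr (\<beta> - \<alpha>)) * (1 / (1 - x)))"
    using A x summ by (intro suminf_ennreal_eq) auto
  finally show ?thesis unfolding s_def x_def by simp
qed

lemma integrable_indicator_continuous:
  fixes g :: "'a::euclidean_space \<Rightarrow> real"
  assumes "continuous_on UNIV g" "A \<in> sets borel" "bounded A"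
  shows "integrable lborel (\<lambda>z. indicator A z * g z)"
proof -
  obtain R where R: "A \<subseteq> cball 0 R" using bounded_subset_ballD[OF assms(3), of 0] ball_subset_cball by blast
  have "integrable lborel (\<lambda>z. indicator (cball 0 R) z *\<^sub>R g z)"
    by (rule borel_integrable_compact) (auto intro: continuous_on_subset[OF assms(1)])
  then show ?thesis
  proof (rule Bochner_Integration.integrable_bound)
    have [measurable]: "g \<in> borel_measurable borel" using assms(1) by (rule borel_measurable_continuous_onI)
    show "(\<lambda>z. indicator A z * g z) \<in> borel_measurable lborel"
      using assms(2) by measurable
    show "AE z in lborel. norm (indicator A z * g z) \<le> norm (indicator (cball 0 R) z *\<^sub>R g z)"
      using R by (intro AE_I2) (auto simp: indicator_def)
  qed
qed

text \<open>
  For \<open>|p| \<le> q r\<close> the argument of \<open>G\<close> is of order \<open>r\<^sup>2\<close>, and \<open>r\<^bsup>2 (\<beta> - 1)\<^esup>\<close> is at most a multiple of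
  \<open>r\<^sup>\<beta>\<close>. Otherwise choose \<open>h\<close> parallel to \<open>p\<close> with \<open>p \<cdot> h = q r\<^sup>2\<close>; then the integral is that of the odd
  function \<open>G(p \<cdot> z)\<close> over the ball centred at \<open>h\<close>. The concentric ball of radius \<open>r - |h|\<close> around the
  origin lies inside and contributes zero, while the rest has volume of order \<open>r\<^bsup>n-1\<^esup> |h|\<close>. The factor
  \<open>1 / |p|\<close> in \<open>|h|\<close> is absorbed by the bound on \<open>G\<close>, leaving \<open>|p|\<^bsup>\<beta>-2\<^esup>\<close>, which is bounded for bounded
  \<open>p\<close> because \<open>\<beta> \<ge> 2\<close>.
\<close>

lemma tilted_ball_integral_le:
  fixes G :: "real \<Rightarrow> real"
  assumes G: "continuous_on UNIV G" "\<And>t. G (- t) = - G t" "\<And>s t. s \<le> t \<Longrightarrow> G s \<le> G t"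
    and growth: "C \<ge> 0" "\<And>t. t > 0 \<Longrightarrow> G t \<le> C * t powr (\<beta> - 1)"
    and \<beta>: "\<beta> \<ge> 2" and q: "q > 0" and P: "P \<ge> 0" and \<rho>: "\<rho> > 0"
  shows "\<exists>A\<ge>0. \<forall>(p::'a::euclidean_space) r. norm p \<le> P \<longrightarrow> 0 < r \<longrightarrow> r \<le> \<rho> \<longrightarrow>
    (\<integral>z. indicator (ball 0 r) z * G (p \<bullet> z + q * r\<^sup>2) \<partial>lborel) \<le> A * r powr (real DIM('a) + \<beta>)"
proof -
  define V where "V = unit_ball_vol (real DIM('a))"
  define n where "n = DIM('a)"
  have V: "V \<ge> 0" by (simp add: V_def)
  have n: "n > 0" by (simp add: n_def)
  define A1 where "A1 = C * (2 * q) powr (\<beta> - 1) * \<rho> powr (\<beta> - 2) * V"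
  define A2 where "A2 = C * 2 powr (\<beta> - 1) * V * real n * q * P powr (\<beta> - 2)"
  have A: "A1 \<ge> 0" "A2 \<ge> 0" using growth(1) V q P by (auto simp: A1_def A2_def)
  have "(\<integral>z. indicator (ball 0 r) z * G (p \<bullet> z + q * r\<^sup>2) \<partial>lborel) \<le> (A1 + A2) * r powr (real n + \<beta>)"
    if p: "norm p \<le> P" and r: "0 < r" "r \<le> \<rho>" for p :: 'a and r
  proof (cases "norm p \<le> q * r")
    case True
    let ?K = "C * (2 * q * r\<^sup>2) powr (\<beta> - 1)"
    have "(\<integral>z. indicator (ball 0 r) z * G (p \<bullet> z + q * r\<^sup>2) \<partial>lborel) \<le> (\<integral>z. indicator (ball (0::'a) r) z * ?K \<partial>lborel)"
    proof (rule integral_mono)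
      show "indicator (ball 0 r) z * G (p \<bullet> z + q * r\<^sup>2) \<le> indicator (ball (0::'a) r) z * ?K" for z
      proof (cases "z \<in> ball 0 r")
        case inb: True
        have "p \<bullet> z \<le> norm p * norm z" by (rule norm_cauchy_schwarz)
        also have "\<dots> \<le> (q * r) * r" using True inb q r by (intro mult_mono) auto
        finally have "p \<bullet> z + q * r\<^sup>2 \<le> 2 * q * r\<^sup>2" by (simp add: power2_eq_square)
        then have "G (p \<bullet> z + q * r\<^sup>2) \<le> G (2 * q * r\<^sup>2)" by (rule G)
        also have "\<dots> \<le> ?K" using q r by (intro growth) auto
        finally show ?thesis using inb by simp
      qed simp
      show "integrable lborel (\<lambda>z. indicator (ball 0 r) z * G (p \<bullet> z + q * r\<^sup>2))"
        by (intro integrable_indicator_continuous continuous_on_compose2[OF G(1)] continuous_intros) auto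
    qed (intro integrable_indicator_continuous continuous_intros, auto)
    also have "\<dots> = ?K * (V * r ^ n)" using r by (simp add: content_ball V_def n_def)
    also have "\<dots> = C * (2 * q) powr (\<beta> - 1) * V * (r powr (2 * (\<beta> - 1)) * r powr real n)"
    proof -
      have "(r\<^sup>2) powr (\<beta> - 1) = r powr (2 * (\<beta> - 1))" using r by (simp add: powr_powr flip: powr_numeral)
      then have "(2 * q * r\<^sup>2) powr (\<beta> - 1) = (2 * q) powr (\<beta> - 1) * r powr (2 * (\<beta> - 1))"
        using q r by (simp add: powr_mult)
      then show ?thesis using r by (simp add: powr_realpow)
    qed
    also have "r powr (2 * (\<beta> - 1)) * r powr real n = r powr (\<beta> - 2) * r powr (real n + \<beta>)"
      by (simp flip: powr_add add: algebra_simps)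
    also have "C * (2 * q) powr (\<beta> - 1) * V * (r powr (\<beta> - 2) * r powr (real n + \<beta>))
        \<le> C * (2 * q) powr (\<beta> - 1) * V * (\<rho> powr (\<beta> - 2) * r powr (real n + \<beta>))"
      using r \<beta> growth(1) V q by (intro mult_left_mono mult_right_mono powr_mono2) auto
    also have "\<dots> = A1 * r powr (real n + \<beta>)" by (simp add: A1_def)
    also have "\<dots> \<le> (A1 + A2) * r powr (real n + \<beta>)" using A by (intro mult_right_mono) auto
    finally show ?thesis .
  next
    case False
    then have p0: "norm p > 0" using q r by (smt (verit) mult_pos_pos)
    \<comment> \<open>The shift that absorbs the quadratic term.\<close>
    define h where "h = (q * r\<^sup>2 / (norm p)\<^sup>2) *\<^sub>R p"
    have ph: "p \<bullet> h = q * r\<^sup>2" using p0 by (simp add: h_def power2_norm_eq_inner)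
    have nh: "norm h = q * r\<^sup>2 / norm p" using p0 q by (simp add: h_def power2_eq_square)
    have nh_le: "norm h \<le> r" using False p0 r by (simp add: nh divide_le_eq power2_eq_square mult_ac)
    let ?H = "\<lambda>z. G (p \<bullet> z)"
    let ?B = "ball (0::'a) (r - norm h)"
    have H: "continuous_on UNIV ?H" by (intro continuous_on_compose2[OF G(1)] continuous_intros) auto
    have sub: "?B \<subseteq> ball h r"
    proof
      fix z assume "z \<in> ?B"
      then show "z \<in> ball h r" using norm_triangle_ineq4[of h z] by (simp add: dist_norm)
    qed
    have "(\<integral>z. indicator (ball 0 r) z * G (p \<bullet> z + q * r\<^sup>2) \<partial>lborel)
        = (\<integral>z. indicator (ball h r) (z + h) * ?H (z + h) \<partial>lborel)"
    proof (intro Bochner_Integration.integral_cong refl)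
      fix z
      have "(z + h \<in> ball h r) = (z \<in> ball 0 r)" by (simp add: dist_norm)
      then show "indicator (ball 0 r) z * G (p \<bullet> z + q * r\<^sup>2) = indicator (ball h r) (z + h) * ?H (z + h)"
        by (simp add: inner_add_right ph indicator_def)
    qed
    also have "\<dots> = (\<integral>z. indicator (ball h r) z * ?H z \<partial>lborel)"
      by (rule integral_translate)
         (intro borel_measurable_times borel_measurable_indicator borel_measurable_continuous_onI[OF H], simp)
    also have "\<dots> = (\<integral>z. indicator ?B z * ?H z + indicator (ball h r - ?B) z * ?H z \<partial>lborel)"
      using sub by (intro Bochner_Integration.integral_cong) (auto simp: indicator_def)
    also have "\<dots> = (\<integral>z. indicator ?B z * ?H z \<partial>lborel) + (\<integral>z. indicator (ball h r - ?B) z * ?H z \<partial>lborel)"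
      by (intro Bochner_Integration.integral_add integrable_indicator_continuous H) (auto intro: bounded_subset[OF bounded_ball])
    also have "(\<integral>z. indicator ?B z * ?H z \<partial>lborel) = 0"
    proof -
      have "(\<integral>z. indicator ?B z * ?H z \<partial>lborel) = (\<integral>z. indicator ?B (- z) * ?H (- z) \<partial>lborel)"
        by (rule integral_reflect_symmetric[symmetric, OF sets_lborel lborel_reflect])
           (intro borel_measurable_times borel_measurable_indicator borel_measurable_continuous_onI[OF H], simp)
      also have "\<dots> = (\<integral>z. - (indicator ?B z * ?H z) \<partial>lborel)"
        by (intro Bochner_Integration.integral_cong) (auto simp: indicator_def G(2))
      finally show ?thesis by simp
    qed
    also have "(\<integral>z. indicator (ball h r - ?B) z * ?H z \<partial>lborel)
        \<le> (\<integral>z. indicator (ball h r - ?B) z * (C * (2 * norm p * r) powr (\<beta> - 1)) \<partial>lborel)"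
    proof (rule integral_mono)
      show "indicator (ball h r - ?B) z * ?H z \<le> indicator (ball h r - ?B) z * (C * (2 * norm p * r) powr (\<beta> - 1))" for z
      proof (cases "z \<in> ball h r")
        case inb: True
        then have "norm z \<le> 2 * r" using nh_le norm_triangle_ineq2[of z h] by (simp add: dist_norm norm_minus_commute)
        then have "p \<bullet> z \<le> 2 * norm p * r"
          using norm_cauchy_schwarz[of p z] mult_left_mono[of "norm z" "2 * r" "norm p"] by simp
        then have "G (p \<bullet> z) \<le> G (2 * norm p * r)" by (rule G)
        also have "\<dots> \<le> C * (2 * norm p * r) powr (\<beta> - 1)" using p0 r by (intro growth) auto
        finally show ?thesis by (intro mult_left_mono) auto
      qed simp
    qed (intro integrable_indicator_continuous H continuous_intros; auto intro: bounded_subset[OF bounded_ball])+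
    also have "\<dots> = C * (2 * norm p * r) powr (\<beta> - 1) * measure lborel (ball h r - ?B)"
      by simp
    also have "measure lborel (ball h r - ?B) = measure lborel (ball h r) - measure lborel ?B"
      using sub emeasure_lborel_ball_finite[of h r] by (intro measure_Diff) auto
    also have "C * (2 * norm p * r) powr (\<beta> - 1) * \<dots> \<le> C * (2 * norm p * r) powr (\<beta> - 1) * (V * real n * r ^ (n - 1) * (r - (r - norm h)))"
      unfolding V_def n_def using growth(1) r by (intro mult_left_mono measure_ball_diff_le) auto
    also have "\<dots> = C * 2 powr (\<beta> - 1) * V * real n * q * (norm p powr (\<beta> - 1) / norm p) * (r powr (\<beta> - 1) * (r ^ (n - 1) * r\<^sup>2))"
      using p0 r by (simp add: nh powr_mult)
    also have "norm p powr (\<beta> - 1) / norm p = norm p powr (\<beta> - 2)"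
      using p0 powr_diff[of "norm p" "\<beta> - 1" 1] by simp
    also have "r powr (\<beta> - 1) * (r ^ (n - 1) * r\<^sup>2) = r powr (real n + \<beta>)"
    proof -
      have "r ^ (n - 1) * r\<^sup>2 = r ^ (n + 1)" using n by (simp flip: power_add)
      also have "\<dots> = r powr (real n + 1)" using powr_realpow[OF r(1), of "n + 1"] by (simp add: add.commute)
      finally have "r ^ (n - 1) * r\<^sup>2 = r powr (real n + 1)" .
      then show ?thesis by (simp add: powr_add[symmetric] add.commute)
    qed
    also have "C * 2 powr (\<beta> - 1) * V * real n * q * norm p powr (\<beta> - 2) * r powr (real n + \<beta>) \<le> A2 * r powr (real n + \<beta>)"
      unfolding A2_def using p \<beta> growth(1) V q by (intro mult_left_mono mult_right_mono powr_mono2) auto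
    also have "\<dots> \<le> (A1 + A2) * r powr (real n + \<beta>)" using A by (intro mult_right_mono) auto
    finally show ?thesis by simp
  qed
  then show ?thesis using A by (intro exI[of _ "A1 + A2"]) (simp add: n_def)
qed

lemma nn_integral_near_origin_le:
  fixes g :: "'a::euclidean_space \<Rightarrow> ennreal" and k :: "'a \<Rightarrow> real"
  assumes [measurable]: "g \<in> borel_measurable borel" "k \<in> borel_measurable borel"
    and near: "AE z in lborel. z \<in> ball 0 \<rho> \<longrightarrow> k z \<le> \<Lambda> * norm z powr - (real DIM('a) + \<alpha>)"
    and "\<Lambda> \<ge> 0" "\<rho> > 0" "\<alpha> < \<beta>" "A \<ge> 0" "\<alpha> > 0"
    and g: "\<And>r. 0 < r \<Longrightarrow> r \<le> \<rho> \<Longrightarrow>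
      (\<integral>\<^sup>+z. indicator (ball 0 r) z * g z \<partial>lborel) \<le> ennreal (A * r powr (real DIM('a) + \<beta>))"
  shows "(\<integral>\<^sup>+z. indicator (ball 0 \<rho>) z * g z \<partial>density lborel (\<lambda>z. ennreal (k z)))
      \<le> ennreal \<Lambda> * ennreal (A * (2 powr (real DIM('a) + \<alpha>) * \<rho> powr (\<beta> - \<alpha>) / (1 - 2 powr - (\<beta> - \<alpha>))))"
proof -
  have [measurable]: "(\<lambda>z. indicator (ball 0 \<rho>) z * g z) \<in> borel_measurable borel"
    by (rule borel_measurable_times_ennreal[OF borel_measurable_indicator]) auto
  have "(\<integral>\<^sup>+z. indicator (ball 0 \<rho>) z * g z \<partial>density lborel (\<lambda>z. ennreal (k z)))
      = (\<integral>\<^sup>+z. ennreal (k z) * (indicator (ball 0 \<rho>) z * g z) \<partial>lborel)"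
    by (rule nn_integral_density) auto
  also have "\<dots> \<le> (\<integral>\<^sup>+z. ennreal \<Lambda> * (indicator (ball 0 \<rho>) z * g z * ennreal (norm z powr - (real DIM('a) + \<alpha>))) \<partial>lborel)"
  proof (rule nn_integral_mono_AE, use near in eventually_elim)
    case (elim z)
    show ?case
    proof (cases "z \<in> ball 0 \<rho>")
      case True
      then have "ennreal (k z) \<le> ennreal \<Lambda> * ennreal (norm z powr - (real DIM('a) + \<alpha>))"
        using elim \<open>\<Lambda> \<ge> 0\<close> by (simp add: ennreal_mult[symmetric] ennreal_leI)
      from mult_right_mono[OF this, of "g z"] show ?thesis using True by (simp add: mult_ac)
    qed simp
  qed
  also have "\<dots> = ennreal \<Lambda> * (\<integral>\<^sup>+z. indicator (ball 0 \<rho>) z * g z * ennreal (norm z powr - (real DIM('a) + \<alpha>)) \<partial>lborel)"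
    by (rule nn_integral_cmult) measurable
  also have "\<dots> \<le> ennreal \<Lambda> * ennreal (A * (2 powr (real DIM('a) + \<alpha>) * \<rho> powr (\<beta> - \<alpha>) / (1 - 2 powr - (\<beta> - \<alpha>))))"
    using assms by (intro mult_left_mono nn_integral_power_weight_le) auto
  finally show ?thesis .
qed

lemma finite_beta_moment_near_origin:
  fixes k :: "'a::euclidean_space \<Rightarrow> real"
  assumes "k \<in> borel_measurable borel"
    and "AE z in lborel. z \<in> ball 0 \<rho> \<longrightarrow> k z \<le> \<Lambda> * norm z powr - (real DIM('a) + \<alpha>)"
    and "\<Lambda> \<ge> 0" "\<rho> > 0" "\<alpha> < \<beta>" "\<alpha> > 0"
  shows "(\<integral>\<^sup>+z. indicator (ball 0 \<rho>) z * ennreal (norm z powr \<beta>) \<partial>density lborel (\<lambda>z. ennreal (k z))) < \<infinity>"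
proof -
  let ?V = "unit_ball_vol (real DIM('a))"
  have "(\<integral>\<^sup>+z. indicator (ball 0 \<rho>) z * ennreal (norm z powr \<beta>) \<partial>density lborel (\<lambda>z. ennreal (k z)))
     \<le> ennreal \<Lambda> * ennreal (?V * (2 powr (real DIM('a) + \<alpha>) * \<rho> powr (\<beta> - \<alpha>) / (1 - 2 powr - (\<beta> - \<alpha>))))"
  proof (rule nn_integral_near_origin_le[OF _ assms(1-5) _ assms(6)])
    fix r :: real assume r: "0 < r" "r \<le> \<rho>"
    have "(\<integral>\<^sup>+z. indicator (ball (0::'a) r) z * ennreal (norm z powr \<beta>) \<partial>lborel)
        \<le> (\<integral>\<^sup>+z. ennreal (r powr \<beta>) * indicator (ball (0::'a) r) z \<partial>lborel)"
      using assms by (intro nn_integral_mono) (auto simp: indicator_def intro!: ennreal_leI powr_mono2)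
    also have "\<dots> = ennreal (r powr \<beta>) * ennreal (?V * r ^ DIM('a))"
      using r by (simp add: nn_integral_cmult_indicator emeasure_ball)
    also have "\<dots> = ennreal (?V * r powr (real DIM('a) + \<beta>))"
      using r by (simp add: ennreal_mult[symmetric] powr_add powr_realpow mult_ac)
    finally show "(\<integral>\<^sup>+z. indicator (ball (0::'a) r) z * ennreal (norm z powr \<beta>) \<partial>lborel) \<le> ennreal (?V * r powr (real DIM('a) + \<beta>))" .
  qed auto
  also have "\<dots> < \<infinity>" by (simp add: ennreal_mult_less_top)
  finally show ?thesis .
qed

text \<open>
  By symmetry of the truncated measure only the even part of the integrand in \<open>z\<close> matters. This even
  part is nonnegative, so it may be estimated from above by the power weight and over all jumps,
  whatever the truncation.
\<close>

lemma (in levy_measure) one_sided_singular_bound: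
  fixes k :: "'a \<Rightarrow> real"
  assumes nu: "\<nu> = density lborel (\<lambda>z. ennreal (k z))" and k: "k \<in> borel_measurable borel"
    and near: "AE z in lborel. z \<in> ball 0 \<rho> \<longrightarrow> k z \<le> \<Lambda> * norm z powr - (real DIM('a) + \<alpha>)"
    and par: "\<Lambda> \<ge> 0" "\<rho> > 0" "\<alpha> < \<beta>" "\<alpha> > 0" "\<beta> \<ge> 2" "q > 0"
    and G: "continuous_on UNIV G" "\<And>t. G (- t) = - G t" "\<And>s t. s \<le> t \<Longrightarrow> G s \<le> G t"
    and growth: "C \<ge> 0" "\<And>t. t > 0 \<Longrightarrow> G t \<le> C * t powr (\<beta> - 1)"
  shows "\<exists>C. \<forall>p \<epsilon>. norm p \<le> P \<longrightarrow> \<epsilon> > 0 \<longrightarrow>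
       (\<integral>z. indicator (ball 0 \<rho>) z * G (p \<bullet> z + q * (norm z)\<^sup>2) \<partial>cut \<nu> \<epsilon>) \<le> C"
proof -
  obtain A where A: "A \<ge> 0" "\<And>(p::'a) r. norm p \<le> max P 0 \<Longrightarrow> 0 < r \<Longrightarrow> r \<le> \<rho> \<Longrightarrow>
    (\<integral>z. indicator (ball 0 r) z * G (p \<bullet> z + q * r\<^sup>2) \<partial>lborel) \<le> A * r powr (real DIM('a) + \<beta>)"
    using tilted_ball_integral_le[where ?'a = 'a, OF G growth par(5,6) max.cobounded2 par(2), of P] by blast
  define S where "S = \<Lambda> * (2 * A * (2 powr (real DIM('a) + \<alpha>) * \<rho> powr (\<beta> - \<alpha>) / (1 - 2 powr - (\<beta> - \<alpha>))))"
  have x: "2 powr - (\<beta> - \<alpha>) < (1::real)" using par(3) by (simp add: powr_less_one)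
  have S: "S \<ge> 0" unfolding S_def using A par x by (intro mult_nonneg_nonneg divide_nonneg_nonneg) auto
  have "(\<integral>z. indicator (ball 0 \<rho>) z * G (p \<bullet> z + q * (norm z)\<^sup>2) \<partial>cut \<nu> \<epsilon>) \<le> S / 2"
    if p: "norm p \<le> P" and e: "\<epsilon> > 0" for p :: 'a and \<epsilon>
  proof -
    interpret N: finite_measure "cut \<nu> \<epsilon>" by (rule finite_cut) fact
    let ?\<Psi> = "\<lambda>z. indicator (ball 0 \<rho>) z * G (p \<bullet> z + q * (norm z)\<^sup>2)"
    let ?s = "norm p * \<rho> + q * \<rho>\<^sup>2"
    define g where "g z = G (p \<bullet> z + q * (norm z)\<^sup>2) + G (- (p \<bullet> z) + q * (norm z)\<^sup>2)" for z
    have g_cont: "continuous_on UNIV g" unfolding g_def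
      by (intro continuous_intros continuous_on_compose2[OF G(1)]) auto
    have \<Psi>_meas: "?\<Psi> \<in> borel_measurable borel"
      by (intro borel_measurable_times borel_measurable_indicator borel_measurable_continuous_onI
            continuous_on_compose2[OF G(1)] continuous_intros) auto
    have g_nonneg: "0 \<le> g z" for z
      using G(3)[of "- (q * (norm z)\<^sup>2) + p \<bullet> z" "q * (norm z)\<^sup>2 + p \<bullet> z"] par
        G(2)[of "- (p \<bullet> z) + q * (norm z)\<^sup>2"]
      by (simp add: g_def add.commute)
    have int: "integrable (cut \<nu> \<epsilon>) ?\<Psi>"
    proof (rule N.integrable_const_bound[where B = "G ?s"])
      show "AE z in cut \<nu> \<epsilon>. norm (?\<Psi> z) \<le> G ?s"
      proof (intro AE_I2)
        fix z
        have s0: "0 \<le> G ?s" using G(3)[of "- ?s" ?s] G(2)[of ?s] par by simp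
        show "norm (?\<Psi> z) \<le> G ?s"
        proof (cases "z \<in> ball 0 \<rho>")
          case True
          have "\<bar>p \<bullet> z\<bar> \<le> norm p * \<rho>"
            by (rule order_trans[OF Cauchy_Schwarz_ineq2]) (use True in \<open>auto intro!: mult_left_mono\<close>)
          moreover have "q * (norm z)\<^sup>2 \<le> q * \<rho>\<^sup>2" "0 \<le> q * (norm z)\<^sup>2"
            using True par by (auto intro!: mult_left_mono power_mono)
          ultimately have "- ?s \<le> p \<bullet> z + q * (norm z)\<^sup>2" "p \<bullet> z + q * (norm z)\<^sup>2 \<le> ?s"
            by linarith+
          from G(3)[OF this(1)] G(3)[OF this(2)] show ?thesis
            using True G(2)[of ?s] by (simp add: abs_le_iff)
        qed (use s0 in simp)
      qed
      show "?\<Psi> \<in> borel_measurable (cut \<nu> \<epsilon>)" using \<Psi>_meas by measurable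
    qed
    have int': "integrable (cut \<nu> \<epsilon>) (\<lambda>z. ?\<Psi> (- z))"
    proof -
      have "integrable (distr (cut \<nu> \<epsilon>) borel uminus) ?\<Psi>" using int by (simp add: symmetric_cut)
      then show ?thesis by (rule integrable_distr[rotated]) measurable
    qed
    have g_eq: "?\<Psi> z + ?\<Psi> (- z) = indicator (ball 0 \<rho>) z * g z" for z
      by (auto simp: g_def indicator_def)
    have "ennreal (\<integral>z. indicator (ball 0 \<rho>) z * g z \<partial>cut \<nu> \<epsilon>)
        = (\<integral>\<^sup>+z. ennreal (indicator (ball 0 \<rho>) z * g z) \<partial>cut \<nu> \<epsilon>)"
    proof (rule nn_integral_eq_integral[symmetric])
      show "integrable (cut \<nu> \<epsilon>) (\<lambda>z. indicator (ball 0 \<rho>) z * g z)"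
        using Bochner_Integration.integrable_add[OF int int'] unfolding g_eq .
    qed (simp add: g_nonneg)
    also have "\<dots> = (\<integral>\<^sup>+z. ennreal (indicator (- ball 0 \<epsilon>) z) * ennreal (indicator (ball 0 \<rho>) z * g z) \<partial>\<nu>)"
    proof -
      note [measurable_cong] = sets_nu
      have [measurable]: "(\<lambda>z. indicator (ball 0 \<rho>) z * g z) \<in> borel_measurable borel"
        by (intro borel_measurable_times borel_measurable_indicator borel_measurable_continuous_onI[OF g_cont]) simp
      show ?thesis unfolding cut_def by (rule nn_integral_density) auto
    qed
    also have "\<dots> \<le> (\<integral>\<^sup>+z. indicator (ball 0 \<rho>) z * ennreal (g z) \<partial>\<nu>)"
      by (intro nn_integral_mono) (auto simp: indicator_def)
    also have "\<dots> \<le> ennreal \<Lambda> * ennreal (2 * A * (2 powr (real DIM('a) + \<alpha>) * \<rho> powr (\<beta> - \<alpha>) / (1 - 2 powr - (\<beta> - \<alpha>))))"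
      unfolding nu
    proof (rule nn_integral_near_origin_le[OF _ k near par(1-3) _ par(4)])
      show "(\<lambda>z. ennreal (g z)) \<in> borel_measurable borel"
        using borel_measurable_continuous_onI[OF g_cont] by measurable
      fix r :: real assume r: "0 < r" "r \<le> \<rho>"
      let ?t = "\<lambda>p z. indicator (ball 0 r) z * G (p \<bullet> z + q * r\<^sup>2)"
      have ti: "integrable lborel (?t p)" for p :: 'a
        by (intro integrable_indicator_continuous continuous_on_compose2[OF G(1)] continuous_intros) auto
      have gi: "integrable lborel (\<lambda>z. indicator (ball 0 r) z * g z)"
        by (intro integrable_indicator_continuous g_cont) auto
      have "(\<integral>\<^sup>+z. indicator (ball 0 r) z * ennreal (g z) \<partial>lborel) = (\<integral>\<^sup>+z. ennreal (indicator (ball 0 r) z * g z) \<partial>lborel)"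
        by (intro nn_integral_cong) (auto simp: indicator_def)
      also have "\<dots> = ennreal (\<integral>z. indicator (ball 0 r) z * g z \<partial>lborel)"
        by (rule nn_integral_eq_integral[OF gi]) (auto simp: g_nonneg)
      also have "\<dots> \<le> ennreal (\<integral>z. ?t p z + ?t (- p) z \<partial>lborel)"
      proof (intro ennreal_leI integral_mono gi Bochner_Integration.integrable_add ti)
        fix z
        show "indicator (ball 0 r) z * g z \<le> ?t p z + ?t (- p) z"
        proof (cases "z \<in> ball 0 r")
          case True
          then have "q * (norm z)\<^sup>2 \<le> q * r\<^sup>2" using par by (auto intro!: mult_left_mono power_mono)
          then show ?thesis using True unfolding g_def
            by (auto intro!: add_mono G(3))
        qed simp
      qed
      also have "(\<integral>z. ?t p z + ?t (- p) z \<partial>lborel) = (\<integral>z. ?t p z \<partial>lborel) + (\<integral>z. ?t (- p) z \<partial>lborel)"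
        by (intro Bochner_Integration.integral_add ti)
      also have "ennreal \<dots> \<le> ennreal (2 * A * r powr (real DIM('a) + \<beta>))"
      proof (rule ennreal_leI)
        have "norm p \<le> max P 0" "norm (- p) \<le> max P 0" using p by auto
        from A(2)[OF this(1) r] A(2)[OF this(2) r]
        show "(\<integral>z. ?t p z \<partial>lborel) + (\<integral>z. ?t (- p) z \<partial>lborel) \<le> 2 * A * r powr (real DIM('a) + \<beta>)" by linarith
      qed
      finally show "(\<integral>\<^sup>+z. indicator (ball 0 r) z * ennreal (g z) \<partial>lborel) \<le> ennreal (2 * A * r powr (real DIM('a) + \<beta>))" .
    qed (use A in simp)
    also have "\<dots> = ennreal S"
      unfolding S_def using A par x by (intro ennreal_mult[symmetric] mult_nonneg_nonneg divide_nonneg_nonneg) auto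
    finally have "(\<integral>z. indicator (ball 0 \<rho>) z * g z \<partial>cut \<nu> \<epsilon>) \<le> S"
      using S by (simp add: ennreal_le_iff)
    moreover have "(\<integral>z. indicator (ball 0 \<rho>) z * g z \<partial>cut \<nu> \<epsilon>) = (\<integral>z. ?\<Psi> z \<partial>cut \<nu> \<epsilon>) + (\<integral>z. ?\<Psi> (- z) \<partial>cut \<nu> \<epsilon>)"
      unfolding g_eq[symmetric] by (rule Bochner_Integration.integral_add[OF int int'])
    moreover have "(\<integral>z. ?\<Psi> (- z) \<partial>cut \<nu> \<epsilon>) = (\<integral>z. ?\<Psi> z \<partial>cut \<nu> \<epsilon>)"
      by (rule integral_reflect_symmetric[OF sets_cut_nu symmetric_cut \<Psi>_meas])
    ultimately show ?thesis by simp
  qed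
  then show ?thesis by blast
qed

text \<open>
  The annuli in the hypothesis are open; letting their inner radii grow by the ratio \<open>3/2\<close> instead of
  \<open>2\<close> makes consecutive ones overlap, so that no spheres are missed. Since the hypothesis is restricted to radii beyond \<open>\<rho>\<close>, the innermost annulus
  is reached as an increasing union.
\<close>

lemma finite_first_moment_at_infinity:
  fixes \<nu> :: "'a::euclidean_space measure"
  assumes sets_nu [measurable_cong]: "sets \<nu> = sets borel"
    and null: "AE z in \<nu>. norm z \<noteq> \<rho>"
    and par: "\<rho> > 0" "\<theta> > 1" "B \<ge> 0"
    and ann: "\<And>r. r > \<rho> \<Longrightarrow> emeasure \<nu> {z. r < norm z \<and> norm z < 2 * r} \<le> ennreal (B * r powr - \<theta>)"
  shows "(\<integral>\<^sup>+z. indicator (- ball 0 \<rho>) z * ennreal (1 + norm z) \<partial>\<nu>) < \<infinity>"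
proof -
  have [measurable]: "{z::'a. a < norm z \<and> norm z < b} \<in> sets borel" for a b by measurable
  have ann': "emeasure \<nu> {z. r < norm z \<and> norm z < 2 * r} \<le> ennreal (B * r powr - \<theta>)" if "r \<ge> \<rho>" for r
  proof (cases "r = \<rho>")
    case True
    define X where "X j = {z::'a. \<rho> + inverse (real (Suc j)) < norm z \<and> norm z < 2 * \<rho>}" for j
    \<comment> \<open>The annuli X j lie in those with inner radii beyond \<open>\<rho>\<close> and exhaust the one with inner radius \<open>\<rho>\<close>.\<close>
    have X_union: "(\<Union>j. X j) = {z. \<rho> < norm z \<and> norm z < 2 * \<rho>}"
    proof (intro set_eqI iffI)
      fix z :: 'a assume "z \<in> {z. \<rho> < norm z \<and> norm z < 2 * \<rho>}"
      then show "z \<in> (\<Union>j. X j)"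
        using reals_Archimedean[of "norm z - \<rho>"] by (auto simp: X_def field_simps)
    next
      fix z :: 'a assume "z \<in> (\<Union>j. X j)"
      then obtain j where "\<rho> + inverse (real (Suc j)) < norm z" "norm z < 2 * \<rho>" by (auto simp: X_def)
      moreover have "0 < inverse (real (Suc j))" by simp
      ultimately show "z \<in> {z. \<rho> < norm z \<and> norm z < 2 * \<rho>}" by (smt (verit) mem_Collect_eq)
    qed
    have X_inc: "incseq X"
      unfolding X_def incseq_def by (auto intro: order.strict_trans1[rotated] simp: le_imp_inverse_le)
    have X_sets: "range X \<subseteq> sets \<nu>" unfolding X_def by (auto simp: sets_nu)
    have X_le: "emeasure \<nu> (X j) \<le> ennreal (B * \<rho> powr - \<theta>)" for j
    proof -
      let ?r = "\<rho> + inverse (real (Suc j))"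
      have r: "?r > \<rho>" by simp
      have "emeasure \<nu> (X j) \<le> emeasure \<nu> {z. ?r < norm z \<and> norm z < 2 * ?r}"
      proof (rule emeasure_mono)
        show "X j \<subseteq> {z. ?r < norm z \<and> norm z < 2 * ?r}"
        proof
          fix z assume "z \<in> X j"
          then have "?r < norm z" "norm z < 2 * \<rho>" unfolding X_def by auto
          moreover have "2 * \<rho> < 2 * ?r" using r by (rule mult_strict_left_mono) simp
          ultimately show "z \<in> {z. ?r < norm z \<and> norm z < 2 * ?r}"
            by (blast intro: less_trans)
        qed
      qed (simp add: sets_nu)
      also have "\<dots> \<le> ennreal (B * ?r powr - \<theta>)" by (rule ann[OF r])
      also have "\<dots> \<le> ennreal (B * \<rho> powr - \<theta>)"
        using r par by (intro ennreal_leI mult_left_mono powr_mono2') auto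
      finally show ?thesis .
    qed
    have "emeasure \<nu> {z. \<rho> < norm z \<and> norm z < 2 * \<rho>} = (SUP j. emeasure \<nu> (X j))"
      unfolding X_union[symmetric] by (rule SUP_emeasure_incseq[OF X_sets X_inc, symmetric])
    also have "\<dots> \<le> ennreal (B * \<rho> powr - \<theta>)" by (rule SUP_least) (rule X_le)
    finally show ?thesis unfolding True .
  qed (use ann that in simp)
  define r where "r k = \<rho> * (3 / 2) ^ k" for k :: nat
  have r: "r k > 0" "r k \<ge> \<rho>" for k using par by (auto simp: r_def one_le_power)
  have r_Suc: "r (Suc k) < 2 * r k" for k using r[of k] by (simp add: r_def)
  let ?R = "\<lambda>k. {z::'a. r k < norm z \<and> norm z < 2 * r k}"
  have pt: "indicator (- ball 0 \<rho>) z * ennreal (1 + norm z) \<le> (\<Sum>k. ennreal (1 + 2 * r k) * indicator (?R k) z)"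
    if "norm z \<noteq> \<rho>" for z :: 'a
  proof (cases "z \<in> ball 0 \<rho>")
    case False
    then have z: "norm z > \<rho>" using that by simp
    have ex: "\<exists>m. norm z \<le> r m"
    proof -
      obtain m where "norm z / \<rho> < (3 / 2) ^ m" using real_arch_pow[of "3/2" "norm z / \<rho>"] by auto
      then show ?thesis using par by (intro exI[of _ m]) (simp add: r_def field_simps)
    qed
    define m where "m = (LEAST m. norm z \<le> r m)"
    have m: "norm z \<le> r m" unfolding m_def by (rule LeastI_ex) fact
    have "m \<noteq> 0" using m z by (cases m) (auto simp: r_def)
    then obtain k where k: "m = Suc k" by (cases m) auto
    have "\<not> norm z \<le> r k" by (rule not_less_Least) (simp add: m_def[symmetric] k)
    then have "z \<in> ?R k" using m r_Suc[of k] k by auto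
    then have "indicator (- ball 0 \<rho>) z * ennreal (1 + norm z) \<le> (\<Sum>k\<in>{k}. ennreal (1 + 2 * r k) * indicator (?R k) z)"
      using z by (auto intro!: ennreal_leI)
    also have "\<dots> \<le> (\<Sum>k. ennreal (1 + 2 * r k) * indicator (?R k) z)"
      by (intro sum_le_suminf) auto
    finally show ?thesis .
  qed simp
  define x where "x = (3 / 2) powr (1 - \<theta>)"
  have x: "0 < x" "x < 1" using par by (auto simp: x_def powr_less_one)
  define B' where "B' = (1 / \<rho> + 2) * B * \<rho> powr (1 - \<theta>)"
  have B': "B' \<ge> 0" using par by (simp add: B'_def)
  have term_le: "(1 + 2 * r k) * (B * r k powr - \<theta>) \<le> B' * x ^ k" for k
  proof -
    have "1 \<le> r k / \<rho>" using r[of k] par by simp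
    then have "(1 + 2 * r k) \<le> (1 / \<rho> + 2) * r k" by (simp add: algebra_simps)
    then have "(1 + 2 * r k) * (B * r k powr - \<theta>) \<le> ((1 / \<rho> + 2) * r k) * (B * r k powr - \<theta>)"
      using par by (intro mult_right_mono) auto
    also have "\<dots> = (1 / \<rho> + 2) * B * (r k * r k powr - \<theta>)" by simp
    also have "r k * r k powr - \<theta> = r k powr (1 - \<theta>)"
      using r[of k] powr_add[of "r k" 1 "- \<theta>"] by simp
    also have "\<dots> = \<rho> powr (1 - \<theta>) * x ^ k"
    proof -
      have "x ^ k = ((3 / 2) ^ k) powr (1 - \<theta>)"
        unfolding x_def by (simp add: powr_realpow[symmetric] powr_powr mult.commute)
      moreover have "r k powr (1 - \<theta>) = \<rho> powr (1 - \<theta>) * ((3 / 2) ^ k) powr (1 - \<theta>)"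
        unfolding r_def by (rule powr_mult)
      ultimately show ?thesis by simp
    qed
    finally show ?thesis by (simp add: B'_def mult_ac)
  qed
  have "(\<integral>\<^sup>+z. indicator (- ball 0 \<rho>) z * ennreal (1 + norm z) \<partial>\<nu>)
      \<le> (\<integral>\<^sup>+z. (\<Sum>k. ennreal (1 + 2 * r k) * indicator (?R k) z) \<partial>\<nu>)"
    by (rule nn_integral_mono_AE, use null in eventually_elim) (rule pt)
  also have "\<dots> = (\<Sum>k. \<integral>\<^sup>+z. ennreal (1 + 2 * r k) * indicator (?R k) z \<partial>\<nu>)"
    by (rule nn_integral_suminf) (auto simp: sets_nu)
  also have "\<dots> = (\<Sum>k. ennreal (1 + 2 * r k) * emeasure \<nu> (?R k))"
    by (intro suminf_cong nn_integral_cmult_indicator) (auto simp: sets_nu)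
  also have "\<dots> \<le> (\<Sum>k. ennreal (B' * x ^ k))"
  proof (intro suminf_le)
    fix k
    have "ennreal (1 + 2 * r k) * emeasure \<nu> (?R k) \<le> ennreal (1 + 2 * r k) * ennreal (B * r k powr - \<theta>)"
      by (intro mult_left_mono ann' r) simp
    also have "\<dots> = ennreal ((1 + 2 * r k) * (B * r k powr - \<theta>))"
      using r[of k] par by (intro ennreal_mult[symmetric]) auto
    also have "\<dots> \<le> ennreal (B' * x ^ k)" by (intro ennreal_leI term_le)
    finally show "ennreal (1 + 2 * r k) * emeasure \<nu> (?R k) \<le> ennreal (B' * x ^ k)" .
  qed auto
  also have "\<dots> = ennreal (B' * (1 / (1 - x)))"
    using B' x by (intro suminf_ennreal_eq sums_mult geometric_sums) auto
  also have "\<dots> < \<infinity>" by simp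
  finally show ?thesis .
qed

section \<open>Hypotheses on the density, the layer and the kernel\<close>

lemma nonlocal_density_facts:
  assumes "nonlocal_density \<Phi>"
  shows nonlocal_density_continuous: "continuous_on UNIV \<Phi>"
    and nonlocal_density_deriv: "\<And>t. (\<Phi> has_real_derivative deriv \<Phi> t) (at t)"
    and nonlocal_density_even: "\<And>t. \<Phi> (- t) = \<Phi> t"
    and nonlocal_density_zero: "\<Phi> 0 = 0"
    and nonlocal_density_nonneg: "\<And>t. 0 \<le> \<Phi> t"
    and nonlocal_density_deriv_continuous: "continuous_on UNIV (deriv \<Phi>)"
    and nonlocal_density_deriv_odd: "\<And>t. deriv \<Phi> (- t) = - deriv \<Phi> t"
    and nonlocal_density_deriv_mono: "\<And>s t. s \<le> t \<Longrightarrow> deriv \<Phi> s \<le> deriv \<Phi> t"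
    and nonlocal_density_convex: "\<And>a b. \<Phi> a + deriv \<Phi> a * (b - a) \<le> \<Phi> b"
proof -
  note D = assms[unfolded nonlocal_density_def]
  have ev: "\<Phi> (- t) = \<Phi> t" for t using D by blast
  have der: "(\<Phi> has_real_derivative deriv \<Phi> t) (at t)" for t
    using D DERIV_deriv_iff_real_differentiable by blast
  have pos: "\<Phi> t > 0" "deriv \<Phi> t > 0" "deriv (deriv \<Phi>) t > 0" if "t > 0" for t
    using D that by blast+
  have zero: "\<Phi> 0 = 0" "deriv \<Phi> 0 = 0" using D by blast+
  have der2: "(deriv \<Phi> has_real_derivative deriv (deriv \<Phi>) t) (at t)" if "t > 0" for t
    using D that DERIV_deriv_iff_real_differentiable by blast
  show "continuous_on UNIV \<Phi>"
    using der DERIV_isCont continuous_at_imp_continuous_on by blast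
  show "\<Phi> (- t) = \<Phi> t" for t by (rule ev)
  show "(\<Phi> has_real_derivative deriv \<Phi> t) (at t)" for t by (rule der)
  show "\<Phi> 0 = 0" by (rule zero)
  show "continuous_on UNIV (deriv \<Phi>)" using D by blast
  show "0 \<le> \<Phi> t" for t
    using pos(1)[of t] pos(1)[of "- t"] zero ev[of t] by (cases t "0::real" rule: linorder_cases) auto
  have odd: "deriv \<Phi> (- t) = - deriv \<Phi> t" for t
  proof -
    have "((\<lambda>x. \<Phi> (- x)) has_real_derivative deriv \<Phi> (- t) * (- 1)) (at t)"
      by (rule DERIV_chain2[OF der]) (auto intro!: derivative_eq_intros)
    then have "(\<Phi> has_real_derivative - deriv \<Phi> (- t)) (at t)" by (simp add: ev)
    from DERIV_unique[OF this der[of t]] show ?thesis by simp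
  qed
  then show "deriv \<Phi> (- t) = - deriv \<Phi> t" for t .
  have nonneg: "0 \<le> deriv \<Phi> t" if "t \<ge> 0" for t
    using pos(2)[of t] zero that by (cases "t = 0") auto
  have mono_pos: "deriv \<Phi> s \<le> deriv \<Phi> t" if "0 < s" "s \<le> t" for s t
    by (rule DERIV_nonneg_imp_nondecreasing[OF that(2)])
       (use that der2 pos(3) in \<open>meson less_imp_le order.strict_trans2\<close>)
  have mono_nonneg: "deriv \<Phi> s \<le> deriv \<Phi> t" if "0 \<le> s" "s \<le> t" for s t
    using that mono_pos[of s t] nonneg[of t] zero by (cases "s = 0") auto
  have mono: "deriv \<Phi> s \<le> deriv \<Phi> t" if "s \<le> t" for s t
  proof -
    consider "0 \<le> s" | "s < 0" "0 \<le> t" | "s < 0" "t < 0" by linarith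
    then show ?thesis
    proof cases
      case 1 then show ?thesis using mono_nonneg that by blast
    next
      case 2
      then show ?thesis using nonneg[of t] nonneg[of "- s"] odd[of s] by simp
    next
      case 3
      then show ?thesis using mono_nonneg[of "- t" "- s"] odd[of s] odd[of t] that by simp
    qed
  qed
  then show "deriv \<Phi> s \<le> deriv \<Phi> t" if "s \<le> t" for s t using that .
  show "\<Phi> a + deriv \<Phi> a * (b - a) \<le> \<Phi> b" for a b
  proof (cases a b rule: linorder_cases)
    case less
    obtain z where z: "a < z" "z < b" "\<Phi> b - \<Phi> a = (b - a) * deriv \<Phi> z"
      using MVT2[OF less, of \<Phi> "deriv \<Phi>"] der by blast
    have "(b - a) * deriv \<Phi> a \<le> (b - a) * deriv \<Phi> z"
      using z less by (intro mult_left_mono mono) auto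
    then show ?thesis using z(3) by (simp add: mult.commute)
  next
    case greater
    obtain z where z: "b < z" "z < a" "\<Phi> a - \<Phi> b = (a - b) * deriv \<Phi> z"
      using MVT2[OF greater, of \<Phi> "deriv \<Phi>"] der by blast
    have "(a - b) * deriv \<Phi> z \<le> (a - b) * deriv \<Phi> a"
      using z greater by (intro mult_left_mono mono) auto
    then show ?thesis using z(3) by (simp add: algebra_simps)
  qed simp
qed

lemma nonlocal_density_growth:
  assumes "nonlocal_density \<Phi>" and C: "\<And>t. t > 0 \<Longrightarrow> deriv \<Phi> t \<le> C * t powr (\<beta> - 1)" and t: "t \<ge> 0"
  shows "\<Phi> t \<le> C * t powr \<beta>"
proof (cases "t = 0")
  case False
  note D = nonlocal_density_facts[OF assms(1)]
  have t: "t > 0" using t False by simp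
  have "\<Phi> t + deriv \<Phi> t * (0 - t) \<le> \<Phi> 0" by (rule D)
  then have "\<Phi> t \<le> deriv \<Phi> t * t" using D(4) by simp
  also have "\<dots> \<le> C * t powr (\<beta> - 1) * t" using t by (intro mult_right_mono C) auto
  also have "\<dots> = C * t powr \<beta>" using t powr_mult_base[of t "\<beta> - 1"] by (simp add: mult_ac)
  finally show ?thesis .
qed (use nonlocal_density_zero[OF assms(1)] in simp)

lemma nonlocal_density_mono:
  assumes "nonlocal_density \<Phi>" "\<bar>s\<bar> \<le> t"
  shows "\<Phi> s \<le> \<Phi> t"
proof -
  note D = nonlocal_density_facts[OF assms(1)]
  have "deriv \<Phi> 0 \<le> deriv \<Phi> \<bar>s\<bar>" by (rule D(8)) simp
  moreover have "deriv \<Phi> 0 = 0" using D(7)[of 0] by simp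
  ultimately have "0 \<le> deriv \<Phi> \<bar>s\<bar> * (t - \<bar>s\<bar>)" using assms(2) by simp
  then have "\<Phi> \<bar>s\<bar> \<le> \<Phi> t" using D(9)[of "\<bar>s\<bar>" t] by linarith
  then show ?thesis using D(3)[of s] by (simp add: abs_if split: if_splits)
qed

lemma with_coord_eq: "with_coord k x (x $ k + t) = x + t *\<^sub>R axis k 1"
  by (simp add: with_coord_def vec_eq_iff axis_def)

lemma layer_monotone:
  assumes "layer_solution k \<Phi> K f u" "s \<le> t"
  shows "u (with_coord k x s) \<le> u (with_coord k x t)"
proof (rule DERIV_nonneg_imp_nondecreasing[OF assms(2)])
  fix r
  have "(\<lambda>t. u (with_coord k (with_coord k x r) t)) = (\<lambda>t. u (with_coord k x t))"
    by (auto simp: with_coord_def vec_eq_iff intro!: arg_cong[where f = u])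
  moreover have "\<exists>d>0. ((\<lambda>t. u (with_coord k (with_coord k x r) t)) has_real_derivative d) (at (with_coord k x r $ k))"
    using assms(1) unfolding layer_solution_def by blast
  ultimately show "\<exists>y. ((\<lambda>t. u (with_coord k x t)) has_real_derivative y) (at r) \<and> 0 \<le> y"
    by (auto simp: with_coord_def intro: less_imp_le)
qed

lemma layer_shift_monotone:
  assumes "layer_solution k \<Phi> K f u" "s \<le> t"
  shows "u (x + s *\<^sub>R axis k 1) \<le> u (x + t *\<^sub>R axis k 1)"
  using layer_monotone[OF assms(1), of "x $ k + s" "x $ k + t" x] assms(2) by (simp add: with_coord_eq)

lemma layer_shift_limit:
  assumes "layer_solution k \<Phi> K f u"
  shows "((\<lambda>t. u (x + t *\<^sub>R axis k 1)) \<longlongrightarrow> 1) at_top"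
proof -
  have "((\<lambda>t. u (with_coord k x t)) \<longlongrightarrow> 1) at_top" using assms unfolding layer_solution_def by blast
  moreover have "filterlim (\<lambda>t. x $ k + t) at_top at_top" by (rule filterlim_tendsto_add_at_top[OF tendsto_const filterlim_ident])
  ultimately have "((\<lambda>t. u (with_coord k x (x $ k + t))) \<longlongrightarrow> 1) at_top" by (rule filterlim_compose)
  then show ?thesis by (simp add: with_coord_eq)
qed

lemma layer_bounds:
  assumes "layer_solution k \<Phi> K f u"
  shows "\<bar>u x\<bar> \<le> 1"
proof -
  have x: "with_coord k x (x $ k) = x" by (simp add: with_coord_def vec_eq_iff)
  have top: "((\<lambda>t. u (with_coord k x t)) \<longlongrightarrow> 1) at_top" and bot: "((\<lambda>t. u (with_coord k x t)) \<longlongrightarrow> -1) at_bot"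
    using assms unfolding layer_solution_def by blast+
  have "eventually (\<lambda>t. u x \<le> u (with_coord k x t)) at_top"
    using eventually_ge_at_top[of "x $ k"]
    by eventually_elim (use layer_monotone[OF assms, of "x $ k" _ x] x in simp)
  then have "u x \<le> 1" by (rule tendsto_lowerbound[OF top]) simp
  moreover have "eventually (\<lambda>t. u (with_coord k x t) \<le> u x) at_bot"
    using eventually_le_at_bot[of "x $ k"]
    by eventually_elim (use layer_monotone[OF assms, of _ "x $ k" x] x in simp)
  then have "- 1 \<le> u x" by (rule tendsto_upperbound[OF bot]) simp
  ultimately show ?thesis by (simp add: abs_le_iff)
qed

text \<open>
  A Borel version of \<open>K\<close> makes the integrands jointly measurable in \<open>x\<close> and \<open>z\<close>, as Tonelli's theorem
  requires. It need not be even at every point; evenness survives for the measure with this density.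
\<close>

lemma nonlocal_kernel_borel_version:
  fixes K :: "real ^ 'n \<Rightarrow> real"
  assumes "nonlocal_kernel K"
  obtains k where "k \<in> borel_measurable borel" "\<And>z. 0 \<le> k z" "AE z in lborel. K z = k z"
    "distr (density lborel (\<lambda>z. ennreal (k z))) borel uminus = density lborel (\<lambda>z. ennreal (k z))"
proof -
  have K: "K \<in> borel_measurable lebesgue" "\<And>z. 0 \<le> K z" "\<And>z. K (- z) = K z"
    using assms by (auto simp: nonlocal_kernel_def)
  obtain k' where k': "k' \<in> borel_measurable lborel" "AE z in lborel. K z = k' z"
    using completion_ex_borel_measurable_real[OF K(1)] by blast
  define k where "k z = max 0 (k' z)" for z
  have k_meas [measurable]: "k \<in> borel_measurable borel" unfolding k_def using k'(1) by measurable
  have Kk: "AE z in lborel. K z = k z"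
    using k'(2) by eventually_elim (use K(2) in \<open>metis k_def max.absorb2\<close>)
  have "AE z in distr lborel borel uminus. K z = k z" unfolding lborel_reflect by (rule Kk)
  then have "AE z in lborel. K (- z) = k (- z)" by (rule AE_distrD[rotated]) measurable
  with Kk have sym: "AE z in lborel. ennreal (k (- z)) = ennreal (k z)"
    by eventually_elim (simp add: K(3))
  have "density lborel (\<lambda>z. ennreal (k z)) = density (distr lborel borel uminus) (\<lambda>z. ennreal (k z))"
    unfolding lborel_reflect ..
  also have "\<dots> = distr (density lborel (\<lambda>z. ennreal (k (- z)))) borel uminus"
    by (rule density_distr) auto
  also have "density lborel (\<lambda>z. ennreal (k (- z))) = density lborel (\<lambda>z. ennreal (k z))"
    by (rule density_cong) (use sym in auto)
  finally have "distr (density lborel (\<lambda>z. ennreal (k z))) borel uminus = density lborel (\<lambda>z. ennreal (k z))" ..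
  then show ?thesis using k_meas Kk by (intro that[of k]) (auto simp: k_def)
qed

lemma kernel_near_origin:
  fixes K c :: "real ^ 'n \<Rightarrow> real"
  assumes "(\<exists>r\<^sub>0. finite_range_kernel \<alpha> c r\<^sub>0 R\<^sub>0 K) \<or> decaying_kernel \<alpha> \<beta> c R\<^sub>0 K"
    and c: "\<And>z. c z \<le> Lam"
  shows "R\<^sub>0 > 0" "\<And>z. z \<noteq> 0 \<Longrightarrow> norm z \<le> R\<^sub>0 \<Longrightarrow> K z \<le> Lam * norm z powr - (real CARD('n) + \<alpha>)"
proof -
  show "R\<^sub>0 > 0" using assms(1) unfolding finite_range_kernel_def decaying_kernel_def by auto
  fix z :: "real ^ 'n" assume z: "z \<noteq> 0" "norm z \<le> R\<^sub>0"
  have "K z \<le> c z / norm z powr (real CARD('n) + \<alpha>)"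
    using assms(1)
  proof
    assume "\<exists>r\<^sub>0. finite_range_kernel \<alpha> c r\<^sub>0 R\<^sub>0 K"
    then have "K z \<le> c z / norm z powr (real CARD('n) + \<alpha>) * indicator {z. norm z \<le> R\<^sub>0} z"
      using z unfolding finite_range_kernel_def by blast
    then show ?thesis using z by simp
  next
    assume "decaying_kernel \<alpha> \<beta> c R\<^sub>0 K"
    then show ?thesis using z unfolding decaying_kernel_def by simp
  qed
  also have "\<dots> \<le> Lam / norm z powr (real CARD('n) + \<alpha>)" by (intro divide_right_mono c) simp
  finally show "K z \<le> Lam * norm z powr - (real CARD('n) + \<alpha>)" unfolding powr_minus divide_inverse .
qed

lemma kernel_first_moment_at_infinity:
  fixes K c :: "real ^ 'n \<Rightarrow> real"
  assumes kernel: "(\<exists>r\<^sub>0. finite_range_kernel \<alpha> c r\<^sub>0 R\<^sub>0 K) \<or> decaying_kernel \<alpha> \<beta> c R\<^sub>0 K"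
    and \<beta>: "\<beta> \<ge> 2" and K0: "\<And>z. 0 \<le> K z"
    and k [measurable]: "k \<in> borel_measurable borel" "AE z in lborel. K z = k z"
  shows "(\<integral>\<^sup>+z. indicator (- ball 0 R\<^sub>0) z * ennreal (1 + norm z) \<partial>density lborel (\<lambda>z. ennreal (k z))) < \<infinity>"
proof -
  have R0: "R\<^sub>0 > 0" using kernel unfolding finite_range_kernel_def decaying_kernel_def by auto
  let ?\<nu> = "density lborel (\<lambda>z. ennreal (k z))"
  have sph: "AE z in lborel. norm (z :: real ^ 'n) \<noteq> R\<^sub>0"
  proof -
    have "negligible (sphere (0 :: real ^ 'n) R\<^sub>0)" by (rule negligible_sphere)
    then have "sphere (0 :: real ^ 'n) R\<^sub>0 \<in> null_sets lborel"
      by (auto simp: negligible_iff_null_sets null_sets_completion_iff)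
    then show ?thesis by (rule AE_I') auto
  qed
  then have sph_nu: "AE z in ?\<nu>. norm z \<noteq> R\<^sub>0"
    by (subst AE_density) (auto elim: eventually_mono)
  show ?thesis using kernel
  proof
    assume "\<exists>r\<^sub>0. finite_range_kernel \<alpha> c r\<^sub>0 R\<^sub>0 K"
    then have outside: "K z = 0" if "norm z > R\<^sub>0" for z
      using that R0 K0[of z] unfolding finite_range_kernel_def by (metis (no_types, lifting) indicator_simps(2) mem_Collect_eq mult_zero_right norm_zero not_le order.asym order_antisym)
    have "AE z in lborel. ennreal (k z) * (indicator (- ball 0 R\<^sub>0) z * ennreal (1 + norm z)) = 0"
      using sph k(2)
    proof eventually_elim
      case (elim z)
      then show ?case using outside[of z] by (cases "norm z < R\<^sub>0") auto
    qed
    then have "(\<integral>\<^sup>+z. ennreal (k z) * (indicator (- ball 0 R\<^sub>0) z * ennreal (1 + norm z)) \<partial>lborel) = 0"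
      by (subst nn_integral_0_iff_AE) auto
    moreover have "(\<integral>\<^sup>+z. indicator (- ball 0 R\<^sub>0) z * ennreal (1 + norm z) \<partial>?\<nu>)
       = (\<integral>\<^sup>+z. ennreal (k z) * (indicator (- ball 0 R\<^sub>0) z * ennreal (1 + norm z)) \<partial>lborel)"
      by (rule nn_integral_density) auto
    ultimately show ?thesis by simp
  next
    assume "decaying_kernel \<alpha> \<beta> c R\<^sub>0 K"
    then obtain D C\<^sub>1 C\<^sub>2 \<theta> where D: "C\<^sub>1 > 0" "C\<^sub>2 > 0" "\<theta> > \<beta>"
        "\<And>r. r > R\<^sub>0 \<Longrightarrow> D r < C\<^sub>2 * r powr (- \<theta>)"
        "\<And>r. r > R\<^sub>0 \<Longrightarrow> (\<integral>\<^sup>+z\<in>{z. r < norm z \<and> norm z < 2 * r}. ennreal \<bar>K z\<bar> \<partial>lebesgue) \<le> ennreal (C\<^sub>1 * D r)"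
      unfolding decaying_kernel_def by blast
    show ?thesis
    proof (rule finite_first_moment_at_infinity[OF _ sph_nu R0])
      show "\<theta> > 1" using D \<beta> by simp
      show "0 \<le> C\<^sub>1 * C\<^sub>2" using D by simp
      fix r assume r: "r > R\<^sub>0"
      let ?A = "{z :: real ^ 'n. r < norm z \<and> norm z < 2 * r}"
      have A: "?A \<in> sets borel" by measurable
      have "emeasure ?\<nu> ?A = (\<integral>\<^sup>+z. ennreal (k z) * indicator ?A z \<partial>lborel)"
        using A by (intro emeasure_density) auto
      also have "\<dots> = (\<integral>\<^sup>+z\<in>?A. ennreal \<bar>K z\<bar> \<partial>lborel)"
      proof (rule nn_integral_cong_AE, use k(2) in eventually_elim)
        fix z assume "K z = k z"
        then show "ennreal (k z) * indicator ?A z = ennreal \<bar>K z\<bar> * indicator ?A z" using K0[of z] by simp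
      qed
      also have "\<dots> = (\<integral>\<^sup>+z\<in>?A. ennreal \<bar>K z\<bar> \<partial>lebesgue)" by (rule nn_integral_completion[symmetric])
      also have "\<dots> \<le> ennreal (C\<^sub>1 * D r)" by (rule D(5)[OF r])
      also have "\<dots> \<le> ennreal (C\<^sub>1 * C\<^sub>2 * r powr - \<theta>)"
        using D(4)[OF r] D(1) by (intro ennreal_leI) (simp add: mult.assoc)
      finally show "emeasure ?\<nu> ?A \<le> ennreal (C\<^sub>1 * C\<^sub>2 * r powr - \<theta>)" .
    qed auto
  qed
qed

lemma finite_kernel_moment:
  fixes k :: "'a::euclidean_space \<Rightarrow> real"
  assumes [measurable]: "k \<in> borel_measurable borel"
    and near: "AE z in lborel. z \<in> ball 0 \<rho> \<longrightarrow> k z \<le> \<Lambda> * norm z powr - (real DIM('a) + \<alpha>)"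
    and far: "(\<integral>\<^sup>+z. indicator (- ball 0 \<rho>) z * ennreal (1 + norm z) \<partial>density lborel (\<lambda>z. ennreal (k z))) < \<infinity>"
    and par: "\<Lambda> \<ge> 0" "\<rho> > 0" "\<alpha> < \<beta>" "\<alpha> > 0"
  shows "(\<integral>\<^sup>+z. ennreal ((1 + norm z) * min 1 (norm z powr \<beta>)) \<partial>density lborel (\<lambda>z. ennreal (k z))) < \<infinity>"
    (is "nn_integral ?\<nu> _ < _")
proof -
  have "(\<integral>\<^sup>+z. ennreal ((1 + norm z) * min 1 (norm z powr \<beta>)) \<partial>?\<nu>)
      \<le> (\<integral>\<^sup>+z. ennreal (1 + \<rho>) * (indicator (ball 0 \<rho>) z * ennreal (norm z powr \<beta>))
            + indicator (- ball 0 \<rho>) z * ennreal (1 + norm z) \<partial>?\<nu>)"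
  proof (rule nn_integral_mono)
    fix z :: 'a
    show "ennreal ((1 + norm z) * min 1 (norm z powr \<beta>))
        \<le> ennreal (1 + \<rho>) * (indicator (ball 0 \<rho>) z * ennreal (norm z powr \<beta>))
            + indicator (- ball 0 \<rho>) z * ennreal (1 + norm z)"
    proof (cases "z \<in> ball 0 \<rho>")
      case True
      then have "(1 + norm z) * min 1 (norm z powr \<beta>) \<le> (1 + \<rho>) * norm z powr \<beta>"
        using par by (intro mult_mono) auto
      then have "ennreal ((1 + norm z) * min 1 (norm z powr \<beta>)) \<le> ennreal ((1 + \<rho>) * norm z powr \<beta>)"
        by (rule ennreal_leI)
      also have "\<dots> = ennreal (1 + \<rho>) * ennreal (norm z powr \<beta>)" using par by (intro ennreal_mult) auto
      finally show ?thesis using True by simp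
    next
      case False
      have "(1 + norm z) * min 1 (norm z powr \<beta>) \<le> (1 + norm z) * 1" by (intro mult_left_mono) auto
      then have "ennreal ((1 + norm z) * min 1 (norm z powr \<beta>)) \<le> ennreal (1 + norm z)"
        by (intro ennreal_leI) simp
      then show ?thesis using False by simp
    qed
  qed
  also have "\<dots> = ennreal (1 + \<rho>) * (\<integral>\<^sup>+z. indicator (ball 0 \<rho>) z * ennreal (norm z powr \<beta>) \<partial>?\<nu>)
      + (\<integral>\<^sup>+z. indicator (- ball 0 \<rho>) z * ennreal (1 + norm z) \<partial>?\<nu>)"
  proof -
    have [measurable]: "(\<lambda>z. indicator (ball 0 \<rho>) z * ennreal (norm z powr \<beta>)) \<in> borel_measurable borel"
        "(\<lambda>z. indicator (- ball 0 \<rho>) z * ennreal (1 + norm z)) \<in> borel_measurable borel"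
      by (rule borel_measurable_times_ennreal[OF borel_measurable_indicator]; simp)+
    show ?thesis by (subst nn_integral_add) (auto simp: nn_integral_cmult)
  qed
  also have "\<dots> < \<infinity>"
    using finite_beta_moment_near_origin[OF assms(1) near par] far
    by (simp add: ennreal_mult_less_top)
  finally show ?thesis .
qed

text \<open>
  Chebyshev's inequality gives the tails finite mass.
\<close>

lemma levy_measure_of_moment:
  fixes k :: "'a::euclidean_space \<Rightarrow> real"
  assumes k [measurable]: "k \<in> borel_measurable borel"
    and sym: "distr (density lborel (\<lambda>z. ennreal (k z))) borel uminus = density lborel (\<lambda>z. ennreal (k z))"
    and moment: "(\<integral>\<^sup>+z. ennreal ((1 + norm z) * min 1 (norm z powr \<beta>)) \<partial>density lborel (\<lambda>z. ennreal (k z))) < \<infinity>"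
    and \<beta>: "\<beta> \<ge> 0"
  shows "levy_measure (density lborel (\<lambda>z. ennreal (k z)))"
proof
  let ?\<nu> = "density lborel (\<lambda>z. ennreal (k z))"
  show "sets ?\<nu> = sets borel" by simp
  have "sigma_finite_measure ?\<nu>"
    by (subst sigma_finite_measure.sigma_finite_iff_density_finite[OF sigma_finite_lborel]) auto
  then show "\<exists>A. countable A \<and> A \<subseteq> sets ?\<nu> \<and> \<Union> A = space ?\<nu> \<and> (\<forall>a\<in>A. emeasure ?\<nu> a \<noteq> \<infinity>)"
    by (rule sigma_finite_measure.sigma_finite_countable)
  show "distr ?\<nu> borel uminus = ?\<nu>" by (rule sym)
  fix \<epsilon> :: real assume e: "\<epsilon> > 0"
  let ?c = "min 1 (\<epsilon> powr \<beta>)"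
  have "ennreal ?c * emeasure ?\<nu> (- ball 0 \<epsilon>) = (\<integral>\<^sup>+z. ennreal ?c * indicator (- ball 0 \<epsilon>) z \<partial>?\<nu>)"
    by (rule nn_integral_cmult_indicator[symmetric]) simp
  also have "\<dots> \<le> (\<integral>\<^sup>+z. ennreal ((1 + norm z) * min 1 (norm z powr \<beta>)) \<partial>?\<nu>)"
  proof (rule nn_integral_mono)
    fix z :: 'a
    show "ennreal ?c * indicator (- ball 0 \<epsilon>) z \<le> ennreal ((1 + norm z) * min 1 (norm z powr \<beta>))"
    proof (cases "z \<in> ball 0 \<epsilon>")
      case False
      then have "1 * ?c \<le> (1 + norm z) * min 1 (norm z powr \<beta>)"
        using e \<beta> by (intro mult_mono min.mono powr_mono2) auto
      then show ?thesis using False by (simp add: ennreal_leI)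
    qed simp
  qed
  also have "\<dots> < \<infinity>" by (rule moment)
  finally show "emeasure ?\<nu> (- ball 0 \<epsilon>) < \<infinity>"
    using e by (auto simp: ennreal_mult_less_top min_def split: if_splits)
qed

section \<open>Translation to interactions of the layer\<close>

definition levy_interaction ::
  "(real \<Rightarrow> real) \<Rightarrow> 'a::euclidean_space measure \<Rightarrow> ('a \<Rightarrow> real) \<Rightarrow> 'a set \<Rightarrow> 'a set \<Rightarrow> ennreal" where
  "levy_interaction \<Phi> \<nu> u A B =
     (\<integral>\<^sup>+x. (\<integral>\<^sup>+z. ennreal (\<Phi> (u x - u (x + z))) * indicator A x * indicator B (x + z) \<partial>\<nu>) \<partial>lborel)"

lemma interaction_eq_levy_interaction:
  fixes K k :: "real ^ 'n \<Rightarrow> real"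
  assumes K: "\<And>z. K (- z) = K z" and k [measurable]: "k \<in> borel_measurable borel"
    and k0: "\<And>z. 0 \<le> k z" and Kk: "AE z in lborel. K z = k z"
    and Phi [measurable]: "\<Phi> \<in> borel_measurable borel" and Phi0: "\<And>t. 0 \<le> \<Phi> t"
    and u [measurable]: "u \<in> borel_measurable borel" and B [measurable]: "B \<in> sets borel"
  shows "interaction \<Phi> K u A B = levy_interaction \<Phi> (density lborel (\<lambda>z. ennreal (k z))) u A B"
  unfolding interaction_def levy_interaction_def nn_integral_completion
proof (rule nn_integral_cong)
  fix x :: "real ^ 'n"
  have "AE y in distr lborel borel (\<lambda>y. y + (- x)). K y = k y" unfolding lborel_translate by (rule Kk)
  then have "AE y in lborel. K (y + (- x)) = k (y + (- x))" by (rule AE_distrD[rotated]) measurable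
  moreover have "K (x - y) = K (y + - x)" for y using K[of "y + - x"] by simp
  ultimately have ae: "AE y in lborel. K (x - y) = k (y + - x)" by simp
  let ?h = "\<lambda>z. ennreal (\<Phi> (u x - u (x + z))) * indicator B (x + z)"
  have "(\<integral>\<^sup>+y. ennreal (\<Phi> (u x - u y) * K (x - y)) * indicator B y \<partial>lborel)
      = (\<integral>\<^sup>+y. ennreal (k (y + - x)) * ?h (y + - x) \<partial>lborel)"
    by (rule nn_integral_cong_AE, use ae in eventually_elim)
       (use k0 Phi0 in \<open>simp add: ennreal_mult mult_ac\<close>)
  also have "\<dots> = (\<integral>\<^sup>+z. ennreal (k z) * ?h z \<partial>lborel)"
    by (rule nn_integral_translate) measurable
  also have "\<dots> = (\<integral>\<^sup>+z. ?h z \<partial>density lborel (\<lambda>z. ennreal (k z)))"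
    by (rule nn_integral_density[symmetric]) auto
  finally show "(\<integral>\<^sup>+y. ennreal (\<Phi> (u x - u y) * K (x - y)) * indicator B y \<partial>lborel) * indicator A x
      = (\<integral>\<^sup>+z. ennreal (\<Phi> (u x - u (x + z))) * indicator A x * indicator B (x + z) \<partial>density lborel (\<lambda>z. ennreal (k z)))"
    by (cases "x \<in> A") auto
qed

text \<open>
  The integrability hypothesis supplies the measurability of the integrand, which is not automatic
  because \<open>K\<close> is composed with a translation.
\<close>

lemma principal_value_eq_cut:
  fixes K k :: "real ^ 'n \<Rightarrow> real"
  assumes k [measurable]: "k \<in> borel_measurable borel"
    and k0: "\<And>z. 0 \<le> k z" and Kk: "AE z in lborel. K z = k z"
    and Phi [measurable]: "deriv \<Phi> \<in> borel_measurable borel"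
    and u [measurable]: "u \<in> borel_measurable borel"
    and int: "set_integrable lebesgue (- ball x \<epsilon>) (T_integrand \<Phi> K u x)"
  shows "(LINT y:(- ball x \<epsilon>)|lebesgue. T_integrand \<Phi> K u x y)
    = (\<integral>z. deriv \<Phi> (u x - u (x + z)) \<partial>cut (density lborel (\<lambda>z. ennreal (k z))) \<epsilon>)"
proof -
  have "AE y in distr lborel borel (\<lambda>y. y + (- x)). K y = k y" unfolding lborel_translate by (rule Kk)
  then have ae: "AE y in lborel. K (y + (- x)) = k (y + (- x))" by (rule AE_distrD[rotated]) measurable
  let ?h = "\<lambda>z. k z * (indicator (- ball 0 \<epsilon>) z * deriv \<Phi> (u x - u (x + z)))"
  have h [measurable]: "?h \<in> borel_measurable borel"
    by (intro borel_measurable_times borel_measurable_indicator) auto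
  have h' [measurable]: "(\<lambda>y. ?h (y + - x)) \<in> borel_measurable borel"
    by (rule measurable_compose[OF _ h]) auto
  have "(LINT y:(- ball x \<epsilon>)|lebesgue. T_integrand \<Phi> K u x y) = (\<integral>y. ?h (y + - x) \<partial>lebesgue)"
    unfolding set_lebesgue_integral_def
  proof (rule integral_cong_AE)
    show "(\<lambda>y. indicator (- ball x \<epsilon>) y *\<^sub>R T_integrand \<Phi> K u x y) \<in> borel_measurable lebesgue"
      using int unfolding set_integrable_def by auto
    show "(\<lambda>y. ?h (y + - x)) \<in> borel_measurable lebesgue"
      using h' by (simp add: measurable_completion)
    show "AE y in lebesgue. indicator (- ball x \<epsilon>) y *\<^sub>R T_integrand \<Phi> K u x y = ?h (y + - x)"
      by (rule AE_completion, use ae in eventually_elim)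
         (auto simp: T_integrand_def indicator_def dist_norm norm_minus_commute)
  qed
  also have "\<dots> = (\<integral>y. ?h (y + - x) \<partial>lborel)" by (rule integral_completion) simp
  also have "\<dots> = (\<integral>z. ?h z \<partial>lborel)" by (rule integral_translate[OF h])
  also have "\<dots> = (\<integral>z. indicator (- ball 0 \<epsilon>) z * deriv \<Phi> (u x - u (x + z)) \<partial>density lborel (\<lambda>z. ennreal (k z)))"
  proof -
    have "(\<lambda>z. indicator (- ball 0 \<epsilon>) z * deriv \<Phi> (u x - u (x + z))) \<in> borel_measurable lborel"
      by (intro borel_measurable_times borel_measurable_indicator) auto
    then show ?thesis using k0 by (subst integral_density) auto
  qed
  also have "\<dots> = (\<integral>z. deriv \<Phi> (u x - u (x + z)) \<partial>cut (density lborel (\<lambda>z. ennreal (k z))) \<epsilon>)"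
    unfolding cut_def by (subst integral_density) auto
  finally show ?thesis .
qed

context levy_convex begin

lemma Phi_even_sym: "(\<And>t. \<Phi> (- t) = \<Phi> t) \<Longrightarrow> \<Phi> (a - b) = \<Phi> (b - a)"
  by (metis minus_diff_eq)

lemma nn_integral_swap_nu:
  assumes "(\<lambda>(x, z). h x z) \<in> borel_measurable (borel \<Otimes>\<^sub>M borel)"
  shows "(\<integral>\<^sup>+x. (\<integral>\<^sup>+z. h x z \<partial>\<nu>) \<partial>lborel) = (\<integral>\<^sup>+z. (\<integral>\<^sup>+x. h x z \<partial>lborel) \<partial>\<nu>)"
proof -
  interpret sigma_finite_measure \<nu> by (rule sigma_finite_nu)
  interpret P: pair_sigma_finite lborel \<nu> ..
  note [measurable_cong] = sets_nu
  have "sets (lborel \<Otimes>\<^sub>M \<nu>) = sets (borel \<Otimes>\<^sub>M borel)"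
    by (intro sets_pair_measure_cong) (auto simp: sets_nu)
  then have "(\<lambda>(x, z). h x z) \<in> borel_measurable (lborel \<Otimes>\<^sub>M \<nu>)"
    using assms measurable_cong_sets by blast
  from P.Fubini'[OF this] show ?thesis by simp
qed

lemma levy_interaction_commute:
  assumes even: "\<And>t. \<Phi> (- t) = \<Phi> t" and u [measurable]: "u \<in> borel_measurable borel"
    and A [measurable]: "A \<in> sets borel" "B \<in> sets borel"
  shows "levy_interaction \<Phi> \<nu> u A B = levy_interaction \<Phi> \<nu> u B A"
proof -
  let ?h = "\<lambda>A B x z. ennreal (\<Phi> (u x - u (x + z))) * indicator A x * indicator B (x + z) :: ennreal"
  interpret sigma_finite_measure lborel by (rule sigma_finite_lborel)
  have [measurable]: "(\<lambda>(x, z). ?h A B x z) \<in> borel_measurable (borel \<Otimes>\<^sub>M borel)"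
      "(\<lambda>(x, z). ?h B A x z) \<in> borel_measurable (borel \<Otimes>\<^sub>M borel)"
    by measurable
  have m: "(\<lambda>z. \<integral>\<^sup>+x. ?h B A x z \<partial>lborel) \<in> borel_measurable borel" by measurable
  have "levy_interaction \<Phi> \<nu> u A B = (\<integral>\<^sup>+z. (\<integral>\<^sup>+x. ?h A B x z \<partial>lborel) \<partial>\<nu>)"
    unfolding levy_interaction_def by (rule nn_integral_swap_nu) measurable
  also have "\<dots> = (\<integral>\<^sup>+z. (\<integral>\<^sup>+x. ?h B A x (- z) \<partial>lborel) \<partial>\<nu>)"
  proof (rule nn_integral_cong)
    fix z
    have "(\<integral>\<^sup>+x. ?h A B x z \<partial>lborel) = (\<integral>\<^sup>+x. ?h B A (x + z) (- z) \<partial>lborel)"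
      using Phi_even_sym[OF even] by (intro nn_integral_cong) (simp add: mult_ac)
    also have "\<dots> = (\<integral>\<^sup>+x. ?h B A x (- z) \<partial>lborel)"
      by (rule nn_integral_translate) measurable
    finally show "(\<integral>\<^sup>+x. ?h A B x z \<partial>lborel) = (\<integral>\<^sup>+x. ?h B A x (- z) \<partial>lborel)" .
  qed
  also have "\<dots> = (\<integral>\<^sup>+z. (\<integral>\<^sup>+x. ?h B A x z \<partial>lborel) \<partial>\<nu>)"
    by (rule nn_integral_reflect_symmetric[OF sets_nu symmetric_nu m])
  also have "\<dots> = levy_interaction \<Phi> \<nu> u B A"
    unfolding levy_interaction_def by (rule nn_integral_swap_nu[symmetric]) measurable
  finally show ?thesis .
qed

text \<open>
  The energy of \<open>v\<close> counts the pairs of points in the ball, and twice the pairs joining it to the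
  surrounding annulus; on both kinds of pairs \<open>u\<close> and \<open>v\<close> agree.
\<close>

lemma ball_interactions_le:
  assumes even: "\<And>t. \<Phi> (- t) = \<Phi> t"
    and u [measurable]: "u \<in> borel_measurable borel" and v [measurable]: "v \<in> borel_measurable borel"
    and eq: "\<And>x. x \<in> ball 0 (R + 1) \<Longrightarrow> v x = u x"
  shows "levy_interaction \<Phi> \<nu> u (ball 0 R) (ball 0 R) / 2 + levy_interaction \<Phi> \<nu> u (ball 0 R) (- ball 0 R)
    \<le> levy_energy \<Phi> \<nu> v / 2 + levy_interaction \<Phi> \<nu> u (ball 0 R) (- ball 0 (R + 1))"
proof -
  interpret sigma_finite_measure \<nu> by (rule sigma_finite_nu)
  note [measurable_cong] = sets_nu
  define B where "B = ball (0::'a) R"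
  define M where "M = ball (0::'a) (R + 1) - ball 0 R"
  have [measurable]: "B \<in> sets borel" "M \<in> sets borel" by (auto simp: B_def M_def)
  let ?Q = "levy_interaction \<Phi> \<nu> u"
  let ?h = "\<lambda>A B x z. ennreal (\<Phi> (u x - u (x + z))) * indicator A x * indicator B (x + z) :: ennreal"
  have out: "?Q B (- B) = ?Q B M + ?Q B (- ball 0 (R + 1))"
  proof -
    have "?h B (- B) x z = ?h B M x z + ?h B (- ball 0 (R + 1)) x z" for x z
      by (auto simp: B_def M_def indicator_def)
    then show ?thesis unfolding levy_interaction_def
      by (simp add: nn_integral_add)
  qed
  have "?Q B B + ?Q B M + ?Q M B = (\<integral>\<^sup>+x. (\<integral>\<^sup>+z. ?h B B x z + ?h B M x z + ?h M B x z \<partial>\<nu>) \<partial>lborel)"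
    unfolding levy_interaction_def by (simp add: nn_integral_add)
  also have "\<dots> \<le> levy_energy \<Phi> \<nu> v"
    unfolding levy_energy_def
  proof (intro nn_integral_mono)
    fix x z
    show "?h B B x z + ?h B M x z + ?h M B x z \<le> ennreal (\<Phi> (v x - v (x + z)))"
      using eq[of x] eq[of "x + z"] by (auto simp: B_def M_def indicator_def)
  qed
  finally have main: "?Q B B + ?Q B M + ?Q B M \<le> levy_energy \<Phi> \<nu> v"
    using levy_interaction_commute[OF even, of u B M] by simp
  have "x + x = x * 2" for x :: ennreal by (simp add: mult_2_right)
  then have half: "(x + x) / 2 = x" for x :: ennreal using ennreal_mult_divide_eq[of 2 x] by simp
  have "?Q B B / 2 + ?Q B M = (?Q B B + ?Q B M + ?Q B M) / 2"
    by (simp add: add.assoc add_divide_distrib_ennreal[of "?Q B B"] half)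
  also have "\<dots> \<le> levy_energy \<Phi> \<nu> v / 2" by (intro divide_right_mono_ennreal main)
  finally show ?thesis using out by (simp add: B_def add.assoc[symmetric] add_right_mono)
qed

end

section \<open>The energy estimate\<close>

text \<open>
  The Lipschitz profile that is \<open>1\<close> on the ball of radius \<open>R + 1\<close> and \<open>- 1\<close> outside that of radius
  \<open>R + 2\<close>.
\<close>

definition cutoff :: "real \<Rightarrow> 'a::euclidean_space \<Rightarrow> real" where
  "cutoff R x = 2 * max 0 (min 1 (R + 2 - norm x)) - 1"

lemma cutoff_simps:
  "norm x \<le> R + 1 \<Longrightarrow> cutoff R x = 1" "R + 2 \<le> norm x \<Longrightarrow> cutoff R x = -1"
  by (auto simp: cutoff_def)

lemma cutoff_bound: "\<bar>cutoff R x\<bar> \<le> 1"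
  by (auto simp: cutoff_def abs_le_iff min_def max_def)

lemma continuous_cutoff: "continuous_on UNIV (cutoff R)"
  unfolding cutoff_def by (intro continuous_intros)

lemma cutoff_difference: "\<bar>cutoff R x - cutoff R (x + z)\<bar> \<le> 2 * min 1 (norm z)"
proof -
  have "\<bar>norm x - norm (x + z)\<bar> \<le> norm z"
    using norm_triangle_ineq3[of x "x + z"] by simp
  then show ?thesis by (auto simp: cutoff_def min_def max_def)
qed

lemma emeasure_ball_diff_le:
  assumes "a \<le> b" "0 \<le> b" "b \<le> L"
  shows "emeasure lborel (ball (0::'a::euclidean_space) b - ball 0 a)
    \<le> ennreal (unit_ball_vol (real DIM('a)) * real DIM('a) * L ^ (DIM('a) - 1) * (b - a))"
proof -
  let ?V = "unit_ball_vol (real DIM('a))"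
  have "emeasure lborel (ball (0::'a) b - ball 0 a) \<le> emeasure lborel (ball (0::'a) b)"
    by (intro emeasure_mono) auto
  also have "\<dots> < \<infinity>" by (rule emeasure_lborel_ball_finite)
  finally have "emeasure lborel (ball (0::'a) b - ball 0 a) = ennreal (measure lborel (ball (0::'a) b - ball 0 a))"
    by (intro emeasure_eq_ennreal_measure) auto
  also have "measure lborel (ball (0::'a) b - ball 0 a) = measure lborel (ball (0::'a) b) - measure lborel (ball (0::'a) a)"
    using emeasure_lborel_ball_finite[of "0::'a" b] assms by (intro measure_Diff) auto
  also have "\<dots> \<le> ?V * real DIM('a) * b ^ (DIM('a) - 1) * (b - a)"
    by (rule measure_ball_diff_le) (use assms in auto)
  also have "\<dots> \<le> ?V * real DIM('a) * L ^ (DIM('a) - 1) * (b - a)"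
    using assms by (intro mult_right_mono mult_left_mono power_mono) auto
  finally show ?thesis by (simp add: ennreal_leI)
qed

context levy_convex begin

text \<open>
  The area of the sphere of radius \<open>R + 2\<close>, which bounds the volume of annuli in the ball of that
  radius per unit of width.
\<close>

definition outer_sphere_area :: "real \<Rightarrow> real" where
  "outer_sphere_area R = unit_ball_vol (real DIM('a)) * real DIM('a) * (R + 2) ^ (DIM('a) - 1)"

lemma outer_sphere_area_nonneg: "R > 0 \<Longrightarrow> 0 \<le> outer_sphere_area R"
  by (simp add: outer_sphere_area_def)

text \<open>
  The increment of the cutoff over a jump \<open>z\<close> is at most \<open>2 min 1 |z|\<close>, and it vanishes unless one of the
  two end points lies in the annulus between the radii \<open>R + 1 - |z|\<close> and \<open>R + 2\<close>.
\<close>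

lemma cutoff_energy_le:
  assumes growth: "\<And>t. 0 \<le> t \<Longrightarrow> \<Phi> t \<le> C * t powr \<beta>" and mono: "\<And>s t. \<bar>s\<bar> \<le> t \<Longrightarrow> \<Phi> s \<le> \<Phi> t"
    and C: "C \<ge> 0" and \<beta>: "\<beta> > 0" and R: "R > 0"
  shows "levy_energy \<Phi> \<nu> (cutoff R) \<le> ennreal (2 * C * 2 powr \<beta> * outer_sphere_area R)
     * (\<integral>\<^sup>+z. ennreal ((1 + norm z) * min 1 (norm z powr \<beta>)) \<partial>\<nu>)"
proof -
  note [measurable_cong] = sets_nu
  have [measurable]: "cutoff R \<in> borel_measurable borel"
    by (rule borel_measurable_continuous_onI) (rule continuous_cutoff)
  let ?\<psi> = "cutoff R :: 'a \<Rightarrow> real"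
  have "levy_energy \<Phi> \<nu> ?\<psi> = (\<integral>\<^sup>+z. (\<integral>\<^sup>+x. ennreal (\<Phi> (?\<psi> x - ?\<psi> (x + z))) \<partial>lborel) \<partial>\<nu>)"
    unfolding levy_energy_def by (rule nn_integral_swap_nu) measurable
  also have "\<dots> \<le> (\<integral>\<^sup>+z. ennreal (2 * C * 2 powr \<beta> * outer_sphere_area R) * ennreal ((1 + norm z) * min 1 (norm z powr \<beta>)) \<partial>\<nu>)"
  proof (rule nn_integral_mono)
    fix z :: 'a
    define S where "S = ball (0::'a) (R + 2) - ball 0 (R + 1 - norm z)"
    have [measurable]: "S \<in> sets borel" by (simp add: S_def)
    define H where "H = C * 2 powr \<beta> * min 1 (norm z powr \<beta>)"
    have H: "0 \<le> H" using C by (simp add: H_def)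
    have ptw: "ennreal (\<Phi> (?\<psi> x - ?\<psi> (x + z))) \<le> ennreal H * (indicator S x + indicator S (x + z))" for x
    proof (cases "?\<psi> x = ?\<psi> (x + z)")
      case False
      have near: "\<bar>norm x - norm (x + z)\<bar> \<le> norm z"
        using norm_triangle_ineq3[of x "x + z"] by simp
      have "\<not> (norm x \<le> R + 1 \<and> norm (x + z) \<le> R + 1)" "\<not> (R + 2 \<le> norm x \<and> R + 2 \<le> norm (x + z))"
        using False cutoff_simps by metis+
      then have "x \<in> S \<or> x + z \<in> S" using near unfolding S_def by auto
      then have one: "(1::ennreal) \<le> indicator S x + indicator S (x + z)"
        by (auto simp: indicator_def)
      have "\<Phi> (?\<psi> x - ?\<psi> (x + z)) \<le> \<Phi> (2 * min 1 (norm z))" by (intro mono cutoff_difference)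
      also have "\<dots> \<le> C * (2 * min 1 (norm z)) powr \<beta>" by (intro growth) simp
      also have "(2 * min 1 (norm z)) powr \<beta> = 2 powr \<beta> * min 1 (norm z powr \<beta>)"
        using \<beta> powr_mono2[of \<beta> "norm z" 1] powr_mono2[of \<beta> 1 "norm z"]
        by (auto simp: powr_mult min_def)
      finally have "ennreal (\<Phi> (?\<psi> x - ?\<psi> (x + z))) \<le> ennreal H * 1"
        by (simp add: H_def mult.assoc ennreal_leI)
      also have "\<dots> \<le> ennreal H * (indicator S x + indicator S (x + z))" by (intro mult_left_mono one) simp
      finally show ?thesis .
    qed (simp add: Phi_0)
    have "(\<integral>\<^sup>+x. ennreal (\<Phi> (?\<psi> x - ?\<psi> (x + z))) \<partial>lborel) \<le> (\<integral>\<^sup>+x. ennreal H * (indicator S x + indicator S (x + z)) \<partial>lborel)"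
      by (intro nn_integral_mono ptw)
    also have "\<dots> = ennreal H * ((\<integral>\<^sup>+x. indicator S x \<partial>lborel) + (\<integral>\<^sup>+x. indicator S (x + z) \<partial>lborel))"
      by (subst nn_integral_cmult) (auto simp: nn_integral_add)
    also have "(\<integral>\<^sup>+x. indicator S (x + z) \<partial>lborel) = (\<integral>\<^sup>+x. indicator S x \<partial>lborel)"
      by (rule nn_integral_translate) measurable
    also have "(\<integral>\<^sup>+x. indicator S x \<partial>lborel) = emeasure lborel S" by simp
    also have "ennreal H * (emeasure lborel S + emeasure lborel S)
        \<le> ennreal H * (ennreal (outer_sphere_area R * (1 + norm z)) + ennreal (outer_sphere_area R * (1 + norm z)))"
    proof -
      have "emeasure lborel S \<le> ennreal (outer_sphere_area R * ((R + 2) - (R + 1 - norm z)))"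
        unfolding S_def outer_sphere_area_def by (rule emeasure_ball_diff_le) (use R in \<open>auto intro: order_trans[OF _ norm_ge_zero]\<close>)
      also have "(R + 2) - (R + 1 - norm z) = 1 + norm z" by simp
      finally show ?thesis by (intro mult_left_mono add_mono) auto
    qed
    also have "\<dots> = ennreal (H * (outer_sphere_area R * (1 + norm z) + outer_sphere_area R * (1 + norm z)))"
    proof -
      have b: "0 \<le> outer_sphere_area R * (1 + norm z)" using outer_sphere_area_nonneg[OF R] by simp
      show ?thesis
        unfolding ennreal_plus[OF b b, symmetric] by (rule ennreal_mult[symmetric]) (use H b in simp_all)
    qed
    also have "\<dots> = ennreal (2 * C * 2 powr \<beta> * outer_sphere_area R) * ennreal ((1 + norm z) * min 1 (norm z powr \<beta>))"
      using C outer_sphere_area_nonneg[OF R] by (subst ennreal_mult[symmetric]) (auto simp: H_def algebra_simps)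
    finally show "(\<integral>\<^sup>+x. ennreal (\<Phi> (?\<psi> x - ?\<psi> (x + z))) \<partial>lborel)
       \<le> ennreal (2 * C * 2 powr \<beta> * outer_sphere_area R) * ennreal ((1 + norm z) * min 1 (norm z powr \<beta>))" .
  qed
  also have "\<dots> = ennreal (2 * C * 2 powr \<beta> * outer_sphere_area R)
     * (\<integral>\<^sup>+z. ennreal ((1 + norm z) * min 1 (norm z powr \<beta>)) \<partial>\<nu>)"
    by (rule nn_integral_cmult) measurable
  finally show ?thesis .
qed

text \<open>
  Jumps out of the ball of radius \<open>R\<close> past radius \<open>R + 1\<close> have length at least \<open>1\<close>, and their starting
  points lie within distance \<open>|z|\<close> of the sphere of radius \<open>R\<close>.
\<close>

lemma far_interaction_le:
  assumes mono: "\<And>s t. \<bar>s\<bar> \<le> t \<Longrightarrow> \<Phi> s \<le> \<Phi> t" and \<beta>: "\<beta> > 0" and R: "R > 0"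
    and u [measurable]: "u \<in> borel_measurable borel" and ub: "\<And>x. \<bar>u x\<bar> \<le> 1"
  shows "levy_interaction \<Phi> \<nu> u (ball 0 R) (- ball 0 (R + 1)) \<le> ennreal (\<Phi> 2 * outer_sphere_area R)
     * (\<integral>\<^sup>+z. ennreal ((1 + norm z) * min 1 (norm z powr \<beta>)) \<partial>\<nu>)"
proof -
  note [measurable_cong] = sets_nu
  define B where "B = ball (0::'a) R"
  define B' where "B' = - ball (0::'a) (R + 1)"
  have [measurable]: "B \<in> sets borel" "B' \<in> sets borel" by (auto simp: B_def B'_def)
  have "levy_interaction \<Phi> \<nu> u B B'
      = (\<integral>\<^sup>+z. (\<integral>\<^sup>+x. ennreal (\<Phi> (u x - u (x + z))) * indicator B x * indicator B' (x + z) \<partial>lborel) \<partial>\<nu>)"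
    unfolding levy_interaction_def by (rule nn_integral_swap_nu) measurable
  also have "\<dots> \<le> (\<integral>\<^sup>+z. ennreal (\<Phi> 2 * outer_sphere_area R) * ennreal ((1 + norm z) * min 1 (norm z powr \<beta>)) \<partial>\<nu>)"
  proof (rule nn_integral_mono)
    fix z :: 'a
    let ?I = "\<integral>\<^sup>+x. ennreal (\<Phi> (u x - u (x + z))) * indicator B x * indicator B' (x + z) \<partial>lborel"
    show "?I \<le> ennreal (\<Phi> 2 * outer_sphere_area R) * ennreal ((1 + norm z) * min 1 (norm z powr \<beta>))"
    proof (cases "norm z < 1")
      case True
      have "ennreal (\<Phi> (u x - u (x + z))) * indicator B x * indicator B' (x + z) = 0" for x
        using norm_triangle_ineq[of x z] True by (auto simp: B_def B'_def indicator_def)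
      then have "?I = 0" by (simp only: nn_integral_const mult_zero_left)
      then show ?thesis by simp
    next
      case False
      define S where "S = ball (0::'a) R - ball 0 (R - norm z)"
      have "?I \<le> (\<integral>\<^sup>+x. ennreal (\<Phi> 2) * indicator S x \<partial>lborel)"
      proof (rule nn_integral_mono)
        fix x
        have "\<bar>u x - u (x + z)\<bar> \<le> 2" using ub[of x] ub[of "x + z"] by linarith
        then have "ennreal (\<Phi> (u x - u (x + z))) \<le> ennreal (\<Phi> 2)" by (intro ennreal_leI mono)
        moreover have "x \<in> S" if "x \<in> B" "x + z \<in> B'"
          using that norm_triangle_ineq[of x z] by (auto simp: B_def B'_def S_def)
        ultimately show "ennreal (\<Phi> (u x - u (x + z))) * indicator B x * indicator B' (x + z) \<le> ennreal (\<Phi> 2) * indicator S x"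
          by (auto simp: indicator_def)
      qed
      also have "\<dots> = ennreal (\<Phi> 2) * emeasure lborel S"
        by (rule nn_integral_cmult_indicator) (simp add: S_def)
      also have "\<dots> \<le> ennreal (\<Phi> 2) * ennreal (outer_sphere_area R * (R - (R - norm z)))"
        unfolding S_def outer_sphere_area_def by (intro mult_left_mono emeasure_ball_diff_le) (use R in auto)
      also have "\<dots> = ennreal (\<Phi> 2 * outer_sphere_area R * norm z)"
        using outer_sphere_area_nonneg[OF R] Phi_nonneg[of 2] by (subst ennreal_mult[symmetric]) (auto simp: mult_ac)
      also have "\<dots> \<le> ennreal (\<Phi> 2 * outer_sphere_area R * ((1 + norm z) * min 1 (norm z powr \<beta>)))"
      proof (intro ennreal_leI mult_left_mono)
        have "1 \<le> norm z powr \<beta>" using False \<beta> by (intro ge_one_powr_ge_zero) auto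
        then show "norm z \<le> (1 + norm z) * min 1 (norm z powr \<beta>)" by simp
      qed (use outer_sphere_area_nonneg[OF R] Phi_nonneg[of 2] in auto)
      also have "\<dots> = ennreal (\<Phi> 2 * outer_sphere_area R) * ennreal ((1 + norm z) * min 1 (norm z powr \<beta>))"
        using outer_sphere_area_nonneg[OF R] Phi_nonneg[of 2] by (intro ennreal_mult) auto
      finally show ?thesis .
    qed
  qed
  also have "\<dots> = ennreal (\<Phi> 2 * outer_sphere_area R)
     * (\<integral>\<^sup>+z. ennreal ((1 + norm z) * min 1 (norm z powr \<beta>)) \<partial>\<nu>)"
    by (rule nn_integral_cmult) measurable
  finally show ?thesis unfolding B_def B'_def .
qed

end

text \<open>
  Comparison with the cutoff. In the potential terms the ball of radius \<open>R\<close> cancels exactly, because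
  there the cutoff equals \<open>1\<close> and \<open>F 1 = 0\<close>.
\<close>

lemma (in monotone_layer) layer_energy_le:
  assumes even: "\<And>t. \<Phi> (- t) = \<Phi> t" and mono: "\<And>s t. \<bar>s\<bar> \<le> t \<Longrightarrow> \<Phi> s \<le> \<Phi> t"
    and growth: "\<And>t. 0 \<le> t \<Longrightarrow> \<Phi> t \<le> C * t powr \<beta>" and C: "C \<ge> 0" and \<beta>: "\<beta> > 0" and R: "R > 0"
    and F1: "F 1 = 0" and M: "\<And>t. \<bar>t\<bar> \<le> 1 \<Longrightarrow> \<bar>F t\<bar> \<le> M"
    and m: "(\<integral>\<^sup>+z. ennreal ((1 + norm z) * min 1 (norm z powr \<beta>)) \<partial>\<nu>) = ennreal m" "m \<ge> 0"
  shows "enn2ereal (levy_interaction \<Phi> \<nu> u (ball 0 R) (ball 0 R) / 2 + levy_interaction \<Phi> \<nu> u (ball 0 R) (- ball 0 R))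
      - ereal (\<integral>x. indicator (ball 0 R) x * F (u x) \<partial>lborel)
    \<le> ereal (outer_sphere_area R * (C * 2 powr \<beta> * m + \<Phi> 2 * m + 4 * M))"
proof -
  let ?\<psi> = "cutoff R :: 'a \<Rightarrow> real"
  let ?v = "\<lambda>x. min (?\<psi> x) (u x)"
  let ?B = "ball (0::'a) R" and ?B2 = "ball (0::'a) (R + 2)"
  note s = outer_sphere_area_nonneg[OF R]
  have M0: "0 \<le> M" using M[of 0] by simp
  have psi: "continuous_on UNIV ?\<psi>" "\<bar>?\<psi> x\<bar> \<le> 1" "x \<notin> ?B2 \<Longrightarrow> ?\<psi> x = -1" for x
    by (auto simp: continuous_cutoff cutoff_bound cutoff_simps)
  have [measurable]: "u \<in> borel_measurable borel" "?\<psi> \<in> borel_measurable borel"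
    using u_continuous psi by (auto intro: borel_measurable_continuous_onI)
  have v_cont: "continuous_on UNIV ?v" by (intro continuous_intros psi u_continuous)
  have v_bound: "\<bar>?v x\<bar> \<le> 1" for x
    using u_bound[of x] psi(2)[of x] by (auto simp: min_def abs_le_iff)
  have v_eq: "?v x = u x" if "x \<in> ball 0 (R + 1)" for x
    using that u_bound[of x] by (simp add: cutoff_simps abs_le_iff)
  have e_psi: "levy_energy \<Phi> \<nu> ?\<psi> \<le> ennreal (2 * C * 2 powr \<beta> * outer_sphere_area R * m)"
    using cutoff_energy_le[OF growth mono C \<beta> R] C s m by (simp add: ennreal_mult)
  then have fin: "levy_energy \<Phi> \<nu> ?\<psi> < \<infinity>" by (rule le_less_trans) simp
  define I where "I = enn2real (levy_energy \<Phi> \<nu> ?\<psi>)"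
  have I: "I \<le> 2 * C * 2 powr \<beta> * outer_sphere_area R * m"
    unfolding I_def by (rule enn2real_leI[OF _ e_psi]) (use C s m in auto)
  define J where "J = (\<integral>x. indicator ?B2 x * (F (?v x) - F (?\<psi> x)) \<partial>lborel)"
  have min: "levy_energy \<Phi> \<nu> ?v \<le> ennreal (I + 2 * J)" "0 \<le> I + 2 * J"
    using minimality[OF psi fin] unfolding I_def J_def by auto
  define P where "P = (\<integral>x. indicator ?B x * F (u x) \<partial>lborel)"
  have far: "levy_interaction \<Phi> \<nu> u ?B (- ball 0 (R + 1)) \<le> ennreal (\<Phi> 2 * outer_sphere_area R * m)"
    using far_interaction_le[OF mono \<beta> R _ u_bound] s m Phi_nonneg[of 2] by (simp add: ennreal_mult)
  have "levy_interaction \<Phi> \<nu> u ?B ?B / 2 + levy_interaction \<Phi> \<nu> u ?B (- ?B)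
      \<le> levy_energy \<Phi> \<nu> ?v / 2 + levy_interaction \<Phi> \<nu> u ?B (- ball 0 (R + 1))"
    by (rule ball_interactions_le[OF even _ _ v_eq]) measurable
  also have "\<dots> \<le> ennreal (I + 2 * J) / 2 + ennreal (\<Phi> 2 * outer_sphere_area R * m)"
    by (intro add_mono divide_right_mono_ennreal min far)
  also have "\<dots> = ennreal ((I + 2 * J) / 2 + \<Phi> 2 * outer_sphere_area R * m)"
  proof -
    have "ennreal (I + 2 * J) / 2 = ennreal ((I + 2 * J) / 2)"
      using divide_ennreal[OF min(2), of 2] by simp
    then show ?thesis using min(2) s m Phi_nonneg[of 2] by (subst ennreal_plus) auto
  qed
  finally have X: "levy_interaction \<Phi> \<nu> u ?B ?B / 2 + levy_interaction \<Phi> \<nu> u ?B (- ?B)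
      \<le> ennreal ((I + 2 * J) / 2 + \<Phi> 2 * outer_sphere_area R * m)" .
  \<comment> \<open>Only the annulus between the radii R and R + 2 contributes, and |F| is at most M on [-1, 1].\<close>
  have pot: "J - P \<le> 4 * M * outer_sphere_area R"
  proof -
    have iu: "integrable lborel (\<lambda>x. indicator ?B x * F (u x))"
      using continuous_on_compose2[OF F_continuous u_continuous]
      by (intro integrable_indicator_continuous) auto
    have iv: "integrable lborel (\<lambda>x. indicator ?B2 x * (F (?v x) - F (?\<psi> x)))"
      by (intro integrable_F_difference v_cont psi v_bound)
    have fin2: "emeasure lborel (?B2 - ?B) < \<infinity>"
      using emeasure_ball_diff_le[where ?'a = 'a, of R "R + 2" "R + 2"] R by (auto intro: le_less_trans)
    have "J - P = (\<integral>x. indicator ?B2 x * (F (?v x) - F (?\<psi> x)) - indicator ?B x * F (u x) \<partial>lborel)"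
      unfolding J_def P_def using iu iv by simp
    also have "\<dots> \<le> (\<integral>x. 2 * M * indicator (?B2 - ?B) x \<partial>lborel)"
    proof (rule integral_mono)
      show "integrable lborel (\<lambda>x. 2 * M * indicator (?B2 - ?B) x)"
        using fin2 by (intro integrable_mult_right integrable_real_indicator) auto
      fix x
      show "indicator ?B2 x * (F (?v x) - F (?\<psi> x)) - indicator ?B x * F (u x) \<le> 2 * M * indicator (?B2 - ?B) x"
      proof (cases "x \<in> ?B")
        case True
        then have "?v x = u x" "?\<psi> x = 1" using v_eq[of x] by (auto simp: cutoff_simps)
        then show ?thesis using True F1 by simp
      next
        case False
        have "F (?v x) - F (?\<psi> x) \<le> 2 * M" using M[OF v_bound[of x]] M[OF psi(2)[of x]] by linarith
        then show ?thesis using False by (auto simp: indicator_def)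
      qed
    qed (use iu iv in auto)
    also have "\<dots> = 2 * M * measure lborel (?B2 - ?B)" by simp
    also have "\<dots> \<le> 2 * M * (outer_sphere_area R * 2)"
    proof (intro mult_left_mono)
      have "emeasure lborel (?B2 - ?B) \<le> ennreal (outer_sphere_area R * 2)"
        using emeasure_ball_diff_le[where ?'a = 'a, of R "R + 2" "R + 2"] R by (simp add: outer_sphere_area_def)
      then show "measure lborel (?B2 - ?B) \<le> outer_sphere_area R * 2"
        using s by (simp add: measure_def enn2real_leI)
    qed (use M0 in auto)
    finally show ?thesis by simp
  qed
  have "enn2ereal (levy_interaction \<Phi> \<nu> u ?B ?B / 2 + levy_interaction \<Phi> \<nu> u ?B (- ?B)) - ereal P
      \<le> ereal ((I + 2 * J) / 2 + \<Phi> 2 * outer_sphere_area R * m) - ereal P"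
  proof (intro ereal_minus_mono order_refl)
    have "enn2ereal (levy_interaction \<Phi> \<nu> u ?B ?B / 2 + levy_interaction \<Phi> \<nu> u ?B (- ?B))
        \<le> enn2ereal (ennreal ((I + 2 * J) / 2 + \<Phi> 2 * outer_sphere_area R * m))"
      using X by (simp add: less_eq_ennreal.rep_eq)
    also have "\<dots> = ereal ((I + 2 * J) / 2 + \<Phi> 2 * outer_sphere_area R * m)"
      using min(2) s m Phi_nonneg[of 2] by (intro enn2ereal_ennreal) auto
    finally show "enn2ereal (levy_interaction \<Phi> \<nu> u ?B ?B / 2 + levy_interaction \<Phi> \<nu> u ?B (- ?B))
        \<le> ereal ((I + 2 * J) / 2 + \<Phi> 2 * outer_sphere_area R * m)" .
  qed
  also have "\<dots> \<le> ereal (outer_sphere_area R * (C * 2 powr \<beta> * m + \<Phi> 2 * m + 4 * M))"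
    using I pot by (simp add: algebra_simps)
  finally show ?thesis unfolding P_def .
qed

theorem theorem5p1:
  fixes k :: "'n::finite"
    and \<Phi> F f :: "real \<Rightarrow> real"
    and K c u :: "real ^ 'n \<Rightarrow> real"
    and \<alpha> \<beta> lam Lam R\<^sub>0 :: real
  assumes "nonlocal_kernel K"
    and "nonlocal_density \<Phi>"
    and "\<And>t. (F has_real_derivative f t) (at t)"
    and "continuous_on UNIV f"
    and "layer_solution k \<Phi> K f u"
    and "F 1 = 0"
    and "\<alpha> > 0" and "\<beta> \<ge> 2" and "\<beta> > \<alpha>"
    and "\<exists>C>0. \<forall>t>0. deriv \<Phi> t \<le> C * t powr (\<beta> - 1)"
    and "0 < lam" and "lam \<le> Lam"
    and "\<And>z. lam \<le> c z \<and> c z \<le> Lam"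
    and "(\<exists>r\<^sub>0. finite_range_kernel \<alpha> c r\<^sub>0 R\<^sub>0 K) \<or> decaying_kernel \<alpha> \<beta> c R\<^sub>0 K"
  shows "\<exists>C>0. \<forall>R>R\<^sub>0. energy \<Phi> K F u (ball 0 R) \<le> ereal (C * R ^ (CARD('n) - 1))"
proof -
  have K: "\<And>z. 0 \<le> K z" "\<And>z. K (- z) = K z" using assms(1) by (auto simp: nonlocal_kernel_def)
  note D = nonlocal_density_facts[OF assms(2)]
  obtain C where C: "C > 0" "\<And>t. t > 0 \<Longrightarrow> deriv \<Phi> t \<le> C * t powr (\<beta> - 1)" using assms(10) by blast
  obtain \<kappa> where \<kappa>: "\<kappa> \<in> borel_measurable borel" "\<And>z. 0 \<le> \<kappa> z" "AE z in lborel. K z = \<kappa> z"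
    "distr (density lborel (\<lambda>z. ennreal (\<kappa> z))) borel uminus = density lborel (\<lambda>z. ennreal (\<kappa> z))"
    using nonlocal_kernel_borel_version[OF assms(1)] by blast
  define \<nu> where "\<nu> = density lborel (\<lambda>z. ennreal (\<kappa> z))"
  have R0: "R\<^sub>0 > 0" using kernel_near_origin(1)[OF assms(14)] assms(13) by blast
  have near: "AE z in lborel. z \<in> ball 0 R\<^sub>0 \<longrightarrow> \<kappa> z \<le> Lam * norm z powr - (real DIM(real ^ 'n) + \<alpha>)"
    using \<kappa>(3) AE_lborel_singleton[of 0]
  proof eventually_elim
    case (elim z)
    have "K z \<le> Lam * norm z powr - (real CARD('n) + \<alpha>)" if "norm z < R\<^sub>0"
      by (rule kernel_near_origin(2)[OF assms(14)]) (use that assms(13) elim in auto)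
    then show ?case using elim by simp
  qed
  have Lam: "Lam \<ge> 0" using assms(11,12) by simp
  have moment: "(\<integral>\<^sup>+z. ennreal ((1 + norm z) * min 1 (norm z powr \<beta>)) \<partial>\<nu>) < \<infinity>"
    unfolding \<nu>_def
    by (rule finite_kernel_moment[OF \<kappa>(1) near kernel_first_moment_at_infinity[OF assms(14,8) K(1) \<kappa>(1,3)] Lam R0 assms(9,7)])
  interpret levy_measure \<nu>
    unfolding \<nu>_def by (rule levy_measure_of_moment[OF \<kappa>(1,4) moment[unfolded \<nu>_def]]) (use assms(8) in simp)
  interpret levy_convex \<nu> \<Phi> "deriv \<Phi>" R\<^sub>0
  proof
    show "\<exists>C. \<forall>p \<epsilon>. norm p \<le> P \<longrightarrow> \<epsilon> > 0 \<longrightarrow>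
       (\<integral>z. indicator (ball 0 R\<^sub>0) z * deriv \<Phi> (p \<bullet> z + q * (norm z)\<^sup>2) \<partial>cut \<nu> \<epsilon>) \<le> C" if "q > 0" for q P
      by (rule one_sided_singular_bound[OF \<nu>_def \<kappa>(1) near Lam R0 assms(9,7,8) that D(6,7,8) less_imp_le[OF C(1)] C(2)])
  qed (use D R0 in auto)
  have u_cont: "continuous_on UNIV u" using assms(5) unfolding layer_solution_def by blast
  have u_meas: "u \<in> borel_measurable borel" using u_cont by (rule borel_measurable_continuous_onI)
  have ub: "\<bar>u x\<bar> \<le> 1" for x by (rule layer_bounds[OF assms(5)])
  interpret monotone_layer \<nu> \<Phi> "deriv \<Phi>" R\<^sub>0 u F f "axis k 1"
  proof
    show "u (x + s *\<^sub>R axis k 1) \<le> u (x + t *\<^sub>R axis k 1)" if "s \<le> t" for x s t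
      by (rule layer_shift_monotone[OF assms(5) that])
    show "((\<lambda>t. u (x + t *\<^sub>R axis k 1)) \<longlongrightarrow> 1) at_top" for x by (rule layer_shift_limit[OF assms(5)])
    show "((\<lambda>\<epsilon>. \<integral>z. deriv \<Phi> (u x - u (x + z)) \<partial>cut \<nu> \<epsilon>) \<longlongrightarrow> f (u x)) (at_right 0)" for x
    proof (rule Lim_transform_eventually)
      have T: "has_T \<Phi> K u x (f (u x))" using assms(5) unfolding layer_solution_def by blast
      then show "((\<lambda>\<epsilon>. LINT y:(- ball x \<epsilon>)|lebesgue. T_integrand \<Phi> K u x y) \<longlongrightarrow> f (u x)) (at_right 0)"
        unfolding has_T_def by blast
      show "\<forall>\<^sub>F \<epsilon> in at_right 0. (LINT y:(- ball x \<epsilon>)|lebesgue. T_integrand \<Phi> K u x y)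
          = (\<integral>z. deriv \<Phi> (u x - u (x + z)) \<partial>cut \<nu> \<epsilon>)"
        using eventually_at_right_less[of 0]
      proof eventually_elim
        case (elim \<epsilon>)
        then have "set_integrable lebesgue (- ball x \<epsilon>) (T_integrand \<Phi> K u x)"
          using T unfolding has_T_def by blast
        then show ?case unfolding \<nu>_def
          by (intro principal_value_eq_cut \<kappa> u_meas measurable_PhiG)
      qed
    qed
  qed (use u_cont ub assms(3,4) in auto)
  have "compact (F ` {-1..1})"
    using F_continuous by (auto intro!: compact_continuous_image intro: continuous_on_subset)
  then obtain M where "\<forall>y\<in>F ` {-1..1}. norm y \<le> M"
    by (meson bounded_iff compact_imp_bounded)
  then have M: "\<bar>F t\<bar> \<le> M" if "\<bar>t\<bar> \<le> 1" for t using that by (auto simp: abs_le_iff)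
  define m where "m = enn2real (\<integral>\<^sup>+z. ennreal ((1 + norm z) * min 1 (norm z powr \<beta>)) \<partial>\<nu>)"
  have m: "(\<integral>\<^sup>+z. ennreal ((1 + norm z) * min 1 (norm z powr \<beta>)) \<partial>\<nu>) = ennreal m" "m \<ge> 0"
    using moment by (simp_all add: m_def)
  define E where "E = C * 2 powr \<beta> * m + \<Phi> 2 * m + 4 * M"
  have E: "E \<ge> 0" using C m M[of 0] Phi_nonneg[of 2] by (simp add: E_def)
  \<comment> \<open>Since R exceeds \<open>R\<^sub>0\<close>, the radius R + 2 is at most \<open>(1 + 2 / R\<^sub>0) R\<close>.\<close>
  define V where "V = unit_ball_vol (real CARD('n)) * real CARD('n) * (1 + 2 / R\<^sub>0) ^ (CARD('n) - 1)"
  have V: "V \<ge> 0" using R0 by (simp add: V_def)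
  have "energy \<Phi> K F u (ball 0 R) \<le> ereal ((V * E + 1) * R ^ (CARD('n) - 1))" if R: "R > R\<^sub>0" for R
  proof -
    have Rpos: "R > 0" using R R0 by simp
    have i: "interaction \<Phi> K u (ball 0 R) A = levy_interaction \<Phi> \<nu> u (ball 0 R) A" if "A \<in> sets borel" for A
      unfolding \<nu>_def by (intro interaction_eq_levy_interaction K(2) \<kappa> measurable_PhiG Phi_nonneg u_meas that)
    have pot: "(LINT x:ball 0 R|lebesgue. F (u x)) = (\<integral>x. indicator (ball 0 R) x * F (u x) \<partial>lborel)"
    proof -
      have "(\<lambda>x. indicator (ball 0 R) x * F (u x)) \<in> borel_measurable borel"
        by (intro borel_measurable_times borel_measurable_indicator borel_measurable_continuous_onI
              continuous_on_compose2[OF F_continuous u_cont]) auto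
      then show ?thesis unfolding set_lebesgue_integral_def by (simp add: integral_completion)
    qed
    have "energy \<Phi> K F u (ball 0 R) \<le> ereal (outer_sphere_area R * E)"
      unfolding energy_def pot E_def
      using layer_energy_le[OF D(3) nonlocal_density_mono[OF assms(2)] nonlocal_density_growth[OF assms(2) C(2)]
          less_imp_le[OF C(1)] _ Rpos assms(6) M m] assms(8)
      by (simp add: i)
    also have "outer_sphere_area R * E \<le> V * R ^ (CARD('n) - 1) * E"
    proof (rule mult_right_mono[OF _ E])
      have "R + 2 \<le> (1 + 2 / R\<^sub>0) * R" using R R0 by (simp add: field_simps)
      then have "(R + 2) ^ (CARD('n) - 1) \<le> ((1 + 2 / R\<^sub>0) * R) ^ (CARD('n) - 1)"
        using Rpos by (intro power_mono) auto
      then show "outer_sphere_area R \<le> V * R ^ (CARD('n) - 1)"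
        unfolding outer_sphere_area_def V_def by (simp add: power_mult_distrib mult.assoc mult_left_mono)
    qed
    also have "\<dots> \<le> (V * E + 1) * R ^ (CARD('n) - 1)" using Rpos by (simp add: algebra_simps)
    finally show ?thesis by simp
  qed
  then show ?thesis using V E by (intro exI[of _ "V * E + 1"]) (simp add: add_nonneg_pos)
qed

end
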